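(* Consider the inhomogeneous spiked Wigner matrix model with block-structured (possibly infinite) variances $\Delta^{(N)}$ having parameters $(\bar\Delta,\rho_1,\dots,\rho_n)$. Let $\kappa\ge1$ be fixed, let $\nu$ be a probability measure on $\mathbb{R}^\kappa$ (not depending on $N$), and let $\mathcal{P}_N$ be the law of the random matrix $V\in\mathbb{R}^{N\times\kappa}$ with i.i.d. rows drawn from $\nu$. Let the signal law $\mathcal{X}_N$ be the law of $X=\frac{\beta}{\sqrt N}VV^\top$ with $V\sim\mathcal{P}_N$, for some constant $\beta>0$. Let $$\beta_* := \sqrt{\frac{1}{\lambda_1(\mathrm{diag}(\rho)^{1/2}\, \bar{\Phi}\, \mathrm{diag}(\rho)^{1/2})}},$$ where $\bar\Phi$ is the entrywise reciprocal of $\bar\Delta$. Then the following hold. 1. (Computational lower bound) Suppose that (a) $\mathbb{E}_{x\sim\nu}[x]=0$; (b) $\|\mathrm{Cov}_{x\sim\nu}[x]\| = \|\mathbb{E}_{x\sim\nu}xx^\top\|\le 1$; (c) $\nu$ has bounded support. If $\beta<\beta_*$, then there is no sequence of polynomials $f_N\in\mathbb{R}[Y]$ with $\deg(f_N)=o(N/\log N)$ that achieves strong separation. 2. (Statistical lower bound) Suppose that (a), (b), (c) hold and also (d) when $x,x'\sim\nu$ are i.i.d., the random vector $x\otimes x'\in\mathbb{R}^{\kappa^2}$ is $1$-moment-subgaussian. If $\beta<\beta_*$, then there is no sequence of functions $f_N$ that achieves strong separation, there is no sequence of tests $t_N$ that achieves strong detection, and $\chi^2(\mathbb{P}_N\mid\mathbb{Q}_N)=O(1)$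 as $N\to\infty$.
   Context: Inhomogeneous spiked Wigner matrix model: for each $N\ge1$, let $\mathcal{X}_N$ be a probability measure on real symmetric $N\times N$ matrices and $\Delta=\Delta^{(N)}\in(\mathbb{R}_{>0}\cup\{+\infty\})^{N\times N}$ symmetric (the variance profile). Let $\mathcal J=\mathcal J^{(N)}=\{(i,j):1\le i\le j\le N,\ \Delta_{ij}\ne+\infty\}$. Two probability measures on $\mathbb{R}^{\mathcal J}$ are defined: under $\mathbb{Q}_N$, $Y_{ij}\sim\mathcal N(0,\Delta_{ij})$ independently for $(i,j)\in\mathcal J$; under $\mathbb{P}_N$, first draw $X\sim\mathcal{X}_N$, then draw $Y_{ij}\sim\mathcal N(X_{ij},\Delta_{ij})$ independently for $(i,j)\in\mathcal J$. $\mathbb{R}[Y]$ denotes polynomials in the variables $Y_{ij}$, $(i,j)\in\mathcal J$. Block structure: $\Delta^{(N)}$ is block-structured with parameters $(\bar\Delta,\rho_1,\dots,\rho_n)$, where $n\ge1$ is fixed, $\rho_1,\dots,\rho_n\in(0,1]$ sum to $1$, and $\bar\Delta\in(\mathbb{R}_{>0}\cup\{+\infty\})^{n\times n}$ is symmetric, if for each $N$ there is $q=q_N:[N]\to[n]$ with $\Delta^{(N)}_{ij}=\bar\Delta_{q(i)q(j)}$ for all $i,j\in[N]$, and $|q_N^{-1}(a)|/N\to\rho_a$ as $N\to\infty$ for each $a\in[n]$. $\bar\Phi_{ab}=1/\bar\Delta_{ab}$ with the convention $1/(+\infty)=0$; $\mathrm{diag}(\rho)$ is the diagonal matrix with entries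 $\rho_1,\dots,\rho_n$; $\lambda_1$ is the largest eigenvalue; if $\bar\Phi=0$, $\beta_*=+\infty$. $\|\cdot\|$ of a matrix is the spectral norm. Strong separation: measurable functions $f_N:\mathbb{R}^{\mathcal J}\to\mathbb{R}$ (square-integrable under $\mathbb{P}_N$ and $\mathbb{Q}_N$) achieve strong separation if $\mathbb{E}_{\mathbb{P}_N}f_N(Y)-\mathbb{E}_{\mathbb{Q}_N}f_N(Y)=\omega\big(\sqrt{\mathrm{Var}_{\mathbb{Q}_N}f_N(Y)}+\sqrt{\mathrm{Var}_{\mathbb{P}_N}f_N(Y)}\big)$ as $N\to\infty$, i.e. for every $C>0$, for all sufficiently large $N$ the left side is strictly greater than $C$ times the expression inside $\omega(\cdot)$. Strong detection: measurable tests $t_N:\mathbb{R}^{\mathcal J}\to\{0,1\}$ achieve strong detection if $\mathbb{P}_N[t_N(Y)=0]+\mathbb{Q}_N[t_N(Y)=1]\to0$ as $N\to\infty$. $\chi^2(\mathbb{P}\mid\mathbb{Q})=\int(\frac{d\mathbb{P}}{d\mathbb{Q}}-1)^2d\mathbb{Q}$. Moment-subgaussianity: a symmetric real random variable $X$ (same law as $-X$) is $\sigma^2$-moment-subgaussian if $\mathbb{E}X^{2k}\le\sigma^{2k}(2k-1)!!$ for all integers $k\ge1$. A symmetric random vector $x$ is $\sigma^2$-moment-subgaussian if $\langle x,v\rangle$ is $\sigma^2$-moment-subgaussian for all unit vectors $v$. *)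

theory Defs
  imports
    "HOL-Probability.Probability"
    "HOL-Library.Poly_Mapping"
    "HOL-Library.Landau_Symbols"
begin

section \<open>The inhomogeneous spiked Wigner model\<close>

text \<open>
  Rows and columns of an \<open>N \<times> N\<close> matrix are indexed by \<open>{1..N}\<close>. A variance profile assigns
  to \<open>N\<close>, \<open>i\<close>, \<open>j\<close> the variance \<open>\<Delta> N i j\<close>, a positive extended real;
  values outside \<open>{1..N}\<close> are irrelevant.
\<close>

definition observed :: "(nat \<Rightarrow> nat \<Rightarrow> nat \<Rightarrow> ereal) \<Rightarrow> nat \<Rightarrow> (nat \<times> nat) set" where
  "observed \<Delta> N = {(i, j). 1 \<le> i \<and> i \<le> j \<and> j \<le> N \<and> \<Delta> N i j \<noteq> \<infinity>}"

definition obs_space :: "(nat \<Rightarrow> nat \<Rightarrow> nat \<Rightarrow> ereal) \<Rightarrow> nat \<Rightarrow> (nat \<times> nat \<Rightarrow> real) measure" where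
  "obs_space \<Delta> N = PiM (observed \<Delta> N) (\<lambda>_. borel)"

text \<open>Parametrised by mean and \<^emph>\<open>variance\<close>, whereas \<^const>\<open>normal_density\<close> takes the
  standard deviation.\<close>

definition gaussian :: "real \<Rightarrow> real \<Rightarrow> real measure" where
  "gaussian m v = density lborel (\<lambda>x. ennreal (normal_density m (sqrt v) x))"

definition noisy_obs ::
  "(nat \<Rightarrow> nat \<Rightarrow> nat \<Rightarrow> ereal) \<Rightarrow> nat \<Rightarrow> (nat \<times> nat \<Rightarrow> real) \<Rightarrow> (nat \<times> nat \<Rightarrow> real) measure" where
  "noisy_obs \<Delta> N X =
     PiM (observed \<Delta> N) (\<lambda>(i, j). gaussian (X (i, j)) (real_of_ereal (\<Delta> N i j)))"

definition null_law :: "(nat \<Rightarrow> nat \<Rightarrow> nat \<Rightarrow> ereal) \<Rightarrow> nat \<Rightarrow> (nat \<times> nat \<Rightarrow> real) measure" where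
  "null_law \<Delta> N = noisy_obs \<Delta> N (\<lambda>_. 0)"

definition planted_law ::
  "(nat \<Rightarrow> nat \<Rightarrow> nat \<Rightarrow> ereal) \<Rightarrow> (nat \<Rightarrow> (nat \<times> nat \<Rightarrow> real) measure) \<Rightarrow> nat \<Rightarrow>
     (nat \<times> nat \<Rightarrow> real) measure" where
  "planted_law \<Delta> signal N = bind (signal N) (noisy_obs \<Delta> N)"

text \<open>The law of \<open>(\<beta> / \<surd>N) V V\<^sup>T\<close>, where \<open>V i\<close> is the \<open>i\<close>-th row of \<open>V\<close>.\<close>

definition matrix_space :: "nat \<Rightarrow> (nat \<times> nat \<Rightarrow> real) measure" where
  "matrix_space N = PiM ({1..N} \<times> {1..N}) (\<lambda>_. borel)"

definition iid_rows :: "(real ^ 'k) measure \<Rightarrow> nat \<Rightarrow> (nat \<Rightarrow> real ^ 'k) measure" where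
  "iid_rows \<nu> N = PiM {1..N} (\<lambda>_. \<nu>)"

definition spike_law ::
  "real \<Rightarrow> (real ^ 'k) measure \<Rightarrow> nat \<Rightarrow> (nat \<times> nat \<Rightarrow> real) measure" where
  "spike_law \<beta> \<nu> N =
     distr (iid_rows \<nu> N) (matrix_space N)
       (\<lambda>V. \<lambda>(i, j)\<in>{1..N} \<times> {1..N}. \<beta> / sqrt (real N) * (\<Sum>k\<in>UNIV. V i $ k * V j $ k))"


section \<open>Block structure and the threshold\<close>

definition block_params :: "ereal ^ 'n ^ 'n \<Rightarrow> real ^ 'n \<Rightarrow> bool" where
  "block_params \<Delta>b \<rho> \<longleftrightarrow>
     (\<forall>a b. 0 < \<Delta>b $ a $ b) \<and> (\<forall>a b. \<Delta>b $ a $ b = \<Delta>b $ b $ a) \<and>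
     (\<forall>a. 0 < \<rho> $ a \<and> \<rho> $ a \<le> 1) \<and> (\<Sum>a\<in>UNIV. \<rho> $ a) = 1"

definition block_structured ::
  "(nat \<Rightarrow> nat \<Rightarrow> nat \<Rightarrow> ereal) \<Rightarrow> ereal ^ 'n ^ 'n \<Rightarrow> real ^ 'n \<Rightarrow> bool" where
  "block_structured \<Delta> \<Delta>b \<rho> \<longleftrightarrow>
     block_params \<Delta>b \<rho> \<and>
     (\<exists>q :: nat \<Rightarrow> nat \<Rightarrow> 'n.
        (\<forall>N\<ge>1. \<forall>i\<in>{1..N}. \<forall>j\<in>{1..N}. \<Delta> N i j = \<Delta>b $ q N i $ q N j) \<and>
        (\<forall>a. (\<lambda>N. real (card {i\<in>{1..N}. q N i = a}) / real N) \<longlonglongrightarrow> \<rho> $ a))"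

text \<open>Division of extended reals satisfies \<open>1 / \<infinity> = 0\<close>.\<close>

definition recip_profile :: "ereal ^ 'n ^ 'n \<Rightarrow> real ^ 'n ^ 'n" where
  "recip_profile \<Delta>b = (\<chi> a b. real_of_ereal (1 / \<Delta>b $ a $ b))"

definition diag_matrix :: "real ^ 'n \<Rightarrow> real ^ 'n ^ 'n" where
  "diag_matrix d = (\<chi> a b. if a = b then d $ a else 0)"

definition eigenvalues :: "real ^ 'n ^ 'n \<Rightarrow> real set" where
  "eigenvalues A = {l. \<exists>v. v \<noteq> 0 \<and> A *v v = l *\<^sub>R v}"

definition max_eigenvalue :: "real ^ 'n ^ 'n \<Rightarrow> real" where
  "max_eigenvalue A = Max (eigenvalues A)"

definition beta_star :: "ereal ^ 'n ^ 'n \<Rightarrow> real ^ 'n \<Rightarrow> ereal" where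
  "beta_star \<Delta>b \<rho> =
     (let \<Phi> = recip_profile \<Delta>b; D = diag_matrix (\<chi> a. sqrt (\<rho> $ a))
      in if \<Phi> = 0 then \<infinity> else ereal (sqrt (1 / max_eigenvalue (D ** \<Phi> ** D))))"


section \<open>Multivariate polynomials\<close>

text \<open>A monomial maps variables to exponents, a polynomial maps monomials to coefficients.\<close>

type_synonym mono = "(nat \<times> nat) \<Rightarrow>\<^sub>0 nat"
type_synonym mpoly = "mono \<Rightarrow>\<^sub>0 real"

definition mpoly_vars :: "mpoly \<Rightarrow> (nat \<times> nat) set" where
  "mpoly_vars p = (\<Union>m\<in>Poly_Mapping.keys p. Poly_Mapping.keys m)"

definition mpoly_degree :: "mpoly \<Rightarrow> nat" where
  "mpoly_degree p =
     Max (insert 0 ((\<lambda>m. \<Sum>v\<in>Poly_Mapping.keys m. Poly_Mapping.lookup m v) ` Poly_Mapping.keys p))"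

definition mpoly_eval :: "mpoly \<Rightarrow> (nat \<times> nat \<Rightarrow> real) \<Rightarrow> real" where
  "mpoly_eval p Y =
     (\<Sum>m\<in>Poly_Mapping.keys p. Poly_Mapping.lookup p m *
        (\<Prod>v\<in>Poly_Mapping.keys m. Y v ^ Poly_Mapping.lookup m v))"


section \<open>Separation, detection, chi-squared divergence\<close>

definition var :: "'a measure \<Rightarrow> ('a \<Rightarrow> real) \<Rightarrow> real" where
  "var M f = (\<integral>x. (f x - (\<integral>y. f y \<partial>M))\<^sup>2 \<partial>M)"

definition square_integrable :: "'a measure \<Rightarrow> ('a \<Rightarrow> real) \<Rightarrow> bool" where
  "square_integrable M f \<longleftrightarrow> f \<in> borel_measurable M \<and> integrable M (\<lambda>x. (f x)\<^sup>2)"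

definition strong_separation ::
  "(nat \<Rightarrow> 'a measure) \<Rightarrow> (nat \<Rightarrow> 'a measure) \<Rightarrow> (nat \<Rightarrow> 'a \<Rightarrow> real) \<Rightarrow> bool" where
  "strong_separation P Q f \<longleftrightarrow>
     (\<forall>N\<ge>1. square_integrable (P N) (f N) \<and> square_integrable (Q N) (f N)) \<and>
     (\<forall>C>0. \<forall>\<^sub>F N in sequentially.
        (\<integral>y. f N y \<partial>P N) - (\<integral>y. f N y \<partial>Q N) > C * (sqrt (var (Q N) (f N)) + sqrt (var (P N) (f N))))"

definition strong_detection ::
  "(nat \<Rightarrow> 'a measure) \<Rightarrow> (nat \<Rightarrow> 'a measure) \<Rightarrow> (nat \<Rightarrow> 'a \<Rightarrow> nat) \<Rightarrow> bool" where
  "strong_detection P Q t \<longleftrightarrow>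
     (\<forall>N\<ge>1. t N \<in> measurable (P N) (count_space {0, 1}) \<and> t N \<in> measurable (Q N) (count_space {0, 1})) \<and>
     (\<lambda>N. measure (P N) {y \<in> space (P N). t N y = 0} + measure (Q N) {y \<in> space (Q N). t N y = 1})
       \<longlonglongrightarrow> 0"

text \<open>\<open>\<chi>\<^sup>2(P | Q)\<close>, set to \<open>\<infinity>\<close> when \<open>P\<close> has no density with respect to \<open>Q\<close>.\<close>

definition chi_squared :: "'a measure \<Rightarrow> 'a measure \<Rightarrow> ennreal" where
  "chi_squared P Q =
     (if absolutely_continuous Q P
      then (\<integral>\<^sup>+ y. ennreal ((enn2real (RN_deriv Q P y) - 1)\<^sup>2) \<partial>Q) else \<infinity>)"


section \<open>Conditions on the row distribution\<close>

definition cov_matrix :: "(real ^ 'k) measure \<Rightarrow> real ^ 'k ^ 'k" where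
  "cov_matrix \<nu> =
     (\<chi> a b. \<integral>x. (x $ a - (\<integral>y. y $ a \<partial>\<nu>)) * (x $ b - (\<integral>y. y $ b \<partial>\<nu>)) \<partial>\<nu>)"

definition spectral_norm :: "real ^ 'm ^ 'n \<Rightarrow> real" where
  "spectral_norm A = onorm (\<lambda>v. A *v v)"

definition measure_support :: "'a::topological_space measure \<Rightarrow> 'a set" where
  "measure_support \<nu> = {x. \<forall>U. open U \<and> x \<in> U \<longrightarrow> emeasure \<nu> U > 0}"

definition tensor :: "real ^ 'k \<Rightarrow> real ^ 'l \<Rightarrow> real ^ ('k \<times> 'l)" where
  "tensor x y = (\<chi> p. x $ fst p * y $ snd p)"

definition symmetric_rv :: "'w measure \<Rightarrow> ('w \<Rightarrow> 'b::real_normed_vector) \<Rightarrow> bool" where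
  "symmetric_rv M X \<longleftrightarrow> X \<in> borel_measurable M \<and> distr M borel X = distr M borel (\<lambda>w. - X w)"

text \<open>The argument \<open>s\<close> is \<open>\<sigma>\<^sup>2\<close>; the product is \<open>(2k-1)!!\<close>.\<close>

definition moment_subgaussian :: "'w measure \<Rightarrow> real \<Rightarrow> ('w \<Rightarrow> real) \<Rightarrow> bool" where
  "moment_subgaussian M s X \<longleftrightarrow>
     symmetric_rv M X \<and>
     (\<forall>k\<ge>1. integrable M (\<lambda>w. X w ^ (2 * k)) \<and>
        (\<integral>w. X w ^ (2 * k) \<partial>M) \<le> s ^ k * (\<Prod>i=1..k. real (2 * i - 1)))"

definition moment_subgaussian_vec :: "'w measure \<Rightarrow> real \<Rightarrow> ('w \<Rightarrow> 'b::euclidean_space) \<Rightarrow> bool" where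
  "moment_subgaussian_vec M s X \<longleftrightarrow>
     symmetric_rv M X \<and> (\<forall>v. norm v = 1 \<longrightarrow> moment_subgaussian M s (\<lambda>w. X w \<bullet> v))"


section \<open>Well-definedness of the planted law\<close>

text \<open>The value of \<^const>\<open>bind\<close> is meaningful only for a measurable kernel; the following
  facts show that this holds here and that \<^const>\<open>planted_law\<close> is a probability measure.\<close>

lemma sets_gaussian [simp, measurable_cong]: "sets (gaussian m v) = sets borel"
  by (simp add: gaussian_def)

lemma prob_space_gaussian: "v > 0 \<Longrightarrow> prob_space (gaussian m v)"
  unfolding gaussian_def by (intro prob_space_normal_density) simp

lemma finite_observed: "finite (observed \<Delta> N)"
  by (rule finite_subset[of _ "{1..N} \<times> {1..N}"]) (auto simp: observed_def)

lemma sets_noisy_obs: "sets (noisy_obs \<Delta> N X) = sets (obs_space \<Delta> N)"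
  unfolding noisy_obs_def obs_space_def by (intro sets_PiM_cong) auto

lemma real_pos_ereal: "0 < d \<Longrightarrow> d \<noteq> \<infinity> \<Longrightarrow> real_of_ereal d > 0"
  by (cases d) auto

lemma prob_space_noisy_obs:
  assumes "\<forall>i\<in>{1..N}. \<forall>j\<in>{1..N}. 0 < \<Delta> N i j"
  shows "prob_space (noisy_obs \<Delta> N X)"
  unfolding noisy_obs_def
proof (rule prob_space_PiM)
  fix p assume "p \<in> observed \<Delta> N"
  with assms show "prob_space (case p of (i, j) \<Rightarrow> gaussian (X (i, j)) (real_of_ereal (\<Delta> N i j)))"
    by (auto simp: observed_def intro!: prob_space_gaussian real_pos_ereal)
qed

lemma emeasure_gaussian_measurable:
  assumes [measurable]: "A \<in> sets borel"
  shows "(\<lambda>m. emeasure (gaussian m v) A) \<in> borel_measurable borel"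
proof -
  have "emeasure (gaussian m v) A =
      (\<integral>\<^sup>+x. ennreal (normal_density m (sqrt v) x) * indicator A x \<partial>lborel)" for m
    unfolding gaussian_def by (subst emeasure_density) auto
  then show ?thesis
    unfolding normal_density_def by simp
qed

lemma measurable_noisy_obs:
  assumes pos: "\<forall>i\<in>{1..N}. \<forall>j\<in>{1..N}. 0 < \<Delta> N i j"
  shows "noisy_obs \<Delta> N \<in> measurable (matrix_space N) (prob_algebra (obs_space \<Delta> N))"
proof (rule measurable_prob_algebra_generated[OF _ Int_stable_prod_algebra prod_algebra_sets_into_space])
  show "sets (obs_space \<Delta> N) = sigma_sets (\<Pi>\<^sub>E i\<in>observed \<Delta> N. space borel) (prod_algebra (observed \<Delta> N) (\<lambda>_. borel))"
    unfolding obs_space_def by (rule sets_PiM)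
  show "prob_space (noisy_obs \<Delta> N X)" for X
    by (rule prob_space_noisy_obs[of N \<Delta>, OF pos])
  show "sets (noisy_obs \<Delta> N X) = sets (obs_space \<Delta> N)" for X
    by (rule sets_noisy_obs)
  fix A assume "A \<in> prod_algebra (observed \<Delta> N) (\<lambda>_. borel :: real measure)"
  then obtain B where A: "A = (\<Pi>\<^sub>E p\<in>observed \<Delta> N. B p)"
      and B: "\<And>p. p \<in> observed \<Delta> N \<Longrightarrow> B p \<in> sets borel"
    by (auto simp: prod_algebra_eq_finite[OF finite_observed] Pi_iff)
  define G where "G X p = gaussian (X p) (if p \<in> observed \<Delta> N then real_of_ereal (\<Delta> N (fst p) (snd p)) else 1)" for X p
  have G: "noisy_obs \<Delta> N X = PiM (observed \<Delta> N) (G X)" for X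
    unfolding noisy_obs_def by (intro PiM_cong) (auto simp: G_def)
  have pG: "prob_space (G X p)" for X p
    unfolding G_def using pos by (intro prob_space_gaussian) (auto simp: observed_def intro!: real_pos_ereal)
  have "emeasure (noisy_obs \<Delta> N X) A = (\<Prod>p\<in>observed \<Delta> N. emeasure (G X p) (B p))" for X
  proof -
    interpret product_prob_space "G X" "observed \<Delta> N"
      using pG by (simp add: product_prob_space_def product_prob_space_axioms_def product_sigma_finite_def prob_space_imp_sigma_finite)
    show ?thesis unfolding G A
      by (rule product_sigma_finite.emeasure_PiM) (use finite_observed B in \<open>auto simp: G_def product_sigma_finite_axioms\<close>)
  qed
  moreover have "(\<lambda>X. \<Prod>p\<in>observed \<Delta> N. emeasure (G X p) (B p)) \<in> borel_measurable (matrix_space N)"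
  proof (rule borel_measurable_prod_ennreal)
    fix p assume p: "p \<in> observed \<Delta> N"
    have "(\<lambda>X. X p) \<in> measurable (matrix_space N) borel"
      unfolding matrix_space_def using p by (intro measurable_component_singleton) (auto simp: observed_def)
    from measurable_compose[OF this emeasure_gaussian_measurable[OF B[OF p]]]
    show "(\<lambda>X. emeasure (G X p) (B p)) \<in> borel_measurable (matrix_space N)"
      by (simp add: G_def)
  qed
  ultimately show "(\<lambda>X. emeasure (noisy_obs \<Delta> N X) A) \<in> borel_measurable (matrix_space N)"
    by simp
qed

lemma spike_law_in_prob_algebra:
  assumes "prob_space \<nu>"
    and b[simp,measurable_cong]: "sets \<nu> = sets borel"
  shows "spike_law \<beta> \<nu> N \<in> space (prob_algebra (matrix_space N))"
proof -
  interpret prob_space \<nu> by fact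
  have m: "(\<lambda>V. V i $ k) \<in> borel_measurable (iid_rows \<nu> N)" if "i \<in> {1..N}" for i k
  proof -
    have "(\<lambda>V. V i) \<in> measurable (iid_rows \<nu> N) \<nu>"
      unfolding iid_rows_def using that by (rule measurable_component_singleton)
    moreover have "(\<lambda>x. x $ k) \<in> borel_measurable \<nu>" 
      using borel_measurable_continuous_onI[OF continuous_on_component[OF continuous_on_id, of UNIV k]]
      by (simp add: measurable_cong_sets[OF b refl])
    ultimately show ?thesis by (rule measurable_compose)
  qed
  have *: "(\<lambda>V. \<lambda>(i, j)\<in>{1..N} \<times> {1..N}. \<beta> / sqrt (real N) * (\<Sum>k\<in>UNIV. V i $ k * V j $ k)) 
    \<in> measurable (iid_rows \<nu> N) (matrix_space N)"
    unfolding matrix_space_def by (rule measurable_restrict) (auto intro!: borel_measurable_times borel_measurable_divide borel_measurable_sum m)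
  have "prob_space (iid_rows \<nu> N)" unfolding iid_rows_def by (rule prob_space_PiM) (rule assms(1))
  from prob_space.prob_space_distr[OF this *]
  show ?thesis by (simp add: space_prob_algebra spike_law_def)
qed

lemma planted_law_in_prob_algebra:
  assumes "\<forall>i\<in>{1..N}. \<forall>j\<in>{1..N}. 0 < \<Delta> N i j"
    and "signal N \<in> space (prob_algebra (matrix_space N))"
  shows "planted_law \<Delta> signal N \<in> space (prob_algebra (obs_space \<Delta> N))"
  unfolding planted_law_def
proof -
  have 1: "sets (signal N) = sets (matrix_space N)" using assms(2) by (simp add: space_prob_algebra)
  have 2: "noisy_obs \<Delta> N \<in> measurable (signal N) (prob_algebra (obs_space \<Delta> N))"
    using measurable_noisy_obs[of N \<Delta>, OF assms(1)] by (simp add: measurable_cong_sets[OF 1 refl])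
  have ps: "prob_space (signal N)" using assms(2) by (simp add: space_prob_algebra)
  show "signal N \<bind> noisy_obs \<Delta> N \<in> space (prob_algebra (obs_space \<Delta> N))"
    using prob_space_bind'[OF _ 2] sets_bind'[OF _ 2] ps by (simp add: space_prob_algebra)
qed

end

theory Submission
  imports Defs "HOL-Real_Asymp.Real_Asymp"
begin

text \<open>
  Write \<open>W = \<Sum> X\<^sub>p X'\<^sub>p / \<Delta>\<^sub>p\<close> for the overlap of two independent signals. The second moment of the
  likelihood ratio is \<open>E exp W\<close>, and its projection to polynomials of degree \<open>\<le> D\<close> has squared norm
  \<open>E exp\<^sub>D W\<close>, where \<open>exp\<^sub>D\<close> is the Taylor polynomial of the exponential; by Cauchy--Schwarz both parts
  reduce to bounding these quantities uniformly in \<open>N\<close>.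

  With \<open>u\<^sub>i = V\<^sub>i \<otimes> V'\<^sub>i\<close> and \<open>Z\<^sub>a = (\<rho>\<^sub>a N)\<^sup>-\<^sup>1\<^sup>/\<^sup>2 \<Sum> u\<^sub>i\<close>, summed over block \<open>a\<close>, the hypothesis
  \<open>\<beta> < \<beta>\<^sub>*\<close> gives \<open>|W| \<le> C + c/2 \<Sum> |Z\<^sub>a|\<^sup>2\<close> with \<open>c < 1\<close>. The Taylor polynomial of \<open>exp (c z\<^sup>2 / 2)\<close>
  is dominated by a mixture of exponentials \<open>exp (t z)\<close> with \<open>t\<^sup>2 = 2 k\<close>, \<open>k \<le> D\<close>, whose total mass
  stays bounded after a Gaussian bound on the moment generating function of \<open>u\<close>. Under (d) this bound
  holds for all arguments, so that \<open>D \<rightarrow> \<infinity>\<close> is allowed; without (d) it holds near \<open>0\<close> up to a factor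
  \<open>\<kappa> > 1\<close> in the exponent, which is enough as long as \<open>D \<le> \<epsilon> N\<close>.
\<close>

section \<open>The threshold as a bound on a quadratic form\<close>

text \<open>The usual linearisation of exp (c z^2 / 2), a Gaussian average of exp (sqrt c g z),
  tilts z by arbitrarily large amounts, whereas without (d) the moment generating function of the
  rows is controlled only near 0. The discrete mixture cures this: level k tilts a row by an amount
  of order sqrt (k / N), so the truncation degree itself confines the tilt to a neighbourhood of 0.
  By Stirling the mass of level k is of order (c / e)^k, the Gaussian bound costs exp k, and c^k is
  summable because c < 1. The gap below 1 must absorb two losses: the factor \<kappa> of the local
  bound, and a second \<kappa> because block a has only asymptotically \<rho>_a N rows. Level k thus
  costs exp (\<kappa>^2 k). The constants are chosen in the order c, then \<kappa> with c exp
  (\<kappa>^2 - 1) < 1, then the neighbourhood, then \<epsilon>. Bounds are on |W| rather than W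
  because all Taylor polynomials of the exponential are monotone on the nonnegative axis.\<close>

lemma symmetric_matrix_inner:
  fixes A :: "real ^ 'n ^ 'n"
  assumes "transpose A = A"
  shows "x \<bullet> (A *v y) = (A *v x) \<bullet> y"
  by (metis assms dot_lmul_matrix transpose_matrix_vector)

text \<open>Eigenvectors of a symmetric matrix for distinct eigenvalues are orthogonal, hence
  independent, so their number is bounded by the dimension. The \<open>Max\<close> in
  \<open>max_eigenvalue\<close> is meaningful because of this.\<close>

lemma finite_eigenvalues:
  fixes A :: "real ^ 'n ^ 'n"
  assumes sym: "transpose A = A"
  shows "finite (eigenvalues A)"
proof -
  define w where "w l = (SOME v. v \<noteq> 0 \<and> A *v v = l *\<^sub>R v)" for l
  have w: "w l \<noteq> 0 \<and> A *v w l = l *\<^sub>R w l" if "l \<in> eigenvalues A" for l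
    using that unfolding eigenvalues_def w_def mem_Collect_eq by (rule someI_ex)
  have orth: "w l \<bullet> w m = 0" if "l \<in> eigenvalues A" "m \<in> eigenvalues A" "l \<noteq> m" for l m
  proof -
    have "m * (w l \<bullet> w m) = l * (w l \<bullet> w m)"
      using symmetric_matrix_inner[OF sym, of "w l" "w m"] w[OF that(1)] w[OF that(2)] by simp
    then show ?thesis using that(3) by simp
  qed
  have inj: "inj_on w (eigenvalues A)"
  proof (rule inj_onI, rule ccontr)
    fix l m assume *: "l \<in> eigenvalues A" "m \<in> eigenvalues A" "w l = w m" "l \<noteq> m"
    then have "w l \<bullet> w l = 0" using orth[of l m] by simp
    then show False using w[OF *(1)] by simp
  qed
  have "pairwise orthogonal (w ` eigenvalues A)"
    unfolding pairwise_def orthogonal_def using orth by blast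
  moreover have "0 \<notin> w ` eigenvalues A" using w by fastforce
  ultimately have "independent (w ` eigenvalues A)" by (rule pairwise_orthogonal_independent)
  then have "finite (w ` eigenvalues A)" using independent_bound by blast
  then show ?thesis using inj by (simp add: finite_image_iff)
qed

text \<open>The form attains its maximum \<open>l\<close> over the unit sphere at some
  \<open>v\<close>. If the residual \<open>z\<close> at \<open>v\<close> were nonzero, moving
  \<open>v\<close> along the line of \<open>z\<close> would violate maximality; so \<open>l\<close>
  is an eigenvalue, and homogeneity carries the bound from the sphere to all vectors.\<close>

lemma rayleigh_le_max_eigenvalue:
  fixes A :: "real ^ 'n ^ 'n"
  assumes sym: "transpose A = A"
  shows "x \<bullet> (A *v x) \<le> max_eigenvalue A * (x \<bullet> x)"
proof -
  have "continuous_on (sphere (0 :: real^'n) 1) (\<lambda>x. x \<bullet> (A *v x))"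
    by (intro continuous_intros matrix_vector_mult_linear_continuous_on)
  moreover have "sphere (0 :: real^'n) 1 \<noteq> {}"
    by simp
  ultimately obtain v where v: "v \<in> sphere 0 1"
    and mx: "\<And>y. y \<in> sphere 0 1 \<Longrightarrow> y \<bullet> (A *v y) \<le> v \<bullet> (A *v v)"
    using continuous_attains_sup[OF compact_sphere] by blast
  define l where "l = v \<bullet> (A *v v)"
  have vv: "v \<bullet> v = 1" using v by (simp add: dot_square_norm)
  have le: "y \<bullet> (A *v y) \<le> l * (y \<bullet> y)" for y
  proof (cases "y = 0")
    case False
    have "(y /\<^sub>R norm y) \<bullet> (A *v (y /\<^sub>R norm y)) \<le> l"
      unfolding l_def using False by (intro mx) simp
    then have "(y \<bullet> (A *v y)) / (norm y)\<^sup>2 \<le> l"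
      by (simp add: matrix_vector_mult_scaleR power2_eq_square field_simps)
    then show ?thesis using False by (simp add: field_simps dot_square_norm)
  qed simp
  define z where "z = l *\<^sub>R v - A *v v"
  have orth: "v \<bullet> z = 0" by (simp add: z_def inner_diff_right vv l_def)
  have "z \<bullet> z = 0"
  proof (rule ccontr)
    assume nz: "z \<bullet> z \<noteq> 0"
    define B where "B = l * (z \<bullet> z) - z \<bullet> (A *v z)"
    have B0: "B \<ge> 0" using le[of z] by (simp add: B_def)
    have zz: "z \<bullet> z > 0" using nz by (metis inner_eq_zero_iff inner_gt_zero_iff)
    have vAz: "v \<bullet> (A *v z) = - (z \<bullet> z)" "z \<bullet> (A *v v) = - (z \<bullet> z)"
    proof -
      have "A *v v = l *\<^sub>R v - z" by (simp add: z_def)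
      then show "z \<bullet> (A *v v) = - (z \<bullet> z)" using orth by (simp add: inner_diff_right inner_commute)
      then show "v \<bullet> (A *v z) = - (z \<bullet> z)" 
        using symmetric_matrix_inner[OF sym, of v z] by (simp add: inner_commute)
    qed
    have key: "0 \<le> 2 * t * (z \<bullet> z) + t\<^sup>2 * B" for t
      using le[of "v + t *\<^sub>R z"] vAz orth
      by (simp add: matrix_vector_right_distrib matrix_vector_mult_scaleR inner_add_left inner_add_right
        vv l_def[symmetric] B_def inner_commute[of z v] algebra_simps power2_eq_square)
    \<comment> \<open>To first order \<open>key\<close> is linear in \<open>t\<close>, so a small
      negative \<open>t\<close> refutes it. This size keeps the quadratic term at most half of the
      linear one; the \<open>+ 1\<close> covers \<open>B = 0\<close>.\<close>
    define t where "t = - (z \<bullet> z) / (B + 1)"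
    have "t * B \<ge> - (z \<bullet> z)" using B0 zz by (simp add: t_def field_simps)
    then have "2 * (z \<bullet> z) + t * B > 0" using zz by linarith
    moreover have "t < 0" using B0 zz by (simp add: t_def field_simps)
    ultimately have "t * (2 * (z \<bullet> z) + t * B) < 0" by (simp add: mult_neg_pos)
    then show False using key[of t] by (simp add: algebra_simps power2_eq_square)
  qed
  then have "l \<in> eigenvalues A"
    unfolding eigenvalues_def using vv by (auto simp: z_def intro!: exI[of _ v])
  then have "l \<le> max_eigenvalue A"
    unfolding max_eigenvalue_def using finite_eigenvalues[OF sym] by simp
  then have "l * (x \<bullet> x) \<le> max_eigenvalue A * (x \<bullet> x)" by (intro mult_right_mono) auto
  then show ?thesis using le[of x] by linarith
qed

text \<open>The constant is \<open>\<beta>\<^sup>2\<close> times the largest eigenvalue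
  \<open>l\<close>. That \<open>l\<close> is positive follows from
  \<open>\<beta> < sqrt (1 / l)\<close> and \<open>\<beta> > 0\<close>: for \<open>l \<le> 0\<close>
  the right-hand side would be nonpositive.\<close>

lemma quadratic_form_below_threshold:
  fixes \<Delta>b :: "ereal ^ 'n ^ 'n"
  assumes bp: "block_params \<Delta>b \<rho>" and b: "\<beta> > 0" "ereal \<beta> < beta_star \<Delta>b \<rho>"
  obtains c where "0 < c" "c < 1"
    "\<And>x :: 'n \<Rightarrow> real. \<beta>\<^sup>2 * (\<Sum>a\<in>UNIV. \<Sum>b\<in>UNIV. recip_profile \<Delta>b $ a $ b * (sqrt (\<rho> $ a) * x a) * (sqrt (\<rho> $ b) * x b))
       \<le> c * (\<Sum>a\<in>UNIV. (x a)\<^sup>2)"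
proof (cases "recip_profile \<Delta>b = 0")
  case True
  \<comment> \<open>The form vanishes identically here, so any number strictly between 0 and 1
    serves.\<close>
  show thesis by (rule that[of "1/2"]) (auto simp: True sum_nonneg)
next
  case False
  define \<Phi> where "\<Phi> = recip_profile \<Delta>b"
  define D where "D = diag_matrix (\<chi> a. sqrt (\<rho> $ a))"
  define A where "A = D ** \<Phi> ** D"
  have A: "A $ a $ b = sqrt (\<rho> $ a) * \<Phi> $ a $ b * sqrt (\<rho> $ b)" for a b
    unfolding A_def D_def diag_matrix_def matrix_matrix_mult_def
    by (simp add: if_distrib[of "\<lambda>x. x * _"] if_distrib[of "\<lambda>x. _ * x"] cong: if_cong)
  have "\<Phi> $ a $ b = \<Phi> $ b $ a" for a b
    using bp by (simp add: \<Phi>_def recip_profile_def block_params_def)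
  then have sym: "transpose A = A" by (simp add: vec_eq_iff transpose_def A mult_ac)
  define l where "l = max_eigenvalue A"
  have "ereal \<beta> < ereal (sqrt (1 / l))"
    using b(2) False by (simp add: beta_star_def \<Phi>_def D_def A_def l_def Let_def)
  then have "\<beta> < sqrt (1 / l)" by simp
  then have "\<beta>\<^sup>2 < 1 / l" 
    using b(1) by (metis abs_of_pos real_sqrt_abs real_sqrt_less_iff)
  moreover have "\<beta>\<^sup>2 > 0" using b by simp
  ultimately have l: "l > 0" "\<beta>\<^sup>2 * l < 1"
    by (smt (verit) zero_less_divide_1_iff, smt (verit) zero_less_divide_1_iff pos_less_divide_eq)
  show thesis
  proof (rule that[of "\<beta>\<^sup>2 * l"])
    show "0 < \<beta>\<^sup>2 * l" using l b by simp
    show "\<beta>\<^sup>2 * l < 1" by fact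
    fix x :: "'n \<Rightarrow> real"
    define y :: "real^'n" where "y = (\<chi> a. x a)"
    have "y \<bullet> (A *v y) \<le> l * (y \<bullet> y)" unfolding l_def by (rule rayleigh_le_max_eigenvalue[OF sym])
    moreover have "y \<bullet> (A *v y) = (\<Sum>a\<in>UNIV. \<Sum>b\<in>UNIV. \<Phi> $ a $ b * (sqrt (\<rho> $ a) * x a) * (sqrt (\<rho> $ b) * x b))"
      by (simp add: inner_vec_def matrix_vector_mult_def A y_def sum_distrib_left mult_ac)
    moreover have "y \<bullet> y = (\<Sum>a\<in>UNIV. (x a)\<^sup>2)" by (simp add: inner_vec_def y_def power2_eq_square)
    ultimately show "\<beta>\<^sup>2 * (\<Sum>a\<in>UNIV. \<Sum>b\<in>UNIV. recip_profile \<Delta>b $ a $ b * (sqrt (\<rho> $ a) * x a) * (sqrt (\<rho> $ b) * x b))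
      \<le> \<beta>\<^sup>2 * l * (\<Sum>a\<in>UNIV. (x a)\<^sup>2)"
      unfolding \<Phi>_def by (simp add: mult.assoc mult_left_mono)
  qed
qed

section \<open>Truncated exponentials and Gaussian mixtures\<close>

definition exp_trunc :: "nat \<Rightarrow> real \<Rightarrow> real" where
  "exp_trunc D y = (\<Sum>d\<le>D. y ^ d / fact d)"

lemma exp_trunc_mono: "0 \<le> x \<Longrightarrow> x \<le> y \<Longrightarrow> exp_trunc D x \<le> exp_trunc D y"
  unfolding exp_trunc_def by (intro sum_mono divide_right_mono power_mono) auto

lemma exp_trunc_nonneg: "0 \<le> x \<Longrightarrow> 0 \<le> exp_trunc D x"
  unfolding exp_trunc_def by (intro sum_nonneg) auto

lemma exp_trunc_le_exp:
  assumes "0 \<le> x"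
  shows "exp_trunc D x \<le> exp x"
proof -
  have "(\<Sum>n\<le>D. x ^ n /\<^sub>R fact n) \<le> suminf (\<lambda>n. x ^ n /\<^sub>R fact n)"
    using assms summable_exp_generic[of x] by (intro sum_le_suminf) auto
  then show ?thesis unfolding exp_trunc_def exp_def by (simp add: divide_inverse mult.commute)
qed

lemma exp_trunc_add:
  "exp_trunc D (x + y) = (\<Sum>i\<le>D. x ^ i / fact i * exp_trunc (D - i) y)"
proof -
  have "exp_trunc D (x + y) = (\<Sum>d\<le>D. \<Sum>i\<le>d. (x ^ i / fact i) * (y ^ (d - i) / fact (d - i)))"
    using exp_series_add_commuting[of x y] unfolding exp_trunc_def by (simp add: field_simps)
  also have "\<dots> = (\<Sum>(i, j)\<in>{(i, j). i + j \<le> D}. (x ^ i / fact i) * (y ^ j / fact j))"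
    by (rule sum.triangle_reindex_eq[symmetric])
  also have "{(i, j). i + j \<le> D} = (SIGMA i:{..D}. {..D - i})" by auto
  also have "(\<Sum>(i, j)\<in>\<dots>. (x ^ i / fact i) * (y ^ j / fact j)) = (\<Sum>i\<le>D. \<Sum>j\<le>D - i. (x ^ i / fact i) * (y ^ j / fact j))"
    by (rule sum.Sigma[symmetric]) auto
  finally show ?thesis unfolding exp_trunc_def sum_distrib_left .
qed

text \<open>The product of the truncations contains every term of total degree at most
  \<open>D\<close>, and all its other terms are nonnegative. This replaces the functional equation
  of \<open>exp\<close> when the bound is split over blocks and coordinates.\<close>

lemma exp_trunc_add_le:
  assumes "0 \<le> x" "0 \<le> y"
  shows "exp_trunc D (x + y) \<le> exp_trunc D x * exp_trunc D y"
proof -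
  have "exp_trunc (D - i) y \<le> exp_trunc D y" for i
    unfolding exp_trunc_def using assms by (intro sum_mono2) auto
  then have "(\<Sum>i\<le>D. x ^ i / fact i * exp_trunc (D - i) y) \<le> (\<Sum>i\<le>D. x ^ i / fact i * exp_trunc D y)"
    using assms by (intro sum_mono mult_left_mono) auto
  then show ?thesis
    unfolding exp_trunc_add by (simp add: exp_trunc_def[of D x] sum_distrib_right)
qed

lemma exp_trunc_0 [simp]: "exp_trunc D 0 = 1"
  unfolding exp_trunc_def by (simp add: power_0_left if_distrib[of "\<lambda>x. x / _"] cong: if_cong)

lemma exp_trunc_sum_le:
  assumes "finite A" "\<And>a. a \<in> A \<Longrightarrow> 0 \<le> f a"
  shows "exp_trunc D (\<Sum>a\<in>A. f a) \<le> (\<Prod>a\<in>A. exp_trunc D (f a))"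
  using assms
proof (induction A rule: finite_induct)
  case (insert a A)
  have "exp_trunc D (f a + sum f A) \<le> exp_trunc D (f a) * exp_trunc D (sum f A)"
    using insert.prems by (intro exp_trunc_add_le sum_nonneg) auto
  also have "\<dots> \<le> exp_trunc D (f a) * (\<Prod>a\<in>A. exp_trunc D (f a))"
    using insert by (intro mult_left_mono exp_trunc_nonneg) auto
  finally show ?case using insert by simp
qed simp

text \<open>All Taylor terms of \<open>cosh\<close> are nonnegative, so it dominates each single
  one.\<close>

lemma even_power_le_cosh:
  fixes y :: real
  shows "y ^ (2 * k) / fact (2 * k) \<le> (exp y + exp (- y)) / 2"
proof -
  have "(\<Sum>n\<in>{2 * k}. if even n then y ^ n /\<^sub>R fact n else 0) \<le> cosh y"
    using cosh_converges[of y]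
    by (intro order_trans[OF sum_le_suminf]) (auto simp: sums_iff zero_le_even_power)
  then show ?thesis by (simp add: cosh_def field_simps)
qed

text \<open>The Taylor coefficient (c/2)^k / k! times the factor (2k)! / t^(2k) from z^(2k) \<le>
  (2k)! / t^(2k) cosh (t z) at t^2 = 2k, halved because \<open>cosh\<close> is split into two
  exponentials. At \<open>k = 0\<close> the weight is 1/2, since 0^0 = 1.\<close>

definition mix_weight :: "real \<Rightarrow> nat \<Rightarrow> real" where
  "mix_weight c k = (c / 2) ^ k * fact (2 * k) / (fact k * (2 * real k) ^ k) / 2"

lemma mix_weight_nonneg: "0 \<le> c \<Longrightarrow> 0 \<le> mix_weight c k"
  unfolding mix_weight_def by auto

text \<open>The \<open>k\<close>-th Taylor term of \<open>exp (c z\<^sup>2 / 2)\<close> is dominated by exponentials with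
  \<open>t\<^sup>2 = 2 k\<close>, the optimal tilt for the \<open>2k\<close>-th moment of a Gaussian.\<close>

lemma exp_trunc_square_le_mixture:
  assumes "0 \<le> c"
  shows "exp_trunc D (c / 2 * z\<^sup>2) \<le>
    (\<Sum>(k, s)\<in>{..D} \<times> {1, -1}. mix_weight c k * exp (s * sqrt (2 * real k) * z))"
proof -
  have "(c / 2 * z\<^sup>2) ^ k / fact k \<le>
    mix_weight c k * (exp (sqrt (2 * real k) * z) + exp (- sqrt (2 * real k) * z))" for k
  proof (cases "k = 0")
    case True
    then show ?thesis by (simp add: mix_weight_def)
  next
    case False
    define y where "y = sqrt (2 * real k) * z"
    have y: "y ^ (2 * k) = (2 * real k) ^ k * (z\<^sup>2) ^ k"
      unfolding y_def power_mult power_mult_distrib by simp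
    have "(c / 2 * z\<^sup>2) ^ k / fact k =
      (2 * mix_weight c k) * (y ^ (2 * k) / fact (2 * k))"
      using False unfolding y by (simp add: mix_weight_def power_mult_distrib field_simps)
    also have "\<dots> \<le> (2 * mix_weight c k) * ((exp y + exp (- y)) / 2)"
      using assms by (intro mult_left_mono even_power_le_cosh) (simp add: mix_weight_nonneg)
    finally show ?thesis by (simp add: y_def)
  qed
  then have "exp_trunc D (c / 2 * z\<^sup>2) \<le>
    (\<Sum>k\<le>D. mix_weight c k * (exp (sqrt (2 * real k) * z) + exp (- sqrt (2 * real k) * z)))"
    unfolding exp_trunc_def by (rule sum_mono)
  also have "\<dots> = (\<Sum>k\<le>D. \<Sum>s\<in>{1, -1}. mix_weight c k * exp (s * sqrt (2 * real k) * z))"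
    by (simp add: distrib_left)
  finally show ?thesis unfolding sum.cartesian_product .
qed

text \<open>The ratio of successive terms tends to \<open>c * exp (l - 1)\<close>:
  \<open>exp l\<close> is the growth paid for the moment generating function, and exp (-1) is the
  limit of (k / (k + 1))^k.\<close>

lemma summable_mix_weight:
  assumes c: "0 < c" and "c * exp (l - 1) < 1"
  shows "summable (\<lambda>k. mix_weight c k * exp (l * real k))"
proof -
  define g where "g k = mix_weight c k * exp (l * real k)" for k
  define r where "r k = c * exp l * ((2 * real k + 1) / (2 * real k + 2)) * (real k / (real k + 1)) ^ k" for k :: nat
  have g0: "g k > 0" for k using c by (cases k) (auto simp: g_def mix_weight_def)
  have step: "g (Suc k) = r k * g k" if "k > 0" for k
  proof -
    have f: "(fact (2 * Suc k) :: real) = (2 * real k + 2) * (2 * real k + 1) * fact (2 * k)"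
      by (simp add: algebra_simps)
    define a b where "a = (2 * real (Suc k)) ^ k" and "b = (2 * real k) ^ k"
    have ab: "a > 0" "b > 0" using that by (auto simp: a_def b_def)
    have p: "(2 * real (Suc k)) ^ Suc k = 2 * (real k + 1) * a"
      by (simp add: a_def)
    have "(real k / (real k + 1)) ^ k = ((2 * real k) / (2 * real (Suc k))) ^ k"
      by (rule arg_cong[of _ _ "\<lambda>x. x ^ k"]) (simp add: divide_simps)
    then have r: "(real k / (real k + 1)) ^ k = b / a"
      unfolding a_def b_def power_divide .
    have e: "exp (l * real (Suc k)) = exp l * exp (l * real k)" by (simp add: exp_add[symmetric] algebra_simps)
    show ?thesis using ab
      unfolding g_def mix_weight_def r_def f p e r b_def[symmetric]
      by (simp add: divide_simps)
  qed
  have "(\<lambda>k. (2 * real k + 1) / (2 * real k + 2)) \<longlonglongrightarrow> 1" by real_asymp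
  moreover have "(\<lambda>k. (real k / (real k + 1)) ^ k) \<longlonglongrightarrow> exp (- 1)" by real_asymp
  ultimately have "r \<longlonglongrightarrow> c * exp l * 1 * exp (- 1)"
    unfolding r_def by (intro tendsto_mult tendsto_const)
  then have "r \<longlonglongrightarrow> c * exp (l - 1)" by (simp add: exp_diff exp_minus field_simps)
  moreover obtain q where q: "c * exp (l - 1) < q" "q < 1" using assms dense by blast
  ultimately have "eventually (\<lambda>k. r k < q) sequentially" by (auto simp: order_tendsto_iff)
  then obtain K where K: "\<And>k. k \<ge> K \<Longrightarrow> r k < q" by (auto simp: eventually_sequentially)
  have "summable g"
  proof (rule summable_ratio_test[OF q(2), of "max K 1"])
    fix k assume "max K 1 \<le> k"
    then have "g (Suc k) = r k * g k" "r k \<le> q" using step[of k] K[of k] by auto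
    then have "g (Suc k) \<le> q * g k" using g0[of k] by simp
    then show "norm (g (Suc k)) \<le> q * norm (g k)"
      using less_imp_le[OF g0[of k]] less_imp_le[OF g0[of "Suc k"]] by simp
  qed
  then show ?thesis unfolding g_def .
qed

section \<open>Likelihood ratio and its second moment\<close>

lemma gaussian_eq_density:
  assumes "v > 0"
  shows "gaussian m v = density (gaussian 0 v) (\<lambda>y. ennreal (exp (m * y / v - m\<^sup>2 / (2 * v))))"
proof -
  have "normal_density m (sqrt v) x = normal_density 0 (sqrt v) x * exp (m * x / v - m\<^sup>2 / (2 * v))" for x
  proof -
    have "- (x - m)\<^sup>2 / (2 * v) = - x\<^sup>2 / (2 * v) + (m * x / v - m\<^sup>2 / (2 * v))"
      using assms by (simp add: field_simps power2_eq_square)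
    then show ?thesis using assms unfolding normal_density_def by (simp add: exp_add[symmetric])
  qed
  then show ?thesis unfolding gaussian_def
    by (subst density_density_eq) (auto simp: ennreal_mult'' intro!: density_cong)
qed

section \<open>Densities with respect to the null law\<close>

locale spiked_model =
  fixes \<Delta> :: "nat \<Rightarrow> nat \<Rightarrow> nat \<Rightarrow> ereal" and N :: nat and S :: "(nat \<times> nat \<Rightarrow> real) measure"
  assumes pos: "\<forall>i\<in>{1..N}. \<forall>j\<in>{1..N}. 0 < \<Delta> N i j"
    and signal: "S \<in> space (prob_algebra (matrix_space N))"
begin

abbreviation "J \<equiv> observed \<Delta> N"

text \<open>The value 1 off \<open>J\<close> makes every coordinate law a probability measure, as
  \<open>product_sigma_finite\<close> ranges over all indices.\<close>

definition nvar :: "nat \<times> nat \<Rightarrow> real" where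
  "nvar p = (if p \<in> J then real_of_ereal (\<Delta> N (fst p) (snd p)) else 1)"

abbreviation "Q \<equiv> null_law \<Delta> N"
abbreviation "obs \<equiv> noisy_obs \<Delta> N"

definition "P = bind S obs"

definition lr :: "(nat \<times> nat \<Rightarrow> real) \<Rightarrow> (nat \<times> nat \<Rightarrow> real) \<Rightarrow> real" where
  "lr X Y = exp (\<Sum>p\<in>J. X p * Y p / nvar p - (X p)\<^sup>2 / (2 * nvar p))"

definition avg_lr :: "(nat \<times> nat \<Rightarrow> real) \<Rightarrow> ennreal" where
  "avg_lr Y = (\<integral>\<^sup>+ X. ennreal (lr X Y) \<partial>S)"

definition overlap :: "(nat \<times> nat \<Rightarrow> real) \<Rightarrow> (nat \<times> nat \<Rightarrow> real) \<Rightarrow> real" where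
  "overlap X X' = (\<Sum>p\<in>J. X p * X' p / nvar p)"

lemma finJ [simp, intro]: "finite J" by (rule finite_observed)

lemma nvar_pos: "nvar p > 0"
  unfolding nvar_def using pos by (auto simp: observed_def intro!: real_pos_ereal)

lemma obs_eq: "obs X = PiM J (\<lambda>p. gaussian (X p) (nvar p))"
  unfolding noisy_obs_def by (intro PiM_cong) (auto simp: nvar_def)

lemma product_sigma_gaussian: "product_sigma_finite (\<lambda>p. gaussian (X p) (nvar p))"
  unfolding product_sigma_finite_def
  using prob_space_imp_sigma_finite[OF prob_space_gaussian[OF nvar_pos]] by blast

lemma prob_obs: "prob_space (obs X)"
  using prob_space_noisy_obs[of N \<Delta>, OF pos] .

lemma prob_Q: "prob_space Q"
  unfolding null_law_def by (rule prob_obs)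

lemma sets_obs [simp, measurable_cong]: "sets (obs X) = sets (PiM J (\<lambda>_. borel))"
  using sets_noisy_obs by (simp add: obs_space_def)

lemma sets_Q [simp, measurable_cong]: "sets Q = sets (PiM J (\<lambda>_. borel))"
  unfolding null_law_def by (rule sets_obs)

lemma sets_S [measurable_cong]: "sets S = sets (matrix_space N)"
  and prob_S: "prob_space S"
  using signal by (auto simp: space_prob_algebra)

lemma measurable_S: "p \<in> J \<Longrightarrow> (\<lambda>X. X p) \<in> borel_measurable S"
  by (subst measurable_cong_sets[OF sets_S refl])
     (auto simp: matrix_space_def observed_def intro!: measurable_component_singleton)

lemma measurable_obs: "obs \<in> measurable S (subprob_algebra (PiM J (\<lambda>_. borel)))"
  using measurable_prob_algebraD[OF measurable_noisy_obs[of N \<Delta>, OF pos]]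
  by (simp add: measurable_cong_sets[OF sets_S refl] obs_space_def)

lemma measurable_lr_pair [measurable]: "(\<lambda>(X, Y). lr X Y) \<in> borel_measurable (S \<Otimes>\<^sub>M PiM J (\<lambda>_. borel))"
proof -
  note measurable_S[measurable]
  show ?thesis unfolding lr_def by measurable
qed

lemma measurable_lr [measurable]: "lr X \<in> borel_measurable (PiM J (\<lambda>_. borel))"
  unfolding lr_def by measurable

lemma measurable_overlap [measurable]: "(\<lambda>(X, Y). overlap X Y) \<in> borel_measurable (S \<Otimes>\<^sub>M S)"
proof -
  note measurable_S[measurable]
  show ?thesis unfolding overlap_def by measurable
qed

lemma prob_P: "prob_space P" and sets_P [measurable_cong]: "sets P = sets (PiM J (\<lambda>_. borel))"
proof -
  have "P \<in> space (prob_algebra (obs_space \<Delta> N))"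
    unfolding P_def using planted_law_in_prob_algebra[of N \<Delta> "\<lambda>_. S", OF pos] signal by (simp add: planted_law_def)
  then show "prob_space P" "sets P = sets (PiM J (\<lambda>_. borel))"
    by (auto simp: space_prob_algebra obs_space_def)
qed

text \<open>A finite product measure is determined by its values on boxes, and there the exponential
  of the sum splits into the one-dimensional tilts of \<open>gaussian_eq_density\<close>.\<close>

lemma obs_density: "obs X = density Q (\<lambda>Y. ennreal (lr X Y))"
proof -
  interpret product_sigma_finite "\<lambda>p. gaussian (X p) (nvar p)" by (rule product_sigma_gaussian)
  interpret Q: product_sigma_finite "\<lambda>p. gaussian 0 (nvar p)" by (rule product_sigma_gaussian)
  define e where "e p y = ennreal (exp (X p * y / nvar p - (X p)\<^sup>2 / (2 * nvar p)))" for p and y :: real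
  have Qeq: "Q = PiM J (\<lambda>p. gaussian 0 (nvar p))" unfolding null_law_def by (rule obs_eq)
  have "density Q (\<lambda>Y. ennreal (lr X Y)) = PiM J (\<lambda>p. gaussian (X p) (nvar p))"
  proof (rule PiM_eqI)
    show "sets (density Q (\<lambda>Y. ennreal (lr X Y))) = sets (PiM J (\<lambda>p. gaussian (X p) (nvar p)))"
      using sets_obs[of X] unfolding obs_eq by simp
    fix A :: "nat \<times> nat \<Rightarrow> real set" assume A: "\<And>p. p \<in> J \<Longrightarrow> A p \<in> sets (gaussian (X p) (nvar p))"
    then have [measurable]: "p \<in> J \<Longrightarrow> A p \<in> sets borel" for p by simp
    have PA: "Pi\<^sub>E J A \<in> sets (PiM J (\<lambda>_. borel))" by (rule sets_PiM_I_finite) auto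
    have "emeasure (density Q (\<lambda>Y. ennreal (lr X Y))) (Pi\<^sub>E J A) =
      (\<integral>\<^sup>+Y. ennreal (lr X Y) * indicator (Pi\<^sub>E J A) Y \<partial>Q)"
      using PA by (subst emeasure_density) auto
    also have "\<dots> = (\<integral>\<^sup>+Y. (\<Prod>p\<in>J. e p (Y p) * indicator (A p) (Y p)) \<partial>Q)"
    proof (rule nn_integral_cong)
      fix Y assume "Y \<in> space Q"
      \<comment> \<open>Membership in a box also demands extensionality, so its indicator is a
        product of coordinate indicators only at extensional points.\<close>
      then have ext: "Y \<in> extensional J" unfolding Qeq by (auto simp: space_PiM PiE_def)
      have "ennreal (lr X Y) = (\<Prod>p\<in>J. e p (Y p))"
        unfolding lr_def e_def by (simp add: exp_sum prod_ennreal)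
      moreover have "indicator (Pi\<^sub>E J A) Y = (\<Prod>p\<in>J. indicator (A p) (Y p) :: ennreal)"
      proof (cases "\<forall>p\<in>J. Y p \<in> A p")
        case True
        then have "Y \<in> Pi\<^sub>E J A" using ext by (simp add: PiE_def Pi_def)
        then show ?thesis using True by simp
      next
        case False
        then obtain p where "p \<in> J" "Y p \<notin> A p" by blast
        then have "Y \<notin> Pi\<^sub>E J A" "(\<Prod>p\<in>J. indicator (A p) (Y p) :: ennreal) = 0"
          by (auto intro!: prod_zero simp: indicator_def)
        then show ?thesis by simp
      qed
      ultimately show "ennreal (lr X Y) * indicator (Pi\<^sub>E J A) Y = (\<Prod>p\<in>J. e p (Y p) * indicator (A p) (Y p))"
        by (simp add: prod.distrib)
    qed
    also have "\<dots> = (\<Prod>p\<in>J. \<integral>\<^sup>+y. e p y * indicator (A p) y \<partial>gaussian 0 (nvar p))"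
      unfolding Qeq
    proof (intro Q.product_nn_integral_prod finJ)
      fix p assume "p \<in> J"
      then have [measurable]: "A p \<in> sets borel" by fact
      have "(\<lambda>y. ennreal (exp (a * y / b - c)) * indicator (A p) y) \<in> borel_measurable (gaussian 0 d)"
        for a b c d :: real by measurable
      then show "(\<lambda>y. e p y * indicator (A p) y) \<in> borel_measurable (gaussian 0 (nvar p))"
        unfolding e_def .
    qed
    also have "\<dots> = (\<Prod>p\<in>J. emeasure (gaussian (X p) (nvar p)) (A p))"
    proof (rule prod.cong[OF refl])
      fix p assume "p \<in> J"
      then have [measurable]: "A p \<in> sets borel" by fact
      have "emeasure (density (gaussian 0 d) (\<lambda>y. ennreal (exp (a * y / b - c)))) (A p) =
        (\<integral>\<^sup>+y. ennreal (exp (a * y / b - c)) * indicator (A p) y \<partial>gaussian 0 d)" for a b c d :: real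
        by (rule emeasure_density) simp_all
      then show "(\<integral>\<^sup>+y. e p y * indicator (A p) y \<partial>gaussian 0 (nvar p)) = emeasure (gaussian (X p) (nvar p)) (A p)"
        unfolding e_def gaussian_eq_density[OF nvar_pos, of "X p"] by simp
    qed
    finally show "emeasure (density Q (\<lambda>Y. ennreal (lr X Y))) (Pi\<^sub>E J A) = \<dots>" .
  qed simp
  then show ?thesis unfolding obs_eq by simp
qed

lemma nn_integral_lr: "(\<integral>\<^sup>+Y. ennreal (lr X Y) \<partial>Q) = 1"
proof -
  have "emeasure (obs X) (space (obs X)) = 1" using prob_obs by (rule prob_space.emeasure_space_1)
  moreover have "emeasure (density Q (\<lambda>Y. ennreal (lr X Y))) (space Q) = (\<integral>\<^sup>+Y. ennreal (lr X Y) * indicator (space Q) Y \<partial>Q)"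
    using sets.top[of Q] by (intro emeasure_density) auto
  moreover have "\<dots> = (\<integral>\<^sup>+Y. ennreal (lr X Y) \<partial>Q)" by (intro nn_integral_cong) simp
  ultimately show ?thesis unfolding obs_density by simp
qed

text \<open>Completing the square: the linear exponents add up, and the quadratic ones differ from
  those of the summed signal exactly by the cross term \<open>overlap\<close>. The ratio of the
  summed signal then integrates to 1.\<close>

lemma nn_integral_lr_lr: "(\<integral>\<^sup>+Y. ennreal (lr X Y) * ennreal (lr X' Y) \<partial>Q) = ennreal (exp (overlap X X'))"
proof -
  have "lr X Y * lr X' Y = exp (overlap X X') * lr (\<lambda>p. X p + X' p) Y" for Y
    unfolding lr_def overlap_def exp_add[symmetric] sum.distrib[symmetric]
    using nvar_pos by (intro arg_cong[of _ _ exp] sum.cong) (auto simp: less_imp_neq[symmetric] field_simps power2_eq_square)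
  then have "(\<integral>\<^sup>+Y. ennreal (lr X Y) * ennreal (lr X' Y) \<partial>Q) =
    (\<integral>\<^sup>+Y. ennreal (exp (overlap X X')) * ennreal (lr (\<lambda>p. X p + X' p) Y) \<partial>Q)"
    by (simp add: ennreal_mult''[symmetric] lr_def)
  also have "\<dots> = ennreal (exp (overlap X X'))"
    by (subst nn_integral_cmult) (auto simp: nn_integral_lr)
  finally show ?thesis .
qed

lemma measurable_avg_lr [measurable]: "avg_lr \<in> borel_measurable (PiM J (\<lambda>_. borel))"
proof -
  interpret S: prob_space S by (rule prob_S)
  have "(\<lambda>(Y, X). ennreal (lr X Y)) \<in> borel_measurable (PiM J (\<lambda>_. borel) \<Otimes>\<^sub>M S)"
    using measurable_compose[OF measurable_pair_swap' measurable_lr_pair] by (simp add: split_beta')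
  then show ?thesis unfolding avg_lr_def by measurable
qed

lemma P_density: "P = density Q avg_lr"
proof (rule measure_eqI)
  interpret S: prob_space S by (rule prob_S)
  interpret Q: prob_space Q by (rule prob_Q)
  interpret SQ: pair_sigma_finite S Q ..
  show "sets P = sets (density Q avg_lr)" by (simp add: sets_P)
  fix A assume "A \<in> sets P"
  then have A[measurable]: "A \<in> sets (PiM J (\<lambda>_. borel))" by (simp add: sets_P)
  have "emeasure P A = (\<integral>\<^sup>+X. emeasure (obs X) A \<partial>S)"
    unfolding P_def using S.not_empty by (rule emeasure_bind[OF _ measurable_obs A])
  also have "\<dots> = (\<integral>\<^sup>+X. (\<integral>\<^sup>+Y. ennreal (lr X Y) * indicator A Y \<partial>Q) \<partial>S)"
    unfolding obs_density by (simp add: emeasure_density)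
  also have "\<dots> = (\<integral>\<^sup>+Y. (\<integral>\<^sup>+X. ennreal (lr X Y) * indicator A Y \<partial>S) \<partial>Q)"
    by (rule SQ.Fubini'[symmetric]) measurable
  also have "\<dots> = (\<integral>\<^sup>+Y. avg_lr Y * indicator A Y \<partial>Q)"
  proof (intro nn_integral_cong)
    fix Y assume "Y \<in> space Q"
    then have "Y \<in> space (PiM J (\<lambda>_. borel))" using sets_eq_imp_space_eq[OF sets_Q] by simp
    then have "(\<lambda>X. ennreal (lr X Y)) \<in> borel_measurable S"
      using measurable_compose[OF measurable_Pair2' measurable_lr_pair] by simp
    then show "(\<integral>\<^sup>+X. ennreal (lr X Y) * indicator A Y \<partial>S) = avg_lr Y * indicator A Y"
      unfolding avg_lr_def by (rule nn_integral_multc)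
  qed
  also have "\<dots> = emeasure (density Q avg_lr) A"
    by (subst emeasure_density) auto
  finally show "emeasure P A = emeasure (density Q avg_lr) A" .
qed

text \<open>Squaring an average over signals introduces an independent second copy; Tonelli allows
  \<open>Y\<close> to be integrated out first, with the pair of signals fixed.\<close>

lemma nn_integral_avg_lr_square:
  "(\<integral>\<^sup>+Y. (avg_lr Y)\<^sup>2 \<partial>Q) = (\<integral>\<^sup>+X. \<integral>\<^sup>+X'. ennreal (exp (overlap X X')) \<partial>S \<partial>S)"
proof -
  interpret S: prob_space S by (rule prob_S)
  interpret Q: prob_space Q by (rule prob_Q)
  interpret SQ: pair_sigma_finite S Q ..
  have m: "(\<lambda>X. ennreal (lr X Y)) \<in> borel_measurable S" if "Y \<in> space Q" for Y
    using measurable_compose[OF measurable_Pair2' measurable_lr_pair, of Y] that sets_eq_imp_space_eq[OF sets_Q] by simp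
  have m2: "(\<lambda>(X, Y). ennreal (lr X Y) * avg_lr Y) \<in> borel_measurable (S \<Otimes>\<^sub>M Q)"
    by measurable
  have "(\<integral>\<^sup>+Y. (avg_lr Y)\<^sup>2 \<partial>Q) = (\<integral>\<^sup>+Y. \<integral>\<^sup>+X. ennreal (lr X Y) * avg_lr Y \<partial>S \<partial>Q)"
    by (intro nn_integral_cong) (simp add: power2_eq_square avg_lr_def[of _] nn_integral_multc m)
  also have "\<dots> = (\<integral>\<^sup>+X. \<integral>\<^sup>+Y. ennreal (lr X Y) * avg_lr Y \<partial>Q \<partial>S)"
    by (rule SQ.Fubini'[OF m2])
  also have "\<dots> = (\<integral>\<^sup>+X. \<integral>\<^sup>+Y. \<integral>\<^sup>+X'. ennreal (lr X Y) * ennreal (lr X' Y) \<partial>S \<partial>Q \<partial>S)"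
    by (intro nn_integral_cong) (simp add: avg_lr_def nn_integral_cmult m)
  also have "\<dots> = (\<integral>\<^sup>+X. \<integral>\<^sup>+X'. \<integral>\<^sup>+Y. ennreal (lr X Y) * ennreal (lr X' Y) \<partial>Q \<partial>S \<partial>S)"
    by (intro nn_integral_cong SQ.Fubini') measurable
  also have "\<dots> = (\<integral>\<^sup>+X. \<integral>\<^sup>+X'. ennreal (exp (overlap X X')) \<partial>S \<partial>S)"
    by (simp add: nn_integral_lr_lr)
  finally show ?thesis .
qed

section \<open>Consequences of a bounded second moment\<close>

text \<open>The crude inequality (x - 1)^2 \<le> x^2 + 1 for x \<ge> 0 gives boundedness without
  subtraction in \<open>ennreal\<close>. \<open>RN_deriv\<close> agrees with \<open>avg_lr\<close>
  almost everywhere.\<close>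

lemma chi_squared_le: "chi_squared P Q \<le> (\<integral>\<^sup>+Y. (avg_lr Y)\<^sup>2 \<partial>Q) + 1"
proof -
  interpret Q: prob_space Q by (rule prob_Q)
  have ac: "absolutely_continuous Q P"
    unfolding P_density by (rule absolutely_continuousI_density) simp
  have le: "ennreal ((enn2real r - 1)\<^sup>2) \<le> r\<^sup>2 + 1" for r
  proof (cases r)
    case (real x)
    then have "(x - 1)\<^sup>2 \<le> x\<^sup>2 + 1" by (simp add: power2_eq_square algebra_simps)
    then show ?thesis using real by (simp add: ennreal_power ennreal_plus[symmetric] ennreal_1[symmetric] del: ennreal_plus ennreal_1)
  qed simp
  have "AE Y in Q. avg_lr Y = RN_deriv Q P Y"
    by (rule Q.RN_deriv_unique) (auto simp: P_density)
  then have "chi_squared P Q \<le> (\<integral>\<^sup>+Y. (avg_lr Y)\<^sup>2 + 1 \<partial>Q)"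
    unfolding chi_squared_def using ac by (auto intro!: nn_integral_mono_AE simp: le)
  also have "\<dots> = (\<integral>\<^sup>+Y. (avg_lr Y)\<^sup>2 \<partial>Q) + 1"
    by (subst nn_integral_add) (auto simp: Q.emeasure_space_1)
  finally show ?thesis .
qed

text \<open>Change of measure followed by Cauchy--Schwarz between the density and \<open>g\<close>.
  This is the only way in which the second moment is used to compare \<open>P\<close> with
  \<open>Q\<close> below.\<close>

lemma nn_integral_P_square_le:
  assumes [measurable]: "g \<in> borel_measurable (PiM J (\<lambda>_. borel))"
    and K: "(\<integral>\<^sup>+Y. (avg_lr Y)\<^sup>2 \<partial>Q) \<le> K"
  shows "(\<integral>\<^sup>+Y. g Y \<partial>P)\<^sup>2 \<le> K * (\<integral>\<^sup>+Y. (g Y)\<^sup>2 \<partial>Q)"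
proof -
  have "(\<integral>\<^sup>+Y. g Y \<partial>P) = (\<integral>\<^sup>+Y. avg_lr Y * g Y \<partial>Q)"
    unfolding P_density by (subst nn_integral_density) auto
  then have "(\<integral>\<^sup>+Y. g Y \<partial>P)\<^sup>2 \<le> (\<integral>\<^sup>+Y. (avg_lr Y)\<^sup>2 \<partial>Q) * (\<integral>\<^sup>+Y. (g Y)\<^sup>2 \<partial>Q)"
    using Cauchy_Schwarz_nn_integral[of avg_lr Q g] by simp
  also have "\<dots> \<le> K * (\<integral>\<^sup>+Y. (g Y)\<^sup>2 \<partial>Q)" using K by (rule mult_right_mono) simp
  finally show ?thesis .
qed

text \<open>Centring \<open>f\<close> at its mean \<open>m\<close> under \<open>Q\<close> before the
  change of measure turns the second moment on the right into the variance under
  \<open>Q\<close>.\<close>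

lemma mean_difference_le:
  assumes f: "square_integrable P f" "square_integrable Q f"
    and K: "K \<ge> 0" "(\<integral>\<^sup>+Y. (avg_lr Y)\<^sup>2 \<partial>Q) \<le> ennreal K"
  shows "(\<integral>y. f y \<partial>P) - (\<integral>y. f y \<partial>Q) \<le> sqrt K * sqrt (var Q f)"
proof -
  interpret Q: prob_space Q by (rule prob_Q)
  interpret P: prob_space P by (rule prob_P)
  define m where "m = (\<integral>y. f y \<partial>Q)"
  have [measurable]: "f \<in> borel_measurable (PiM J (\<lambda>_. borel))"
    using f by (simp add: square_integrable_def measurable_cong_sets[OF sets_Q refl])
  note sq = f[unfolded square_integrable_def]
  have intP: "integrable P f"
    using P.square_integrable_imp_integrable[of f] sq by blast
  have intQ: "integrable Q f" "integrable Q (\<lambda>y. (f y)\<^sup>2)"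
    using Q.square_integrable_imp_integrable[of f] sq by blast+
  have intQ2: "integrable Q (\<lambda>y. (f y - m)\<^sup>2)"
    using intQ by (simp add: power2_diff)
  have "(\<integral>\<^sup>+y. ennreal \<bar>f y - m\<bar> \<partial>P)\<^sup>2 \<le> ennreal K * (\<integral>\<^sup>+y. (ennreal \<bar>f y - m\<bar>)\<^sup>2 \<partial>Q)"
    by (rule nn_integral_P_square_le[OF _ K(2)]) measurable
  also have "(\<integral>\<^sup>+y. (ennreal \<bar>f y - m\<bar>)\<^sup>2 \<partial>Q) = ennreal (var Q f)"
    unfolding var_def m_def[symmetric] using nn_integral_eq_integral[OF intQ2] by (simp add: ennreal_power)
  also have "(\<integral>\<^sup>+y. ennreal \<bar>f y - m\<bar> \<partial>P) = ennreal (\<integral>y. \<bar>f y - m\<bar> \<partial>P)"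
    using intP by (intro nn_integral_eq_integral) auto
  finally have "(\<integral>y. \<bar>f y - m\<bar> \<partial>P)\<^sup>2 \<le> K * var Q f"
    using K by (simp add: ennreal_power ennreal_mult''[symmetric] var_def)
  then have "(\<integral>y. \<bar>f y - m\<bar> \<partial>P) \<le> sqrt (K * var Q f)" by (rule real_le_rsqrt)
  moreover have "(\<integral>y. f y \<partial>P) - m = (\<integral>y. f y - m \<partial>P)" using intP by (simp add: P.prob_space)
  moreover have "\<dots> \<le> (\<integral>y. \<bar>f y - m\<bar> \<partial>P)" using intP by (intro integral_mono) auto
  ultimately show ?thesis by (simp add: m_def real_sqrt_mult)
qed

text \<open>Quantitative contiguity: with a fixed \<open>K\<close>, events that become negligible
  under \<open>Q\<close> become negligible under \<open>P\<close>.\<close>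

lemma measure_P_square_le:
  assumes A: "A \<in> sets Q"
    and K: "K \<ge> 0" "(\<integral>\<^sup>+Y. (avg_lr Y)\<^sup>2 \<partial>Q) \<le> ennreal K"
  shows "(measure P A)\<^sup>2 \<le> K * measure Q A"
proof -
  interpret Q: prob_space Q by (rule prob_Q)
  interpret P: prob_space P by (rule prob_P)
  have A': "A \<in> sets (PiM J (\<lambda>_. borel))" "A \<in> sets P" using A by (auto simp: sets_P)
  have "(\<integral>\<^sup>+Y. indicator A Y \<partial>P)\<^sup>2 \<le> ennreal K * (\<integral>\<^sup>+Y. (indicator A Y)\<^sup>2 \<partial>Q)"
    using A' by (intro nn_integral_P_square_le[OF _ K(2)]) auto
  also have "(\<integral>\<^sup>+Y. (indicator A Y)\<^sup>2 \<partial>Q) = (\<integral>\<^sup>+Y. indicator A Y \<partial>Q)"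
    by (intro nn_integral_cong) (auto simp: indicator_def)
  finally show ?thesis using A A' K
    by (simp add: P.emeasure_eq_measure Q.emeasure_eq_measure ennreal_power ennreal_mult''[symmetric])
qed

end

section \<open>Hermite polynomials\<close>

text \<open>The probabilists' Hermite polynomials, generated by the operator x - d/dx, which is the
  adjoint of d/dx under the standard Gaussian.\<close>

fun hermite :: "nat \<Rightarrow> real poly" where
  "hermite 0 = 1"
| "hermite (Suc n) = pCons 0 (hermite n) - pderiv (hermite n)"

text \<open>The Appell property. Differentiation and x - d/dx commute up to the identity, which
  produces the extra \<open>h\<close> added to the induction hypothesis.\<close>

lemma pderiv_hermite_Suc: "pderiv (hermite (Suc n)) = smult (real (Suc n)) (hermite n)"
proof (induction n)
  case 0
  then show ?case by (simp add: pderiv_pCons)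
next
  case (Suc n)
  define h where "h = hermite (Suc n)"
  have "pderiv (hermite (Suc (Suc n))) = h + (pCons 0 (pderiv h) - pderiv (pderiv h))"
    by (simp only: hermite.simps(2)[of "Suc n"] h_def[symmetric] pderiv_diff pderiv_pCons)
  also have "pderiv h = smult (real (Suc n)) (hermite n)" unfolding h_def by (rule Suc.IH)
  also have "pCons 0 (smult (real (Suc n)) (hermite n)) - pderiv (smult (real (Suc n)) (hermite n)) = smult (real (Suc n)) h"
    unfolding h_def by (simp add: pderiv_smult smult_diff_right del: of_nat_Suc)
  finally show ?case unfolding h_def[symmetric]
    by (simp add: smult_add_left[of 1 "real (Suc n)" h, simplified, symmetric] algebra_simps del: hermite.simps)
qed

lemma hermite_degree: "degree (hermite n) \<le> n" and coeff_hermite_self: "coeff (hermite n) n = 1"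
proof (induction n)
  case (Suc n)
  have "degree (pCons 0 (hermite n)) \<le> Suc n" using Suc by (simp add: degree_pCons_le order_trans[OF degree_pCons_le])
  moreover have d: "degree (pderiv (hermite n)) \<le> n" using Suc by (simp add: degree_pderiv)
  ultimately show "degree (hermite (Suc n)) \<le> Suc n" by (auto intro!: degree_diff_le)
  have "coeff (pderiv (hermite n)) (Suc n) = 0" using d by (intro coeff_eq_0) simp
  then show "coeff (hermite (Suc n)) (Suc n) = 1" using Suc by simp
qed simp_all

text \<open>Since \<open>hermite n\<close> is monic of degree \<open>n\<close>, subtracting the
  right multiple of it cancels the top coefficient and lowers the degree.\<close>

lemma hermite_expansion:
  assumes "degree (p :: real poly) \<le> k"
  shows "\<exists>c. p = (\<Sum>j\<le>k. smult (c j) (hermite j))"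
  using assms
proof (induction k arbitrary: p)
  case 0
  then obtain a where "p = [:a:]" using degree_eq_zeroE[of p] by auto
  then show ?case by (intro exI[of _ "\<lambda>_. a"]) simp
next
  case (Suc k)
  define q where "q = p - smult (coeff p (Suc k)) (hermite (Suc k))"
  have "degree q \<le> Suc k"
    unfolding q_def using Suc.prems hermite_degree[of "Suc k"]
    by (intro degree_diff_le) (auto simp del: hermite.simps)
  moreover have "coeff q (Suc k) = 0" 
    using coeff_hermite_self[of "Suc k"] by (simp add: q_def del: hermite.simps)
  ultimately have "degree q \<le> k"
    by (metis degree_0 le_SucE le0 leading_coeff_0_iff)
  then obtain c where c: "q = (\<Sum>j\<le>k. smult (c j) (hermite j))" using Suc.IH by blast
  have "p = (\<Sum>j\<le>Suc k. smult ((c(Suc k := coeff p (Suc k))) j) (hermite j))"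
    using c unfolding q_def by (simp add: algebra_simps del: hermite.simps)
  then show ?case by blast
qed

section \<open>Gaussian expectation of polynomials and orthogonality\<close>

definition gauss_mean :: "real poly \<Rightarrow> real" where
  "gauss_mean p = (\<integral>x. std_normal_density x * poly p x \<partial>lborel)"

lemma integrable_gauss_poly: "integrable lborel (\<lambda>x. std_normal_density x * poly p x)"
  unfolding poly_altdef sum_distrib_left
  using integrable_std_normal_moment by (intro Bochner_Integration.integrable_sum) (simp add: mult.left_commute)

lemma gauss_mean_add: "gauss_mean (p + q) = gauss_mean p + gauss_mean q"
  unfolding gauss_mean_def using integrable_gauss_poly by (simp add: distrib_left)

lemma gauss_mean_diff: "gauss_mean (p - q) = gauss_mean p - gauss_mean q"
  unfolding gauss_mean_def using integrable_gauss_poly by (simp add: right_diff_distrib)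

lemma gauss_mean_smult: "gauss_mean (smult a p) = a * gauss_mean p"
  unfolding gauss_mean_def by (simp add: mult.left_commute)

lemma gauss_mean_0 [simp]: "gauss_mean 0 = 0" by (simp add: gauss_mean_def)

lemma gauss_mean_sum: "gauss_mean (\<Sum>i\<in>A. f i) = (\<Sum>i\<in>A. gauss_mean (f i))"
  by (induction A rule: infinite_finite_induct) (auto simp: gauss_mean_add)

lemma gauss_mean_monom: "gauss_mean (monom 1 k) = (if even k then fact k / (2 ^ (k div 2) * fact (k div 2)) else 0)"
proof (cases "even k")
  case True
  then obtain m where "k = 2 * m" by (elim evenE)
  then show ?thesis using integral_std_normal_moment_even[of m] by (simp add: gauss_mean_def poly_monom)
next
  case False
  then obtain m where "k = 2 * m + 1" by (elim oddE)
  then show ?thesis using integral_std_normal_moment_odd[of m] by (simp add: gauss_mean_def poly_monom)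
qed

lemma gauss_mean_1 [simp]: "gauss_mean 1 = 1"
  using gauss_mean_monom[of 0] by (simp add: monom_0 one_pCons)

text \<open>Integration by parts for monomials, read off the explicit moments. At
  \<open>k = 0\<close> the truncated \<open>k - 1\<close> is harmless because the factor is
  0.\<close>

lemma gauss_mean_monom_Suc: "gauss_mean (monom 1 (Suc k)) = real k * gauss_mean (monom 1 (k - 1))"
proof (cases k)
  case (Suc m)
  show ?thesis
  proof (cases "even m")
    case True
    then obtain l where "m = 2 * l" by (elim evenE)
    have f: "fact (Suc (Suc (2 * l))) = (2 * (real l + 1)) * (2 * real l + 1) * fact (2 * l)"
      "fact (Suc l) = (real l + 1) * fact l" by (simp_all add: algebra_simps)
    have "fact (Suc (Suc (2 * l))) / (2 ^ Suc l * fact (Suc l)) = (2 * real l + 1) * (fact (2 * l) / (2 ^ l * fact l))"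
      unfolding f by (simp add: divide_simps)
    then show ?thesis using \<open>m = 2 * l\<close> unfolding Suc gauss_mean_monom by (simp del: fact_Suc)
  next
    case False
    then show ?thesis unfolding Suc gauss_mean_monom by simp
  qed
qed (simp add: gauss_mean_monom)

text \<open>Stein's identity: both sides are linear in \<open>p\<close>, and on monomials it is the
  moment recursion.\<close>

lemma gauss_mean_stein: "gauss_mean (pCons 0 p) = gauss_mean (pderiv p)"
proof -
  have m: "monom a k = smult a (monom 1 k)" for a :: real and k by (simp add: smult_monom)
  have "gauss_mean (pCons 0 p) = gauss_mean (\<Sum>i\<le>degree p. smult (coeff p i) (monom 1 (Suc i)))"
  proof -
    have "pCons 0 p = monom 1 1 * (\<Sum>i\<le>degree p. monom (coeff p i) i)"
      unfolding poly_as_sum_of_monoms by (simp add: monom_Suc monom_0 flip: one_pCons)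
    also have "\<dots> = (\<Sum>i\<le>degree p. smult (coeff p i) (monom 1 (Suc i)))"
      unfolding sum_distrib_left by (intro sum.cong) (auto simp: mult_monom smult_monom)
    finally show ?thesis by simp
  qed
  moreover have "gauss_mean (pderiv p) = gauss_mean (\<Sum>i\<le>degree p. smult (coeff p i * real i) (monom 1 (i - 1)))"
  proof -
    have "pderiv p = pderiv (\<Sum>i\<le>degree p. monom (coeff p i) i)"
      by (simp add: poly_as_sum_of_monoms)
    also have "\<dots> = (\<Sum>i\<le>degree p. smult (coeff p i * real i) (monom 1 (i - 1)))"
      by (simp add: higher_pderiv_sum[of 1, simplified] pderiv_monom smult_monom mult.commute)
    finally show ?thesis by simp
  qed
  ultimately show ?thesis
    by (simp only: gauss_mean_sum gauss_mean_smult gauss_mean_monom_Suc mult.assoc)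
qed

text \<open>The adjointness behind the recursion: by Stein and the product rule, one step up in
  \<open>hermite\<close> is traded for one derivative of \<open>g\<close>.\<close>

lemma gauss_mean_hermite_Suc: "gauss_mean (hermite (Suc n) * g) = gauss_mean (hermite n * pderiv g)"
proof -
  have "gauss_mean (hermite (Suc n) * g) = gauss_mean (pCons 0 (hermite n * g)) - gauss_mean (pderiv (hermite n) * g)"
    by (simp add: left_diff_distrib gauss_mean_diff[symmetric])
  also have "\<dots> = gauss_mean (hermite n * pderiv g)"
    unfolding gauss_mean_stein pderiv_mult gauss_mean_add by (simp add: mult.commute)
  finally show ?thesis .
qed

text \<open>Each adjointness step lowers both indices by one and contributes the factor of the
  Appell property; unequal indices end in the derivative of a constant.\<close>

lemma gauss_mean_hermite_mult: "gauss_mean (hermite n * hermite m) = (if n = m then fact n else 0)"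
proof (induction n arbitrary: m)
  case 0
  show ?case
  proof (cases m)
    case (Suc k)
    have "gauss_mean (hermite (Suc k) * 1) = 0" by (subst gauss_mean_hermite_Suc) simp
    then show ?thesis by (simp add: Suc del: hermite.simps(2))
  qed simp
next
  case (Suc n)
  show ?case
  proof (cases m)
    case 0
    then show ?thesis by (subst gauss_mean_hermite_Suc) simp
  next
    case m: (Suc k)
    show ?thesis unfolding m gauss_mean_hermite_Suc pderiv_hermite_Suc
      by (simp add: gauss_mean_smult Suc.IH del: of_nat_Suc)
  qed
qed

text \<open>Shifting the Gaussian turns a Hermite polynomial into a pure power of the shift. Hence
  the Hermite coefficients of the planted law are monomials in the signal.\<close>

lemma gauss_mean_hermite_shift: "gauss_mean (hermite n \<circ>\<^sub>p [:x, 1:]) = x ^ n"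
proof (induction n)
  case (Suc n)
  define g where "g = hermite n \<circ>\<^sub>p [:x, 1:]"
  have "hermite (Suc n) \<circ>\<^sub>p [:x, 1:] = [:x, 1:] * g - pderiv (hermite n) \<circ>\<^sub>p [:x, 1:]"
    by (simp add: pcompose_diff pcompose_pCons g_def)
  also have "pderiv (hermite n) \<circ>\<^sub>p [:x, 1:] = pderiv g"
    unfolding g_def by (simp add: pderiv_pcompose pderiv_pCons)
  also have "[:x, 1:] * g = smult x g + pCons 0 g" by simp
  finally show ?case using Suc unfolding g_def[symmetric]
    by (simp add: gauss_mean_diff gauss_mean_add gauss_mean_smult gauss_mean_stein)
qed (simp add: pcompose_1)

text \<open>Rescaled to be orthonormal under the centred Gaussian of variance
  \<open>v\<close>.\<close>

definition hermite_fun :: "real \<Rightarrow> nat \<Rightarrow> real \<Rightarrow> real" where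
  "hermite_fun v n y = poly (hermite n) (y / sqrt v) / sqrt (fact n)"

lemma measurable_hermite_fun [measurable]: "hermite_fun v n \<in> borel_measurable borel"
  unfolding hermite_fun_def poly_altdef by measurable

lemma gaussian_poly:
  assumes v: "v > 0"
  shows "integrable (gaussian m v) (\<lambda>y. poly p (y / sqrt v))"
    and "(\<integral>y. poly p (y / sqrt v) \<partial>gaussian m v) = gauss_mean (p \<circ>\<^sub>p [:m / sqrt v, 1:])"
proof -
  define s where "s = sqrt v"
  have s: "s > 0" "v = s\<^sup>2" using v by (auto simp: s_def)
  define f where "f y = normal_density m s y * poly p (y / s)" for y
  have [measurable]: "(\<lambda>y. poly p (y / s)) \<in> borel_measurable borel"
    unfolding poly_altdef by measurable
  have f: "f (m + s * x) = (1 / s) * (std_normal_density x * poly (p \<circ>\<^sub>p [:m / s, 1:]) x)" for x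
  proof -
    have "normal_density m s (m + s * x) = (1 / s) * std_normal_density x"
      using s(1) unfolding normal_density_def by (simp add: real_sqrt_mult power_mult_distrib)
    moreover have "(m + s * x) / s = m / s + x" using s(1) by (simp add: field_simps)
    ultimately show ?thesis unfolding f_def by (simp add: poly_pcompose)
  qed
  have "integrable lborel (\<lambda>x. f (m + s * x))" unfolding f
    by (intro integrable_mult_right integrable_gauss_poly)
  then have i: "integrable lborel f" using s(1) by (simp add: lborel_integrable_real_affine_iff)
  then show "integrable (gaussian m v) (\<lambda>y. poly p (y / sqrt v))"
    unfolding gaussian_def s_def[symmetric] f_def by (subst integrable_density) auto
  have "(\<integral>y. poly p (y / s) \<partial>gaussian m v) = (\<integral>y. f y \<partial>lborel)"
    unfolding gaussian_def s_def[symmetric] f_def by (subst integral_density) auto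
  also have "\<dots> = \<bar>s\<bar> *\<^sub>R (\<integral>x. f (m + s * x) \<partial>lborel)"
    using s(1) by (intro lborel_integral_real_affine) simp
  also have "\<dots> = gauss_mean (p \<circ>\<^sub>p [:m / s, 1:])"
    unfolding f gauss_mean_def using s(1) by simp
  finally show "(\<integral>y. poly p (y / sqrt v) \<partial>gaussian m v) = gauss_mean (p \<circ>\<^sub>p [:m / sqrt v, 1:])"
    by (simp add: s_def)
qed

lemma integrable_hermite_fun: "v > 0 \<Longrightarrow> integrable (gaussian m v) (hermite_fun v n)"
  unfolding hermite_fun_def[abs_def] by (rule integrable_divide) (rule gaussian_poly(1))

lemma integral_hermite_fun: "v > 0 \<Longrightarrow> (\<integral>y. hermite_fun v n y \<partial>gaussian m v) = (m / sqrt v) ^ n / sqrt (fact n)"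
  unfolding hermite_fun_def[abs_def] using gaussian_poly[of v m "hermite n"] 
  by (simp add: gauss_mean_hermite_shift)

lemma hermite_fun_orthonormal:
  assumes "v > 0"
  shows "integrable (gaussian 0 v) (\<lambda>y. hermite_fun v n y * hermite_fun v k y)"
    and "(\<integral>y. hermite_fun v n y * hermite_fun v k y \<partial>gaussian 0 v) = (if n = k then 1 else 0)"
proof -
  have eq: "hermite_fun v n y * hermite_fun v k y = poly (hermite n * hermite k) (y / sqrt v) / (sqrt (fact n) * sqrt (fact k))" for y
    unfolding hermite_fun_def by simp
  show "integrable (gaussian 0 v) (\<lambda>y. hermite_fun v n y * hermite_fun v k y)"
    unfolding eq using assms by (intro integrable_divide gaussian_poly(1))
  have "gauss_mean ((hermite n * hermite k) \<circ>\<^sub>p [:0, 1:]) = gauss_mean (hermite n * hermite k)"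
    by simp
  then show "(\<integral>y. hermite_fun v n y * hermite_fun v k y \<partial>gaussian 0 v) = (if n = k then 1 else 0)"
    unfolding eq using gaussian_poly(2)[OF assms, of 0 "hermite n * hermite k"]
    by (simp add: gauss_mean_hermite_mult)
qed

lemma power_hermite_expansion:
  assumes "v > 0"
  shows "\<exists>c. \<forall>y. y ^ k = (\<Sum>j\<le>k. c j * hermite_fun v j y)"
proof -
  obtain c where c: "monom 1 k = (\<Sum>j\<le>k. smult (c j) (hermite j))"
    using hermite_expansion[of "monom 1 k" k] degree_monom_le by blast
  have "y ^ k = (\<Sum>j\<le>k. (sqrt v ^ k * c j * sqrt (fact j)) * hermite_fun v j y)" for y
  proof -
    have "y ^ k = sqrt v ^ k * poly (monom 1 k) (y / sqrt v)"
      using assms by (simp add: poly_monom power_divide)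
    also have "\<dots> = (\<Sum>j\<le>k. (sqrt v ^ k * c j * sqrt (fact j)) * hermite_fun v j y)"
      unfolding c by (simp add: poly_sum sum_distrib_left hermite_fun_def mult_ac)
    finally show ?thesis .
  qed
  then show ?thesis by (intro exI[of _ "\<lambda>j. sqrt v ^ k * c j * sqrt (fact j)"] allI)
qed

section \<open>Low-degree projection of the likelihood ratio\<close>

text \<open>Extensional functions, so that an exponent vector is determined by its values on
  \<open>J\<close> and the set is finite.\<close>

definition multi_indices :: "'i set \<Rightarrow> nat \<Rightarrow> ('i \<Rightarrow> nat) set" where
  "multi_indices J D = {\<alpha> \<in> J \<rightarrow>\<^sub>E UNIV. (\<Sum>p\<in>J. \<alpha> p) \<le> D}"

lemma finite_multi_indices:
  assumes "finite J"
  shows "finite (multi_indices J D)"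
proof (rule finite_subset)
  show "multi_indices J D \<subseteq> J \<rightarrow>\<^sub>E {..D}"
  proof
    fix \<alpha> assume a: "\<alpha> \<in> multi_indices J D"
    have "\<alpha> p \<le> D" if "p \<in> J" for p
      using a member_le_sum[OF that, of \<alpha>] assms by (simp add: multi_indices_def)
    then show "\<alpha> \<in> J \<rightarrow>\<^sub>E {..D}" using a by (auto simp: multi_indices_def PiE_iff)
  qed
  show "finite (J \<rightarrow>\<^sub>E {..D})" using assms by (intro finite_PiE) auto
qed

text \<open>The multinomial theorem summed over all degrees up to \<open>D\<close>; peeling off one
  variable matches the convolution formula \<open>exp_trunc_add\<close>.\<close>

lemma sum_multi_indices_eq_exp_trunc:
  assumes "finite J"
  shows "(\<Sum>\<alpha>\<in>multi_indices J D. \<Prod>p\<in>J. z p ^ \<alpha> p / fact (\<alpha> p)) = exp_trunc D (\<Sum>p\<in>J. z p)"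
  using assms
proof (induction J arbitrary: D rule: finite_induct)
  case empty
  then show ?case by (simp add: multi_indices_def)
next
  case (insert x F)
  let ?S = "SIGMA k:{..D}. multi_indices F (D - k)"
  have "(\<Sum>\<alpha>\<in>multi_indices (insert x F) D. \<Prod>p\<in>insert x F. z p ^ \<alpha> p / fact (\<alpha> p)) =
    (\<Sum>(k, \<alpha>)\<in>?S. z x ^ k / fact k * (\<Prod>p\<in>F. z p ^ \<alpha> p / fact (\<alpha> p)))"
  \<comment> \<open>An exponent vector corresponds to its value at \<open>x\<close> and its
    restriction to \<open>F\<close>; resetting \<open>x\<close> to \<open>undefined\<close> keeps
    the restriction extensional on \<open>F\<close>.\<close>
  proof (rule sum.reindex_bij_witness[of _ "\<lambda>(k, \<alpha>). \<alpha>(x := k)" "\<lambda>\<alpha>. (\<alpha> x, \<alpha>(x := undefined))"])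
    fix \<alpha> assume \<alpha>: "\<alpha> \<in> multi_indices (insert x F) D"
    then have s: "\<alpha> x + (\<Sum>p\<in>F. \<alpha> p) \<le> D" and e: "\<alpha> \<in> insert x F \<rightarrow>\<^sub>E UNIV"
      using insert.hyps by (auto simp: multi_indices_def)
    have sF: "(\<Sum>p\<in>F. (\<alpha>(x := undefined)) p) = (\<Sum>p\<in>F. \<alpha> p)"
      using insert.hyps by (intro sum.cong) auto
    show "(\<alpha> x, \<alpha>(x := undefined)) \<in> ?S"
      using s e sF insert.hyps by (auto simp: multi_indices_def PiE_iff extensional_def)
    have "(\<Prod>p\<in>F. z p ^ (\<alpha>(x := undefined)) p / fact ((\<alpha>(x := undefined)) p)) = (\<Prod>p\<in>F. z p ^ \<alpha> p / fact (\<alpha> p))"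
      using insert.hyps by (intro prod.cong) auto
    then show "(case (\<alpha> x, \<alpha>(x := undefined)) of (k, \<alpha>) \<Rightarrow> z x ^ k / fact k * (\<Prod>p\<in>F. z p ^ \<alpha> p / fact (\<alpha> p))) =
      (\<Prod>p\<in>insert x F. z p ^ \<alpha> p / fact (\<alpha> p))"
      using insert.hyps by simp
  next
    fix y assume "y \<in> ?S"
    then obtain k \<beta> where y: "y = (k, \<beta>)" and k: "k \<le> D" and b: "\<beta> \<in> multi_indices F (D - k)" by auto
    have bx: "\<beta> x = undefined" using b insert.hyps by (auto simp: multi_indices_def PiE_iff extensional_def)
    then show "(\<lambda>\<alpha>. (\<alpha> x, \<alpha>(x := undefined))) (case y of (k, \<alpha>) \<Rightarrow> \<alpha>(x := k)) = y"
      by (simp add: y fun_upd_idem)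
    have "(\<Sum>p\<in>F. (\<beta>(x := k)) p) = (\<Sum>p\<in>F. \<beta> p)" using insert.hyps by (intro sum.cong) auto
    then show "(case y of (k, \<alpha>) \<Rightarrow> \<alpha>(x := k)) \<in> multi_indices (insert x F) D"
      using b k insert.hyps by (auto simp: y multi_indices_def PiE_iff extensional_def)
  qed auto
  also have "\<dots> = (\<Sum>k\<le>D. \<Sum>\<alpha>\<in>multi_indices F (D - k). z x ^ k / fact k * (\<Prod>p\<in>F. z p ^ \<alpha> p / fact (\<alpha> p)))"
    by (rule sum.Sigma[symmetric]) (auto intro: finite_multi_indices insert.hyps)
  also have "\<dots> = (\<Sum>k\<le>D. z x ^ k / fact k * exp_trunc (D - k) (\<Sum>p\<in>F. z p))"
    unfolding sum_distrib_left[symmetric] insert.IH ..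
  also have "\<dots> = exp_trunc D (\<Sum>p\<in>insert x F. z p)"
    using insert.hyps by (simp add: exp_trunc_add)
  finally show ?case .
qed

lemma ennreal_integral_le_nn_integral:
  fixes f :: "'a \<Rightarrow> real"
  assumes "integrable M f"
  shows "ennreal (\<integral>x. f x \<partial>M) \<le> (\<integral>\<^sup>+x. ennreal (f x) \<partial>M)"
proof -
  have "(\<integral>x. f x \<partial>M) \<le> (\<integral>x. max 0 (f x) \<partial>M)" using assms by (intro integral_mono) auto
  then have "ennreal (\<integral>x. f x \<partial>M) \<le> ennreal (\<integral>x. max 0 (f x) \<partial>M)" by (rule ennreal_leI)
  also have "\<dots> = (\<integral>\<^sup>+x. ennreal (max 0 (f x)) \<partial>M)"
    using assms by (intro nn_integral_eq_integral[symmetric]) auto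
  finally show ?thesis by simp
qed

section \<open>Hermite coefficients of polynomial statistics\<close>

context spiked_model
begin

definition hermite_prod :: "(nat \<times> nat \<Rightarrow> nat) \<Rightarrow> (nat \<times> nat \<Rightarrow> real) \<Rightarrow> real" where
  "hermite_prod \<alpha> Y = (\<Prod>p\<in>J. hermite_fun (nvar p) (\<alpha> p) (Y p))"

definition signal_moment :: "(nat \<times> nat \<Rightarrow> nat) \<Rightarrow> (nat \<times> nat \<Rightarrow> real) \<Rightarrow> real" where
  "signal_moment \<alpha> X = (\<Prod>p\<in>J. (X p / sqrt (nvar p)) ^ \<alpha> p / sqrt (fact (\<alpha> p)))"

abbreviation "I0 \<equiv> \<lambda>p\<in>J. 0 :: nat"

lemma measurable_hermite_prod [measurable]: "hermite_prod \<alpha> \<in> borel_measurable (PiM J (\<lambda>_. borel))"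
  unfolding hermite_prod_def by measurable

lemma integrable_obs_hermite: "integrable (obs X) (hermite_prod \<alpha>)"
  and integral_obs_hermite: "(\<integral>Y. hermite_prod \<alpha> Y \<partial>obs X) = signal_moment \<alpha> X"
proof -
  interpret product_sigma_finite "\<lambda>p. gaussian (X p) (nvar p)" by (rule product_sigma_gaussian)
  show "integrable (obs X) (hermite_prod \<alpha>)"
    unfolding obs_eq hermite_prod_def[abs_def]
    by (intro product_integrable_prod finJ integrable_hermite_fun nvar_pos)
  have "(\<integral>Y. hermite_prod \<alpha> Y \<partial>obs X) = (\<Prod>p\<in>J. \<integral>y. hermite_fun (nvar p) (\<alpha> p) y \<partial>gaussian (X p) (nvar p))"
    unfolding obs_eq hermite_prod_def
    by (intro product_integral_prod finJ integrable_hermite_fun nvar_pos)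
  then show "(\<integral>Y. hermite_prod \<alpha> Y \<partial>obs X) = signal_moment \<alpha> X"
    unfolding signal_moment_def by (simp add: integral_hermite_fun nvar_pos)
qed

lemma integrable_Q_hermite_mult: "integrable Q (\<lambda>Y. hermite_prod \<alpha> Y * hermite_prod \<beta> Y)"
  and integral_Q_hermite_mult: "\<alpha> \<in> J \<rightarrow>\<^sub>E UNIV \<Longrightarrow> \<beta> \<in> J \<rightarrow>\<^sub>E UNIV \<Longrightarrow>
    (\<integral>Y. hermite_prod \<alpha> Y * hermite_prod \<beta> Y \<partial>Q) = (if \<alpha> = \<beta> then 1 else 0)"
proof -
  interpret product_sigma_finite "\<lambda>p. gaussian 0 (nvar p)" by (rule product_sigma_gaussian)
  have Qeq: "Q = PiM J (\<lambda>p. gaussian 0 (nvar p))" unfolding null_law_def by (rule obs_eq)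
  show "integrable Q (\<lambda>Y. hermite_prod \<alpha> Y * hermite_prod \<beta> Y)"
    unfolding Qeq hermite_prod_def prod.distrib[symmetric]
    by (intro product_integrable_prod finJ hermite_fun_orthonormal nvar_pos)
  assume \<alpha>: "\<alpha> \<in> J \<rightarrow>\<^sub>E UNIV" "\<beta> \<in> J \<rightarrow>\<^sub>E UNIV"
  have "(\<integral>Y. hermite_prod \<alpha> Y * hermite_prod \<beta> Y \<partial>Q) =
    (\<Prod>p\<in>J. \<integral>y. hermite_fun (nvar p) (\<alpha> p) y * hermite_fun (nvar p) (\<beta> p) y \<partial>gaussian 0 (nvar p))"
    unfolding Qeq hermite_prod_def prod.distrib[symmetric]
    by (intro product_integral_prod finJ hermite_fun_orthonormal nvar_pos)
  also have "\<dots> = (\<Prod>p\<in>J. if \<alpha> p = \<beta> p then 1 else 0)"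
    by (simp add: hermite_fun_orthonormal nvar_pos)
  also have "\<dots> = (if \<alpha> = \<beta> then 1 else 0)"
  proof (cases "\<alpha> = \<beta>")
    case False
    then obtain p where "p \<in> J" "\<alpha> p \<noteq> \<beta> p" using \<alpha> by (metis PiE_ext)
    then show ?thesis using False by (auto intro!: prod_zero bexI[of _ p])
  qed simp
  finally show "(\<integral>Y. hermite_prod \<alpha> Y * hermite_prod \<beta> Y \<partial>Q) = (if \<alpha> = \<beta> then 1 else 0)" .
qed

lemma hermite_prod_I0: "hermite_prod I0 = (\<lambda>_. 1)"
  by (rule ext) (simp add: hermite_prod_def hermite_fun_def)

lemma I0_multi_indices: "I0 \<in> multi_indices J D"
  unfolding multi_indices_def by simp

text \<open>Positive and negative part are treated separately as nonnegative integrals, where the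
  formula for \<open>bind\<close> applies without integrability, and then recombined as finite
  reals.\<close>

lemma integral_P:
  fixes g :: "(nat \<times> nat \<Rightarrow> real) \<Rightarrow> real"
  assumes [measurable]: "g \<in> borel_measurable (PiM J (\<lambda>_. borel))"
    and P: "integrable P g" and obs: "\<And>X. integrable (obs X) g"
  shows "(\<integral>Y. g Y \<partial>P) = (\<integral>X. (\<integral>Y. g Y \<partial>obs X) \<partial>S)"
proof -
  interpret S: prob_space S by (rule prob_S)
  define u where "u X = (\<integral>\<^sup>+Y. ennreal (g Y) \<partial>obs X)" for X
  define w where "w X = (\<integral>\<^sup>+Y. ennreal (- g Y) \<partial>obs X)" for X
  have "(\<lambda>X. \<integral>\<^sup>+Y. h Y \<partial>obs X) \<in> borel_measurable S" if "h \<in> borel_measurable (PiM J (\<lambda>_. borel))" for h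
    by (rule measurable_compose[OF measurable_obs nn_integral_measurable_subprob_algebra[OF that]])
  then have m[measurable]: "u \<in> borel_measurable S" "w \<in> borel_measurable S"
    unfolding u_def w_def by simp_all
  have fin: "u X < \<infinity>" "w X < \<infinity>" for X
    using obs[of X] unfolding u_def w_def real_integrable_def by (auto simp: less_top)
  have U: "(\<integral>\<^sup>+Y. ennreal (g Y) \<partial>P) = (\<integral>\<^sup>+X. u X \<partial>S)" "(\<integral>\<^sup>+Y. ennreal (- g Y) \<partial>P) = (\<integral>\<^sup>+X. w X \<partial>S)"
    unfolding P_def u_def w_def by (intro nn_integral_bind[OF _ measurable_obs]; measurable)+
  have finU: "(\<integral>\<^sup>+X. u X \<partial>S) < \<infinity>" "(\<integral>\<^sup>+X. w X \<partial>S) < \<infinity>"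
    using P unfolding real_integrable_def U by (auto simp: less_top)
  have e: "ennreal (enn2real (u X)) = u X" "ennreal (enn2real (w X)) = w X" for X
    using fin[of X] by (auto simp: less_top)
  have i: "integrable S (\<lambda>X. enn2real (u X))" "integrable S (\<lambda>X. enn2real (w X))"
    using finU by (auto simp: integrable_iff_bounded e)
  have "(\<integral>X. (\<integral>Y. g Y \<partial>obs X) \<partial>S) = (\<integral>X. enn2real (u X) - enn2real (w X) \<partial>S)"
    using obs by (simp add: real_lebesgue_integral_def u_def w_def)
  also have "\<dots> = (\<integral>X. enn2real (u X) \<partial>S) - (\<integral>X. enn2real (w X) \<partial>S)"
    using i by (rule Bochner_Integration.integral_diff)
  also have "\<dots> = enn2real (\<integral>\<^sup>+X. u X \<partial>S) - enn2real (\<integral>\<^sup>+X. w X \<partial>S)"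
    by (simp add: integral_eq_nn_integral e)
  also have "\<dots> = (\<integral>Y. g Y \<partial>P)"
    using P by (simp add: real_lebesgue_integral_def U)
  finally show ?thesis by simp
qed

text \<open>In the orthonormal Hermite basis the mean difference is the inner product of the
  coefficients \<open>b\<close> of the centred \<open>f\<close> with the coefficients
  \<open>a\<close> of the likelihood ratio. Cauchy--Schwarz leaves the sum of squares of
  \<open>b\<close>, which is the variance under \<open>Q\<close>, and that of \<open>a\<close>,
  which is the truncated second moment.\<close>

lemma hermite_mean_difference_le:
  assumes bdd: "AE X in S. \<forall>p\<in>J. \<bar>X p\<bar> \<le> B"
    and K: "K \<ge> 0" "(\<integral>\<^sup>+X. \<integral>\<^sup>+X'. ennreal (exp_trunc D \<bar>overlap X X'\<bar>) \<partial>S \<partial>S) \<le> ennreal K"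
    and f: "\<And>Y. f Y = (\<Sum>\<alpha>\<in>multi_indices J D. c \<alpha> * hermite_prod \<alpha> Y)"
  shows "(\<integral>y. f y \<partial>P) - (\<integral>y. f y \<partial>Q) \<le> sqrt K * sqrt (var Q f)"
proof -
  interpret S: prob_space S by (rule prob_S)
  interpret Q: prob_space Q by (rule prob_Q)
  interpret P: prob_space P by (rule prob_P)
  let ?A = "multi_indices J D"
  have finA: "finite ?A" by (intro finite_multi_indices finJ)
  have A: "\<alpha> \<in> ?A \<Longrightarrow> \<alpha> \<in> J \<rightarrow>\<^sub>E UNIV" for \<alpha> by (simp add: multi_indices_def)
  define a where "a \<alpha> = (\<integral>Y. hermite_prod \<alpha> Y \<partial>P)" for \<alpha>
  \<comment> \<open>The constant term contributes equally to both means, so it is removed from the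
    coefficients.\<close>
  define b where "b = c(I0 := 0)"
  define M where "M = (\<Sum>p\<in>J. \<bar>B\<bar> * \<bar>B\<bar> / nvar p)"
  have ov: "\<bar>overlap X X'\<bar> \<le> M" if "\<forall>p\<in>J. \<bar>X p\<bar> \<le> B" "\<forall>p\<in>J. \<bar>X' p\<bar> \<le> B" for X X'
    unfolding overlap_def M_def using that nvar_pos
    by (intro order_trans[OF sum_abs] sum_mono) (auto simp: abs_mult less_imp_le intro!: divide_right_mono mult_mono)
  \<comment> \<open>This crude bound may depend on \<open>N\<close>; it serves to make the Hermite
    products integrable under \<open>P\<close>.\<close>
  have K1: "(\<integral>\<^sup>+Y. (avg_lr Y)\<^sup>2 \<partial>Q) \<le> ennreal (exp M)"
  proof -
    have "(\<integral>\<^sup>+X. \<integral>\<^sup>+X'. ennreal (exp (overlap X X')) \<partial>S \<partial>S) \<le> (\<integral>\<^sup>+X. \<integral>\<^sup>+X'. ennreal (exp M) \<partial>S \<partial>S)"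
    proof (rule nn_integral_mono_AE, use bdd in eventually_elim)
      fix X assume X: "\<forall>p\<in>J. \<bar>X p\<bar> \<le> B"
      show "(\<integral>\<^sup>+X'. ennreal (exp (overlap X X')) \<partial>S) \<le> (\<integral>\<^sup>+X'. ennreal (exp M) \<partial>S)"
        by (rule nn_integral_mono_AE, use bdd in eventually_elim) (use ov[OF X] in \<open>auto intro: order_trans[OF abs_ge_self]\<close>)
    qed
    then show ?thesis by (simp add: nn_integral_avg_lr_square S.emeasure_space_1)
  qed
  have intQ: "integrable Q (hermite_prod \<alpha>)" for \<alpha>
    using integrable_obs_hermite[of "\<lambda>_. 0" \<alpha>] by (simp add: null_law_def)
  have intQ2: "integrable Q (\<lambda>Y. (hermite_prod \<alpha> Y)\<^sup>2)" for \<alpha>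
    using integrable_Q_hermite_mult[of \<alpha> \<alpha>] by (simp add: power2_eq_square)
  have intP: "integrable P (hermite_prod \<alpha>)" for \<alpha>
  proof -
    have "(\<integral>\<^sup>+Y. ennreal \<bar>hermite_prod \<alpha> Y\<bar> \<partial>P)\<^sup>2 \<le> ennreal (exp M) * (\<integral>\<^sup>+Y. (ennreal \<bar>hermite_prod \<alpha> Y\<bar>)\<^sup>2 \<partial>Q)"
      by (rule nn_integral_P_square_le[OF _ K1]) measurable
    also have "(\<integral>\<^sup>+Y. (ennreal \<bar>hermite_prod \<alpha> Y\<bar>)\<^sup>2 \<partial>Q) = ennreal (\<integral>Y. (hermite_prod \<alpha> Y)\<^sup>2 \<partial>Q)"
      using nn_integral_eq_integral[OF intQ2[of \<alpha>]] by (simp add: ennreal_power)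
    finally have "(\<integral>\<^sup>+Y. ennreal \<bar>hermite_prod \<alpha> Y\<bar> \<partial>P)\<^sup>2 < \<infinity>"
      by (rule le_less_trans) (simp add: ennreal_mult''[symmetric])
    then have "(\<integral>\<^sup>+Y. ennreal \<bar>hermite_prod \<alpha> Y\<bar> \<partial>P) < \<infinity>"
      by (auto simp: power2_eq_square ennreal_mult_less_top)
    then show ?thesis by (simp add: integrable_iff_bounded measurable_cong_sets[OF sets_P refl])
  qed
  have a_eq: "a \<alpha> = (\<integral>X. signal_moment \<alpha> X \<partial>S)" for \<alpha>
    unfolding a_def by (subst integral_P) (auto simp: intP integrable_obs_hermite integral_obs_hermite)
  have EQ: "(\<integral>Y. hermite_prod \<alpha> Y \<partial>Q) = (if \<alpha> = I0 then 1 else 0)" if "\<alpha> \<in> ?A" for \<alpha>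
    using integral_Q_hermite_mult[of \<alpha> I0] A[OF that] by (simp add: hermite_prod_I0)
  have a0: "a I0 = 1" unfolding a_def by (simp add: hermite_prod_I0 P.prob_space)
  have Pf: "(\<integral>y. f y \<partial>P) = (\<Sum>\<alpha>\<in>?A. c \<alpha> * a \<alpha>)"
    unfolding f a_def using intP by (simp add: Bochner_Integration.integral_sum)
  have Qf: "(\<integral>y. f y \<partial>Q) = c I0"
  proof -
    have "(\<integral>y. f y \<partial>Q) = (\<Sum>\<alpha>\<in>?A. c \<alpha> * (\<integral>Y. hermite_prod \<alpha> Y \<partial>Q))"
      unfolding f using intQ by (simp add: Bochner_Integration.integral_sum)
    also have "\<dots> = (\<Sum>\<alpha>\<in>?A. if \<alpha> = I0 then c \<alpha> else 0)"
      by (intro sum.cong) (auto simp: EQ)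
    finally show ?thesis using I0_multi_indices finA by simp
  qed
  have c_b: "(\<Sum>\<alpha>\<in>?A. c \<alpha> * g \<alpha>) - c I0 * g I0 = (\<Sum>\<alpha>\<in>?A. b \<alpha> * g \<alpha>)" for g :: "_ \<Rightarrow> real"
    unfolding sum.remove[OF finA I0_multi_indices] by (simp add: b_def)
  have diff: "(\<integral>y. f y \<partial>P) - (\<integral>y. f y \<partial>Q) = (\<Sum>\<alpha>\<in>?A. b \<alpha> * a \<alpha>)"
    using c_b[of a] by (simp add: Pf Qf a0)
  have "f Y - (\<integral>y. f y \<partial>Q) = (\<Sum>\<alpha>\<in>?A. b \<alpha> * hermite_prod \<alpha> Y)" for Y
    using c_b[of "\<lambda>\<alpha>. hermite_prod \<alpha> Y"] by (simp add: f[symmetric] Qf hermite_prod_I0)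
  then have "var Q f = (\<integral>Y. (\<Sum>\<alpha>\<in>?A. b \<alpha> * hermite_prod \<alpha> Y)\<^sup>2 \<partial>Q)"
    unfolding var_def by simp
  also have "\<dots> = (\<integral>Y. (\<Sum>\<alpha>\<in>?A. \<Sum>\<beta>\<in>?A. (b \<alpha> * b \<beta>) * (hermite_prod \<alpha> Y * hermite_prod \<beta> Y)) \<partial>Q)"
    by (simp add: power2_eq_square sum_product mult_ac)
  also have "\<dots> = (\<Sum>\<alpha>\<in>?A. \<Sum>\<beta>\<in>?A. (b \<alpha> * b \<beta>) * (\<integral>Y. hermite_prod \<alpha> Y * hermite_prod \<beta> Y \<partial>Q))"
    using integrable_Q_hermite_mult by (simp add: Bochner_Integration.integral_sum)
  also have "\<dots> = (\<Sum>\<alpha>\<in>?A. \<Sum>\<beta>\<in>?A. if \<beta> = \<alpha> then (b \<alpha>)\<^sup>2 else 0)"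
    by (intro sum.cong) (auto simp: integral_Q_hermite_mult A power2_eq_square)
  also have "\<dots> = (\<Sum>\<alpha>\<in>?A. (b \<alpha>)\<^sup>2)" using finA by simp
  finally have var: "var Q f = (\<Sum>\<alpha>\<in>?A. (b \<alpha>)\<^sup>2)" .
  have msm[measurable]: "signal_moment \<alpha> \<in> borel_measurable S" for \<alpha>
  proof -
    note measurable_S[measurable]
    show ?thesis unfolding signal_moment_def[abs_def] by measurable
  qed
  have int_sm: "integrable S (signal_moment \<alpha>)" for \<alpha>
  proof (rule S.integrable_const_bound)
    show "AE X in S. norm (signal_moment \<alpha> X) \<le> (\<Prod>p\<in>J. (\<bar>B\<bar> / sqrt (nvar p)) ^ \<alpha> p / sqrt (fact (\<alpha> p)))"
      using bdd
    proof eventually_elim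
      fix X assume X: "\<forall>p\<in>J. \<bar>X p\<bar> \<le> B"
      show "norm (signal_moment \<alpha> X) \<le> (\<Prod>p\<in>J. (\<bar>B\<bar> / sqrt (nvar p)) ^ \<alpha> p / sqrt (fact (\<alpha> p)))"
        unfolding signal_moment_def real_norm_def abs_prod
      proof (intro prod_mono conjI abs_ge_zero)
        fix p assume p: "p \<in> J"
        have "\<bar>X p / sqrt (nvar p)\<bar> ^ \<alpha> p \<le> (\<bar>B\<bar> / sqrt (nvar p)) ^ \<alpha> p"
          using X p nvar_pos[of p] by (intro power_mono) (auto simp: abs_divide intro!: divide_right_mono)
        then show "\<bar>(X p / sqrt (nvar p)) ^ \<alpha> p / sqrt (fact (\<alpha> p))\<bar> \<le> (\<bar>B\<bar> / sqrt (nvar p)) ^ \<alpha> p / sqrt (fact (\<alpha> p))"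
          by (simp add: abs_divide power_abs divide_right_mono)
      qed
    qed
  qed simp
  \<comment> \<open>Here orthogonal projection becomes truncation: the products of coefficients of
    degree at most \<open>D\<close> sum to the Taylor polynomial of the overlap.\<close>
  have sm: "(\<Sum>\<alpha>\<in>?A. signal_moment \<alpha> X * signal_moment \<alpha> X') = exp_trunc D (overlap X X')" for X X'
  proof -
    have "signal_moment \<alpha> X * signal_moment \<alpha> X' = (\<Prod>p\<in>J. (X p * X' p / nvar p) ^ \<alpha> p / fact (\<alpha> p))" for \<alpha>
      unfolding signal_moment_def prod.distrib[symmetric] using nvar_pos
      by (intro prod.cong) (auto simp: power_mult_distrib[symmetric] power_divide[symmetric] less_imp_le)
    then show ?thesis unfolding overlap_def
      using sum_multi_indices_eq_exp_trunc[OF finJ, of "\<lambda>p. X p * X' p / nvar p" D] by simp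
  qed
  have i1: "integrable S (\<lambda>X'. \<Sum>\<alpha>\<in>?A. signal_moment \<alpha> X * signal_moment \<alpha> X')" for X
    using int_sm by auto
  have i2: "integrable S (\<lambda>X. \<Sum>\<alpha>\<in>?A. signal_moment \<alpha> X * a \<alpha>)"
    using int_sm by auto
  have i3: "(\<integral>X'. (\<Sum>\<alpha>\<in>?A. signal_moment \<alpha> X * signal_moment \<alpha> X') \<partial>S) = (\<Sum>\<alpha>\<in>?A. signal_moment \<alpha> X * a \<alpha>)" for X
    unfolding a_eq by (subst Bochner_Integration.integral_sum) (auto simp: int_sm)
  have i4: "(\<Sum>\<alpha>\<in>?A. (a \<alpha>)\<^sup>2) = (\<integral>X. (\<Sum>\<alpha>\<in>?A. signal_moment \<alpha> X * a \<alpha>) \<partial>S)"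
    using int_sm by (simp add: Bochner_Integration.integral_sum a_eq power2_eq_square)
  \<comment> \<open>Each \<open>a \<alpha>\<close> is an average over the signal, so its square is a
    double average over two copies. In \<open>ennreal\<close> negative integrands become 0, which
    costs only an inequality at each of the two integrals.\<close>
  have "ennreal (\<Sum>\<alpha>\<in>?A. (a \<alpha>)\<^sup>2) \<le> (\<integral>\<^sup>+X. ennreal (\<Sum>\<alpha>\<in>?A. signal_moment \<alpha> X * a \<alpha>) \<partial>S)"
    unfolding i4 using i2 by (rule ennreal_integral_le_nn_integral)
  also have "\<dots> = (\<integral>\<^sup>+X. ennreal (\<integral>X'. (\<Sum>\<alpha>\<in>?A. signal_moment \<alpha> X * signal_moment \<alpha> X') \<partial>S) \<partial>S)"
    by (simp only: i3)
  also have "\<dots> \<le> (\<integral>\<^sup>+X. \<integral>\<^sup>+X'. ennreal (\<Sum>\<alpha>\<in>?A. signal_moment \<alpha> X * signal_moment \<alpha> X') \<partial>S \<partial>S)"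
    by (intro nn_integral_mono ennreal_integral_le_nn_integral i1)
  also have "\<dots> \<le> (\<integral>\<^sup>+X. \<integral>\<^sup>+X'. ennreal (exp_trunc D \<bar>overlap X X'\<bar>) \<partial>S \<partial>S)"
    unfolding sm
  proof (intro nn_integral_mono ennreal_leI)
    fix X X'
    show "exp_trunc D (overlap X X') \<le> exp_trunc D \<bar>overlap X X'\<bar>"
      unfolding exp_trunc_def by (intro sum_mono divide_right_mono) (auto simp flip: power_abs)
  qed
  also have "\<dots> \<le> ennreal K" by (rule K(2))
  finally have aK: "(\<Sum>\<alpha>\<in>?A. (a \<alpha>)\<^sup>2) \<le> K" using K(1) by simp
  have "(\<Sum>\<alpha>\<in>?A. b \<alpha> * a \<alpha>)\<^sup>2 \<le> (\<Sum>\<alpha>\<in>?A. (b \<alpha>)\<^sup>2) * (\<Sum>\<alpha>\<in>?A. (a \<alpha>)\<^sup>2)"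
    by (rule Cauchy_Schwarz_ineq_sum)
  also have "\<dots> \<le> var Q f * K"
    unfolding var using aK by (intro mult_left_mono) (auto intro: sum_nonneg)
  finally have "(\<integral>y. f y \<partial>P) - (\<integral>y. f y \<partial>Q) \<le> sqrt (var Q f * K)"
    unfolding diff by (rule real_le_rsqrt)
  then show ?thesis by (simp add: real_sqrt_mult mult.commute)
qed

text \<open>Multiply the one-dimensional expansions of the factors. An index in the resulting box is
  bounded coordinatewise by the exponents, so its total degree stays within
  \<open>D\<close>.\<close>

lemma monomial_hermite_expansion:
  assumes "Poly_Mapping.keys m \<subseteq> J" "(\<Sum>v\<in>Poly_Mapping.keys m. Poly_Mapping.lookup m v) \<le> D"
  shows "\<exists>c. \<forall>Y. (\<Prod>v\<in>Poly_Mapping.keys m. Y v ^ Poly_Mapping.lookup m v) =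
    (\<Sum>\<alpha>\<in>multi_indices J D. c \<alpha> * hermite_prod \<alpha> Y)"
proof -
  define l where "l = Poly_Mapping.lookup m"
  have l0: "l p = 0" if "p \<in> J - Poly_Mapping.keys m" for p using that by (simp add: l_def in_keys_iff)
  have "\<exists>c. \<forall>y. y ^ l p = (\<Sum>j\<le>l p. c j * hermite_fun (nvar p) j y)" for p
    by (rule power_hermite_expansion[OF nvar_pos])
  then obtain c where c: "\<And>p y. y ^ l p = (\<Sum>j\<le>l p. c p j * hermite_fun (nvar p) j y)" by metis
  let ?B = "Pi\<^sub>E J (\<lambda>p. {..l p})"
  have deg: "(\<Sum>p\<in>J. l p) \<le> D"
  proof -
    have "(\<Sum>p\<in>J. l p) = (\<Sum>v\<in>Poly_Mapping.keys m. l v)"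
      using assms(1) l0 by (intro sum.mono_neutral_right) auto
    then show ?thesis using assms(2) by (simp add: l_def)
  qed
  have sub: "?B \<subseteq> multi_indices J D"
  proof
    fix \<alpha> assume a: "\<alpha> \<in> ?B"
    then have "(\<Sum>p\<in>J. \<alpha> p) \<le> (\<Sum>p\<in>J. l p)" by (intro sum_mono) auto
    then show "\<alpha> \<in> multi_indices J D" using a deg by (auto simp: multi_indices_def PiE_iff)
  qed
  define C where "C \<alpha> = (if \<alpha> \<in> ?B then (\<Prod>p\<in>J. c p (\<alpha> p)) else 0)" for \<alpha>
  have "(\<Prod>v\<in>Poly_Mapping.keys m. Y v ^ l v) = (\<Sum>\<alpha>\<in>multi_indices J D. C \<alpha> * hermite_prod \<alpha> Y)" for Y
  proof -
    have "(\<Prod>v\<in>Poly_Mapping.keys m. Y v ^ l v) = (\<Prod>p\<in>J. Y p ^ l p)"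
      using assms(1) l0 by (intro prod.mono_neutral_left) auto
    also have "\<dots> = (\<Prod>p\<in>J. \<Sum>j\<le>l p. c p j * hermite_fun (nvar p) j (Y p))"
      by (simp only: c)
    also have "\<dots> = (\<Sum>\<alpha>\<in>?B. \<Prod>p\<in>J. c p (\<alpha> p) * hermite_fun (nvar p) (\<alpha> p) (Y p))"
      by (rule prod_sum_PiE) auto
    also have "\<dots> = (\<Sum>\<alpha>\<in>?B. C \<alpha> * hermite_prod \<alpha> Y)"
      by (intro sum.cong) (auto simp: C_def hermite_prod_def prod.distrib)
    also have "\<dots> = (\<Sum>\<alpha>\<in>multi_indices J D. C \<alpha> * hermite_prod \<alpha> Y)"
      using sub by (intro sum.mono_neutral_left finite_multi_indices finJ) (auto simp: C_def)
    finally show ?thesis .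
  qed
  then show ?thesis unfolding l_def by blast
qed

lemma mpoly_hermite_expansion:
  assumes "mpoly_vars q \<subseteq> J" "mpoly_degree q \<le> D"
  shows "\<exists>c. \<forall>Y. mpoly_eval q Y = (\<Sum>\<alpha>\<in>multi_indices J D. c \<alpha> * hermite_prod \<alpha> Y)"
proof -
  have "\<exists>c. \<forall>Y. (\<Prod>v\<in>Poly_Mapping.keys m. Y v ^ Poly_Mapping.lookup m v) =
    (\<Sum>\<alpha>\<in>multi_indices J D. c \<alpha> * hermite_prod \<alpha> Y)" if "m \<in> Poly_Mapping.keys q" for m
  proof (rule monomial_hermite_expansion)
    show "Poly_Mapping.keys m \<subseteq> J" using assms(1) that by (auto simp: mpoly_vars_def)
    have "(\<Sum>v\<in>Poly_Mapping.keys m. Poly_Mapping.lookup m v) \<le> mpoly_degree q"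
      unfolding mpoly_degree_def using that by (intro Max_ge) auto
    then show "(\<Sum>v\<in>Poly_Mapping.keys m. Poly_Mapping.lookup m v) \<le> D" using assms(2) by simp
  qed
  then obtain c where c: "\<And>m Y. m \<in> Poly_Mapping.keys q \<Longrightarrow> (\<Prod>v\<in>Poly_Mapping.keys m. Y v ^ Poly_Mapping.lookup m v) =
    (\<Sum>\<alpha>\<in>multi_indices J D. c m \<alpha> * hermite_prod \<alpha> Y)" by metis
  have "mpoly_eval q Y = (\<Sum>\<alpha>\<in>multi_indices J D. (\<Sum>m\<in>Poly_Mapping.keys q. Poly_Mapping.lookup q m * c m \<alpha>) * hermite_prod \<alpha> Y)" for Y
  proof -
    have "mpoly_eval q Y = (\<Sum>m\<in>Poly_Mapping.keys q. \<Sum>\<alpha>\<in>multi_indices J D. Poly_Mapping.lookup q m * c m \<alpha> * hermite_prod \<alpha> Y)"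
      unfolding mpoly_eval_def by (simp add: c sum_distrib_left mult.assoc)
    also have "\<dots> = (\<Sum>\<alpha>\<in>multi_indices J D. \<Sum>m\<in>Poly_Mapping.keys q. Poly_Mapping.lookup q m * c m \<alpha> * hermite_prod \<alpha> Y)"
      by (rule sum.swap)
    finally show ?thesis by (simp add: sum_distrib_right)
  qed
  then show ?thesis
    by (intro exI[of _ "\<lambda>\<alpha>. \<Sum>m\<in>Poly_Mapping.keys q. Poly_Mapping.lookup q m * c m \<alpha>"] allI)
qed

lemma mpoly_mean_difference_le:
  assumes "AE X in S. \<forall>p\<in>J. \<bar>X p\<bar> \<le> B"
    and "K \<ge> 0" "(\<integral>\<^sup>+X. \<integral>\<^sup>+X'. ennreal (exp_trunc D \<bar>overlap X X'\<bar>) \<partial>S \<partial>S) \<le> ennreal K"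
    and "mpoly_vars q \<subseteq> J" "mpoly_degree q \<le> D"
  shows "(\<integral>y. mpoly_eval q y \<partial>P) - (\<integral>y. mpoly_eval q y \<partial>Q) \<le> sqrt K * sqrt (var Q (mpoly_eval q))"
proof -
  obtain c where "\<And>Y. mpoly_eval q Y = (\<Sum>\<alpha>\<in>multi_indices J D. c \<alpha> * hermite_prod \<alpha> Y)"
    using mpoly_hermite_expansion[OF assms(4,5)] by blast
  then show ?thesis by (rule hermite_mean_difference_le[OF assms(1-3)])
qed

end

section \<open>Moment generating function of the tensor product of two rows\<close>

text \<open>The complement of the support is the union of all open null sets, and by Lindelof
  countably many of them already cover it.\<close>

lemma AE_measure_support:
  fixes \<nu> :: "'a::second_countable_topology measure"
  assumes "sets \<nu> = sets borel"
  shows "AE x in \<nu>. x \<in> measure_support \<nu>"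
proof -
  define F where "F = {U :: 'a set. open U \<and> emeasure \<nu> U = 0}"
  obtain F' where F': "F' \<subseteq> F" "countable F'" "\<Union>F' = \<Union>F"
    using Lindelof[of F] by (auto simp: F_def)
  have "\<Union>F' \<in> null_sets \<nu>"
    using F' assms by (intro null_sets_UN'[of F' id, simplified]) (auto simp: F_def null_sets_def)
  moreover have "x \<in> measure_support \<nu>" if "x \<notin> \<Union>F'" for x
    using that unfolding F' measure_support_def F_def by (auto simp: zero_less_iff_neq_zero)
  ultimately show ?thesis using AE_not_in[of "\<Union>F'" \<nu>] by auto
qed

lemma norm_tensor: "norm (tensor x y) = norm x * norm y"
proof -
  have "(norm (tensor x y))\<^sup>2 = (\<Sum>p\<in>UNIV. (x $ fst p)\<^sup>2 * (y $ snd p)\<^sup>2)"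
    by (simp add: norm_vec_def L2_set_def sum_nonneg tensor_def power_mult_distrib)
  also have "\<dots> = (\<Sum>k\<in>UNIV. \<Sum>l\<in>UNIV. (x $ k)\<^sup>2 * (y $ l)\<^sup>2)"
    by (simp add: sum.cartesian_product split_beta')
  also have "\<dots> = (norm x * norm y)\<^sup>2"
    by (simp add: sum_product[symmetric] norm_vec_def L2_set_def sum_nonneg power_mult_distrib)
  finally show ?thesis by simp
qed

lemma tensor_inner: "tensor x y \<bullet> v = (\<Sum>p\<in>UNIV. x $ fst p * y $ snd p * v $ p)"
  by (simp add: inner_vec_def tensor_def)

text \<open>Taylor's formula with Lagrange remainder; the intermediate exponential is at most exp
  (ln \<kappa>) = \<kappa>.\<close>

lemma exp_le_quadratic:
  fixes y \<kappa> :: real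
  assumes "\<kappa> > 1" "\<bar>y\<bar> \<le> ln \<kappa>"
  shows "exp y \<le> 1 + y + \<kappa> / 2 * y\<^sup>2"
proof -
  obtain t where t: "\<bar>t\<bar> \<le> \<bar>y\<bar>" "exp y = (\<Sum>m<2. y ^ m / fact m) + exp t / fact 2 * y ^ 2"
    using Maclaurin_exp_le[of y 2] by blast
  have "exp t \<le> exp (ln \<kappa>)" using t(1) assms(2) by (subst exp_le_cancel_iff) linarith
  then have "exp t / 2 * y\<^sup>2 \<le> \<kappa> / 2 * y\<^sup>2" using assms(1) by (intro mult_right_mono) auto
  then show ?thesis using t(2) by (simp add: numeral_2_eq_2)
qed

lemma fact_double: "(fact (2 * k) :: real) = 2 ^ k * fact k * (\<Prod>i=1..k. real (2 * i - 1))"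
proof (induction k)
  case (Suc k)
  have "(fact (2 * Suc k) :: real) = (2 * real k + 2) * (2 * real k + 1) * fact (2 * k)"
    by (simp add: algebra_simps)
  then show ?case using Suc by (simp add: algebra_simps)
qed simp

lemma exp_sums: "(\<lambda>k. x ^ k / fact k) sums exp (x::real)"
  using exp_converges[of x] by (simp add: field_simps)

lemma cosh_sums: "(\<lambda>k. (y::real) ^ (2 * k) / fact (2 * k)) sums cosh y"
proof -
  have "(\<lambda>k. (\<lambda>n. if even n then y ^ n /\<^sub>R fact n else 0) (2 * k)) sums cosh y"
    using cosh_converges[of y]
    by (subst sums_mono_reindex) (auto simp: strict_mono_def elim!: evenE)
  then show ?thesis by (simp add: field_simps)
qed

text \<open>Symmetry replaces the exponential by \<open>cosh\<close>, whose series involves even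
  moments alone. The double factorial in the moment bound cancels against (2k)! and leaves the
  Taylor coefficients of exp (t^2 / 2). Working with nonnegative series allows termwise
  integration.\<close>

lemma nn_integral_exp_le_moment_subgaussian:
  assumes "prob_space M" and "moment_subgaussian M 1 X"
  shows "(\<integral>\<^sup>+w. ennreal (exp (t * X w)) \<partial>M) \<le> ennreal (exp (t\<^sup>2 / 2))"
proof -
  have [measurable]: "X \<in> borel_measurable M" and sym: "distr M borel X = distr M borel (\<lambda>w. - X w)"
    using assms by (auto simp: moment_subgaussian_def symmetric_rv_def)
  let ?I = "\<integral>\<^sup>+w. ennreal (exp (t * X w)) \<partial>M"
  have "?I = (\<integral>\<^sup>+x. ennreal (exp (t * x)) \<partial>distr M borel X)"
    by (subst nn_integral_distr) auto
  also have "\<dots> = (\<integral>\<^sup>+w. ennreal (exp (- (t * X w))) \<partial>M)"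
    unfolding sym by (subst nn_integral_distr) auto
  finally have "?I + ?I = (\<integral>\<^sup>+w. ennreal (exp (t * X w)) + ennreal (exp (- (t * X w))) \<partial>M)"
    by (subst nn_integral_add) auto
  also have "\<dots> = (\<integral>\<^sup>+w. 2 * ennreal (cosh (t * X w)) \<partial>M)"
    by (intro nn_integral_cong) (simp add: cosh_def ennreal_plus[symmetric] ennreal_mult''[symmetric] del: ennreal_plus flip: ennreal_numeral)
  also have "\<dots> = 2 * (\<integral>\<^sup>+w. ennreal (cosh (t * X w)) \<partial>M)"
    by (rule nn_integral_cmult) (simp add: cosh_def)
  also have "(\<integral>\<^sup>+w. ennreal (cosh (t * X w)) \<partial>M) = (\<integral>\<^sup>+w. suminf (\<lambda>k. ennreal ((t * X w) ^ (2 * k) / fact (2 * k))) \<partial>M)"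
    by (intro nn_integral_cong suminf_ennreal_eq[symmetric] cosh_sums) (simp add: zero_le_even_power)
  also have "\<dots> = suminf (\<lambda>k. \<integral>\<^sup>+w. ennreal ((t * X w) ^ (2 * k) / fact (2 * k)) \<partial>M)"
    by (rule nn_integral_suminf) simp
  also have "\<dots> \<le> suminf (\<lambda>k. ennreal ((t\<^sup>2 / 2) ^ k / fact k))"
  proof (rule suminf_le)
    fix k
    show "(\<integral>\<^sup>+w. ennreal ((t * X w) ^ (2 * k) / fact (2 * k)) \<partial>M) \<le> ennreal ((t\<^sup>2 / 2) ^ k / fact k)"
    proof (cases "k = 0")
      case True
      then show ?thesis using prob_space.emeasure_space_1[OF assms(1)] by simp
    next
      case False
      then have m: "integrable M (\<lambda>w. X w ^ (2 * k))" "(\<integral>w. X w ^ (2 * k) \<partial>M) \<le> (\<Prod>i=1..k. real (2 * i - 1))"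
        using assms by (auto simp: moment_subgaussian_def)
      have eq: "(t * X w) ^ (2 * k) / fact (2 * k) = t ^ (2 * k) / fact (2 * k) * X w ^ (2 * k)" for w
        by (simp add: power_mult_distrib)
      have "(\<integral>\<^sup>+w. ennreal ((t * X w) ^ (2 * k) / fact (2 * k)) \<partial>M) = ennreal (\<integral>w. t ^ (2 * k) / fact (2 * k) * X w ^ (2 * k) \<partial>M)"
        unfolding eq using m(1) by (intro nn_integral_eq_integral) (auto simp: zero_le_even_power)
      also have "(\<integral>w. t ^ (2 * k) / fact (2 * k) * X w ^ (2 * k) \<partial>M) = t ^ (2 * k) / fact (2 * k) * (\<integral>w. X w ^ (2 * k) \<partial>M)"
        by simp
      also have "\<dots> \<le> t ^ (2 * k) / fact (2 * k) * (\<Prod>i=1..k. real (2 * i - 1))"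
        using m(2) by (intro mult_left_mono) (auto simp: zero_le_even_power)
      also have "\<dots> = (t\<^sup>2 / 2) ^ k / fact k"
      proof -
        have "(\<Prod>i=1..k. real (2 * i - 1)) > 0" by (intro prod_pos) auto
        then show ?thesis unfolding fact_double by (simp add: power_mult power_divide)
      qed
      finally show ?thesis by (simp add: ennreal_leI)
    qed
  qed auto
  also have "\<dots> = ennreal (exp (t\<^sup>2 / 2))"
    by (intro suminf_ennreal_eq exp_sums) simp
  finally have "?I + ?I \<le> 2 * ennreal (exp (t\<^sup>2 / 2))" by (simp add: mult_left_mono)
  then have "2 * ?I \<le> 2 * ennreal (exp (t\<^sup>2 / 2))" by (simp only: mult_2)
  then show ?thesis by (simp add: ennreal_mult_le_mult_iff)
qed

section \<open>Bounded centred rows with covariance at most the identity\<close>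

locale row_law = prob_space \<nu> for \<nu> :: "(real ^ 'k) measure" +
  fixes R :: real
  assumes sets_\<nu> [measurable_cong]: "sets \<nu> = sets borel"
    and bdd: "AE x in \<nu>. norm x \<le> R"
    and mean: "(\<integral>x. x \<partial>\<nu>) = 0"
    and cov: "spectral_norm (cov_matrix \<nu>) \<le> 1"
begin

definition mgf :: "real ^ ('k \<times> 'k) \<Rightarrow> ennreal" where
  "mgf v = (\<integral>\<^sup>+x. \<integral>\<^sup>+x'. ennreal (exp (tensor x x' \<bullet> v)) \<partial>\<nu> \<partial>\<nu>)"

lemma measurable_nth_\<nu> [measurable]: "(\<lambda>x. x $ k) \<in> borel_measurable \<nu>"
  by measurable

lemma integrable_\<nu>: "integrable \<nu> (\<lambda>x. x)"
  using bdd by (intro integrable_const_bound[of _ R]) auto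

lemma integral_inner_\<nu>: "(\<integral>x. x \<bullet> w \<partial>\<nu>) = 0"
  using integral_inner_left[of w \<nu> "\<lambda>x. x"] integrable_\<nu> mean by simp

lemma integrable_inner_\<nu>: "integrable \<nu> (\<lambda>x. x \<bullet> w)"
  using integrable_\<nu> by simp

lemma integrable_nth_mult_\<nu>: "integrable \<nu> (\<lambda>x. x $ a * x $ b)"
proof (rule integrable_const_bound)
  show "AE x in \<nu>. norm (x $ a * x $ b) \<le> R * R"
    using bdd
  proof eventually_elim
    fix x :: "real ^ 'k" assume "norm x \<le> R"
    then have "\<bar>x $ a\<bar> \<le> R" "\<bar>x $ b\<bar> \<le> R" using component_le_norm_cart order_trans by blast+
    then show "norm (x $ a * x $ b) \<le> R * R" by (auto simp: abs_mult intro!: mult_mono)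
  qed
qed simp

lemma inner_square_eq: "(x \<bullet> w)\<^sup>2 = (\<Sum>a\<in>UNIV. \<Sum>b\<in>UNIV. (w $ a * w $ b) * (x $ a * x $ b))"
  for x w :: "real ^ 'k"
  by (simp add: inner_vec_def power2_eq_square sum_product mult_ac)

lemma integrable_inner_square_\<nu>: "integrable \<nu> (\<lambda>x. (x \<bullet> w)\<^sup>2)"
  unfolding inner_square_eq
  by (intro Bochner_Integration.integrable_sum integrable_mult_right integrable_nth_mult_\<nu>)

text \<open>Since the mean vanishes, the second-moment form is the covariance form, which the
  spectral norm bounds.\<close>

lemma integral_inner_square_le: "(\<integral>x. (x \<bullet> w)\<^sup>2 \<partial>\<nu>) \<le> (norm w)\<^sup>2"
proof -
  have m: "(\<integral>x. x $ a \<partial>\<nu>) = 0" for a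
    using integral_inner_\<nu>[of "axis a 1"] by (simp add: inner_axis)
  have "(\<integral>x. (x \<bullet> w)\<^sup>2 \<partial>\<nu>) = (\<Sum>a\<in>UNIV. \<Sum>b\<in>UNIV. (w $ a * w $ b) * (\<integral>x. x $ a * x $ b \<partial>\<nu>))"
    unfolding inner_square_eq using integrable_nth_mult_\<nu> by (simp add: Bochner_Integration.integral_sum)
  also have "\<dots> = w \<bullet> (cov_matrix \<nu> *v w)"
    by (simp add: inner_vec_def matrix_vector_mult_def cov_matrix_def m sum_distrib_left mult_ac)
  also have "\<dots> \<le> norm w * norm (cov_matrix \<nu> *v w)" by (rule norm_cauchy_schwarz)
  also have "norm (cov_matrix \<nu> *v w) \<le> spectral_norm (cov_matrix \<nu>) * norm w"
    unfolding spectral_norm_def by (rule onorm) (rule matrix_vector_mul_bounded_linear)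
  also have "\<dots> \<le> 1 * norm w" using cov by (intro mult_right_mono) auto
  finally show ?thesis by (simp add: power2_eq_square mult_left_mono)
qed

text \<open>The bound on the support keeps the exponent within ln \<kappa>; averaging the quadratic
  majorant kills its linear term.\<close>

lemma nn_integral_exp_inner_le:
  fixes w :: "real ^ 'k"
  assumes "\<kappa> > 1" "R * norm w \<le> ln \<kappa>"
  shows "(\<integral>\<^sup>+x. ennreal (exp (x \<bullet> w)) \<partial>\<nu>) \<le> ennreal (1 + \<kappa> / 2 * (norm w)\<^sup>2)"
proof -
  define g where "g x = 1 + x \<bullet> w + \<kappa> / 2 * (x \<bullet> w)\<^sup>2" for x :: "real ^ 'k"
  have le: "AE x in \<nu>. exp (x \<bullet> w) \<le> g x"
    using bdd
  proof eventually_elim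
    fix x :: "real ^ 'k" assume "norm x \<le> R"
    then have "norm x * norm w \<le> R * norm w" by (intro mult_right_mono) auto
    then have "\<bar>x \<bullet> w\<bar> \<le> ln \<kappa>" using Cauchy_Schwarz_ineq2[of x w] assms(2) by linarith
    then show "exp (x \<bullet> w) \<le> g x" unfolding g_def by (rule exp_le_quadratic[OF assms(1)])
  qed
  have i: "integrable \<nu> g" unfolding g_def
    by (intro Bochner_Integration.integrable_add integrable_mult_right integrable_inner_square_\<nu> integrable_inner_\<nu>) auto
  have "(\<integral>\<^sup>+x. ennreal (exp (x \<bullet> w)) \<partial>\<nu>) \<le> (\<integral>\<^sup>+x. ennreal (g x) \<partial>\<nu>)"
    using le by (intro nn_integral_mono_AE) (auto intro: ennreal_leI elim!: eventually_mono)
  also have "\<dots> = ennreal (\<integral>x. g x \<partial>\<nu>)"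
    using i le by (intro nn_integral_eq_integral) (auto elim!: eventually_mono intro: order_trans[OF less_imp_le[OF exp_gt_zero]])
  also have "(\<integral>x. g x \<partial>\<nu>) = 1 + \<kappa> / 2 * (\<integral>x. (x \<bullet> w)\<^sup>2 \<partial>\<nu>)"
    unfolding g_def using integrable_inner_square_\<nu> integrable_inner_\<nu>
    by (simp add: integral_inner_\<nu> prob_space)
  also have "\<dots> \<le> 1 + \<kappa> / 2 * (norm w)\<^sup>2"
    using integral_inner_square_le assms(1) by simp
  finally show ?thesis by (simp add: ennreal_leI)
qed

text \<open>Read \<open>v\<close> as a matrix. With \<open>x\<close> fixed, the exponent is linear
  in \<open>x'\<close> with direction \<open>w x\<close>, so the one-row bound applies; the
  remaining average of the squared norm of \<open>w x\<close> is bounded column by column. The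
  factor \<kappa> is lost only in the inner average.\<close>

lemma mgf_le_local:
  assumes "\<kappa> > 1"
  obtains \<eta> where "\<eta> > 0" "\<And>v :: real ^ ('k \<times> 'k). norm v \<le> \<eta> \<Longrightarrow> mgf v \<le> ennreal (exp (\<kappa> / 2 * (norm v)\<^sup>2))"
proof
  \<comment> \<open>Chosen so that R |w x| \<le> R^2 |v| \<le> ln \<kappa>; the \<open>+ 1\<close>
    avoids division by zero when \<open>R = 0\<close>.\<close>
  let ?\<eta> = "ln \<kappa> / (R\<^sup>2 + 1)"
  have R1: "R\<^sup>2 + 1 > 0" by (simp add: add_nonneg_pos)
  show "?\<eta> > 0" using assms R1 by simp
  fix v :: "real ^ ('k \<times> 'k)" assume v: "norm v \<le> ?\<eta>"
  define w where "w x = (\<chi> l. \<Sum>k\<in>UNIV. x $ k * v $ (k, l))" for x :: "real ^ 'k"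
  define u where "u l = (\<chi> k. v $ (k, l))" for l
  have tw: "tensor x x' \<bullet> v = x' \<bullet> w x" for x x'
  proof -
    have "tensor x x' \<bullet> v = (\<Sum>k\<in>UNIV. \<Sum>l\<in>UNIV. x $ k * x' $ l * v $ (k, l))"
      unfolding tensor_inner by (simp add: sum.cartesian_product split_beta')
    also have "\<dots> = (\<Sum>l\<in>UNIV. \<Sum>k\<in>UNIV. x $ k * x' $ l * v $ (k, l))" by (rule sum.swap)
    finally show ?thesis by (simp add: inner_vec_def w_def sum_distrib_left mult_ac)
  qed
  have w2: "(norm (w x))\<^sup>2 = (\<Sum>l\<in>UNIV. (x \<bullet> u l)\<^sup>2)" for x
    by (simp add: norm_vec_def L2_set_def sum_nonneg w_def u_def inner_vec_def)
  have u2: "(\<Sum>l\<in>UNIV. (norm (u l))\<^sup>2) = (norm v)\<^sup>2"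
  proof -
    have "(\<Sum>l\<in>UNIV. (norm (u l))\<^sup>2) = (\<Sum>l\<in>UNIV. \<Sum>k\<in>UNIV. (v $ (k, l))\<^sup>2)"
      by (simp add: norm_vec_def L2_set_def sum_nonneg u_def)
    also have "\<dots> = (\<Sum>k\<in>UNIV. \<Sum>l\<in>UNIV. (v $ (k, l))\<^sup>2)" by (rule sum.swap)
    also have "\<dots> = (norm v)\<^sup>2"
      by (simp add: norm_vec_def L2_set_def sum_nonneg sum.cartesian_product split_beta')
    finally show ?thesis .
  qed
  have wle: "norm (w x) \<le> norm x * norm v" for x
  proof (rule power2_le_imp_le)
    have "(x \<bullet> u l)\<^sup>2 \<le> (norm x)\<^sup>2 * (norm (u l))\<^sup>2" for l
      using Cauchy_Schwarz_ineq[of x "u l"] by (simp add: dot_square_norm)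
    then have "(norm (w x))\<^sup>2 \<le> (\<Sum>l\<in>UNIV. (norm x)\<^sup>2 * (norm (u l))\<^sup>2)"
      unfolding w2 by (rule sum_mono)
    then show "(norm (w x))\<^sup>2 \<le> (norm x * norm v)\<^sup>2"
      by (simp add: sum_distrib_left[symmetric] u2 power_mult_distrib)
  qed simp
  have i: "integrable \<nu> (\<lambda>x. (norm (w x))\<^sup>2)" unfolding w2
    by (intro Bochner_Integration.integrable_sum integrable_inner_square_\<nu>)
  have "mgf v \<le> (\<integral>\<^sup>+x. ennreal (1 + \<kappa> / 2 * (norm (w x))\<^sup>2) \<partial>\<nu>)"
    unfolding mgf_def tw
  proof (rule nn_integral_mono_AE, use bdd in eventually_elim)
    fix x :: "real ^ 'k" assume x: "norm x \<le> R"
    have R0: "R \<ge> 0" using x norm_ge_zero order_trans by blast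
    have "R * norm (w x) \<le> R * (R * norm v)"
      using wle[of x] mult_right_mono[OF x norm_ge_zero[of v]] R0 by (intro mult_left_mono) auto
    also have "\<dots> \<le> (R\<^sup>2 + 1) * norm v" by (simp add: power2_eq_square algebra_simps)
    also have "\<dots> \<le> ln \<kappa>" using v R1 by (simp add: field_simps)
    finally show "(\<integral>\<^sup>+x'. ennreal (exp (x' \<bullet> w x)) \<partial>\<nu>) \<le> ennreal (1 + \<kappa> / 2 * (norm (w x))\<^sup>2)"
      by (rule nn_integral_exp_inner_le[OF assms])
  qed
  also have "\<dots> = ennreal (\<integral>x. 1 + \<kappa> / 2 * (norm (w x))\<^sup>2 \<partial>\<nu>)"
    using i assms by (intro nn_integral_eq_integral Bochner_Integration.integrable_add integrable_mult_right) (auto intro: add_nonneg_nonneg)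
  also have "(\<integral>x. 1 + \<kappa> / 2 * (norm (w x))\<^sup>2 \<partial>\<nu>) = 1 + \<kappa> / 2 * (\<Sum>l\<in>UNIV. \<integral>x. (x \<bullet> u l)\<^sup>2 \<partial>\<nu>)"
    using i integrable_inner_square_\<nu> by (simp add: w2 prob_space Bochner_Integration.integral_sum)
  also have "\<dots> \<le> 1 + \<kappa> / 2 * (norm v)\<^sup>2"
    unfolding u2[symmetric] using assms integral_inner_square_le by (simp add: sum_mono)
  also have "\<dots> \<le> exp (\<kappa> / 2 * (norm v)\<^sup>2)" by (rule exp_ge_add_one_self)
  finally show "mgf v \<le> ennreal (exp (\<kappa> / 2 * (norm v)\<^sup>2))" by (simp add: ennreal_leI)
qed

text \<open>Subgaussianity is stated for unit directions, so \<open>v\<close> is split into its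
  direction and its norm, the latter becoming the argument of the scalar bound.\<close>

lemma mgf_le_global:
  assumes sg: "moment_subgaussian_vec (\<nu> \<Otimes>\<^sub>M \<nu>) 1 (\<lambda>(x, x'). tensor x x')"
  shows "mgf v \<le> ennreal (exp ((norm v)\<^sup>2 / 2))"
proof (cases "v = 0")
  case True
  then show ?thesis by (simp add: mgf_def emeasure_space_1)
next
  case False
  define X where "X = (\<lambda>p. (case p of (x, x') \<Rightarrow> tensor x x') \<bullet> (v /\<^sub>R norm v))"
  have X: "moment_subgaussian (\<nu> \<Otimes>\<^sub>M \<nu>) 1 X"
    using sg False unfolding moment_subgaussian_vec_def X_def by (simp del: inner_scaleR_right)
  then have [measurable]: "X \<in> borel_measurable (\<nu> \<Otimes>\<^sub>M \<nu>)"
    by (simp add: moment_subgaussian_def symmetric_rv_def)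
  have "mgf v = (\<integral>\<^sup>+x. \<integral>\<^sup>+x'. ennreal (exp (norm v * X (x, x'))) \<partial>\<nu> \<partial>\<nu>)"
    unfolding mgf_def X_def using False by (simp add: mult.assoc[symmetric])
  also have "\<dots> = (\<integral>\<^sup>+p. ennreal (exp (norm v * X p)) \<partial>(\<nu> \<Otimes>\<^sub>M \<nu>))"
    by (rule nn_integral_fst) measurable
  also have "\<dots> \<le> ennreal (exp ((norm v)\<^sup>2 / 2))"
    by (rule nn_integral_exp_le_moment_subgaussian[OF prob_space_pair X]) (rule prob_space_axioms)+
  finally show ?thesis .
qed

end

section \<open>Moments of the overlap\<close>

lemma tensor_inner_tensor: "tensor x y \<bullet> tensor x' y' = (x \<bullet> x') * (y \<bullet> y')"
proof -
  have "tensor x y \<bullet> tensor x' y' = (\<Sum>k\<in>UNIV. \<Sum>l\<in>UNIV. (x $ k * x' $ k) * (y $ l * y' $ l))"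
    unfolding tensor_inner by (simp add: tensor_def sum.cartesian_product split_beta' mult_ac)
  then show ?thesis by (simp add: inner_vec_def sum_product)
qed

definition upper_pairs :: "nat \<Rightarrow> (nat \<times> nat) set" where
  "upper_pairs N = {(i, j). 1 \<le> i \<and> i \<le> j \<and> j \<le> N}"

lemma finite_upper_pairs [simp, intro]: "finite (upper_pairs N)"
  by (rule finite_subset[of _ "{1..N} \<times> {1..N}"]) (auto simp: upper_pairs_def)

text \<open>The full square counts off-diagonal pairs twice and the diagonal once. This is the
  origin of the factor 1/2 in front of \<open>c\<close> in the bound on the overlap.\<close>

lemma sum_upper_pairs:
  fixes g :: "nat \<Rightarrow> nat \<Rightarrow> real"
  assumes sym: "\<And>i j. g i j = g j i"
  shows "(\<Sum>(i, j)\<in>upper_pairs N. g i j) = ((\<Sum>i\<in>{1..N}. \<Sum>j\<in>{1..N}. g i j) + (\<Sum>i\<in>{1..N}. g i i)) / 2"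
proof -
  define L where "L = {(i, j). 1 \<le> i \<and> i < j \<and> j \<le> N}"
  define G where "G = {(i, j). 1 \<le> j \<and> j < i \<and> i \<le> N}"
  define E where "E = (\<lambda>i. (i, i)) ` {1..N}"
  have fin: "finite L" "finite G" "finite E"
    by (rule finite_subset[of _ "{1..N} \<times> {1..N}"], auto simp: L_def G_def E_def)+
  have E: "(\<Sum>(i, j)\<in>E. g i j) = (\<Sum>i\<in>{1..N}. g i i)"
    unfolding E_def by (subst sum.reindex) (auto simp: inj_on_def)
  have LG: "(\<Sum>(i, j)\<in>G. g i j) = (\<Sum>(i, j)\<in>L. g i j)"
    by (rule sum.reindex_bij_witness[of _ "\<lambda>(i, j). (j, i)" "\<lambda>(i, j). (j, i)"]) (auto simp: L_def G_def sym)
  have "upper_pairs N = L \<union> E" by (auto simp: upper_pairs_def L_def E_def)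
  then have U: "(\<Sum>(i, j)\<in>upper_pairs N. g i j) = (\<Sum>(i, j)\<in>L. g i j) + (\<Sum>(i, j)\<in>E. g i j)"
    using fin by (simp add: sum.union_disjoint L_def E_def disjoint_iff image_iff)
  have "{1..N} \<times> {1..N} = (L \<union> E) \<union> G" by (auto simp: L_def E_def G_def)
  moreover have "(\<Sum>(i, j)\<in>(L \<union> E) \<union> G. g i j) = (\<Sum>(i, j)\<in>L. g i j) + (\<Sum>(i, j)\<in>E. g i j) + (\<Sum>(i, j)\<in>G. g i j)"
    using fin by (subst sum.union_disjoint, simp, simp, force simp: L_def E_def G_def,
      subst sum.union_disjoint) (auto simp: L_def E_def)
  ultimately have "(\<Sum>i\<in>{1..N}. \<Sum>j\<in>{1..N}. g i j) = (\<Sum>(i, j)\<in>L. g i j) + (\<Sum>(i, j)\<in>E. g i j) + (\<Sum>(i, j)\<in>G. g i j)"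
    by (simp add: sum.cartesian_product)
  then show ?thesis using U E LG by simp
qed

text \<open>Normalised by the limiting size \<open>\<rho> $ a * real N\<close> of the block, so that
  the block weights are exactly those of the threshold; the deviation of the true size is absorbed
  later.\<close>

definition block_mean :: "real ^ 'n \<Rightarrow> (nat \<Rightarrow> 'n) \<Rightarrow> nat \<Rightarrow> (nat \<Rightarrow> 'b::real_inner) \<Rightarrow> 'n \<Rightarrow> 'b" where
  "block_mean \<rho> q N u a = (\<Sum>i\<in>{i\<in>{1..N}. q i = a}. u i) /\<^sub>R sqrt (\<rho> $ a * real N)"

text \<open>Only the norms of the block sums enter, so the scalar quadratic form bound suffices
  for vector-valued \<open>u\<close>.\<close>

lemma block_quadratic_form_le:
  fixes \<Phi> :: "real ^ 'n ^ 'n" and \<rho> :: "real ^ 'n" and u :: "nat \<Rightarrow> 'b::real_inner"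
  assumes N: "N \<ge> 1" and \<rho>: "\<And>a. \<rho> $ a > 0"
    and \<Phi>: "\<And>a b. 0 \<le> \<Phi> $ a $ b" "\<And>a b. \<Phi> $ a $ b = \<Phi> $ b $ a" "\<And>a. \<Phi> $ a $ a \<le> F"
    and quad: "\<And>x :: 'n \<Rightarrow> real. \<beta>\<^sup>2 * (\<Sum>a\<in>UNIV. \<Sum>b\<in>UNIV. \<Phi> $ a $ b * (sqrt (\<rho> $ a) * x a) * (sqrt (\<rho> $ b) * x b))
       \<le> c * (\<Sum>a\<in>UNIV. (x a)\<^sup>2)"
    and u: "\<And>i. i \<in> {1..N} \<Longrightarrow> norm (u i) \<le> U" and U: "0 \<le> U"
  shows "\<bar>\<Sum>(i, j)\<in>upper_pairs N. \<beta>\<^sup>2 / real N * \<Phi> $ q i $ q j * (u i \<bullet> u j)\<bar>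
    \<le> \<beta>\<^sup>2 / 2 * F * U\<^sup>2 + c / 2 * (\<Sum>a\<in>UNIV. (norm (block_mean \<rho> q N u a))\<^sup>2)"
proof -
  define S where "S a = (\<Sum>i\<in>{i\<in>{1..N}. q i = a}. u i)" for a
  define x where "x a = norm (block_mean \<rho> q N u a)" for a
  have nS: "norm (S a) = sqrt (real N) * (sqrt (\<rho> $ a) * x a)" for a
  proof -
    define s where "s = sqrt (\<rho> $ a * real N)"
    have s: "s > 0" using \<rho>[of a] N by (simp add: s_def)
    have "x a = norm (S a) / s"
      using s unfolding x_def block_mean_def S_def[symmetric] s_def[symmetric] by (simp add: divide_inverse_commute)
    then have "norm (S a) = s * x a" using s by simp
    then show ?thesis by (simp add: s_def real_sqrt_mult mult_ac)
  qed
  have full: "(\<Sum>i\<in>{1..N}. \<Sum>j\<in>{1..N}. \<Phi> $ q i $ q j * (u i \<bullet> u j)) = (\<Sum>a\<in>UNIV. \<Sum>b\<in>UNIV. \<Phi> $ a $ b * (S a \<bullet> S b))"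
  proof -
    have "(\<Sum>i\<in>{1..N}. \<Sum>j\<in>{1..N}. \<Phi> $ q i $ q j * (u i \<bullet> u j)) =
      (\<Sum>i\<in>{1..N}. \<Sum>b\<in>UNIV. \<Sum>j\<in>{j\<in>{1..N}. q j = b}. \<Phi> $ q i $ q j * (u i \<bullet> u j))"
      by (intro sum.cong refl sum.group[symmetric]) auto
    also have "\<dots> = (\<Sum>i\<in>{1..N}. \<Sum>b\<in>UNIV. \<Phi> $ q i $ b * (u i \<bullet> S b))"
      by (intro sum.cong refl) (simp add: S_def inner_sum_right sum_distrib_left)
    also have "\<dots> = (\<Sum>b\<in>UNIV. \<Sum>i\<in>{1..N}. \<Phi> $ q i $ b * (u i \<bullet> S b))" by (rule sum.swap)
    also have "\<dots> = (\<Sum>b\<in>UNIV. \<Sum>a\<in>UNIV. \<Sum>i\<in>{i\<in>{1..N}. q i = a}. \<Phi> $ q i $ b * (u i \<bullet> S b))"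
      by (intro sum.cong refl sum.group[symmetric]) auto
    also have "\<dots> = (\<Sum>b\<in>UNIV. \<Sum>a\<in>UNIV. \<Phi> $ a $ b * (S a \<bullet> S b))"
      by (intro sum.cong refl) (simp add: S_def[of a for a] inner_sum_left sum_distrib_left)
    also have "\<dots> = (\<Sum>a\<in>UNIV. \<Sum>b\<in>UNIV. \<Phi> $ a $ b * (S a \<bullet> S b))" by (rule sum.swap)
    finally show ?thesis .
  qed
  \<comment> \<open>Nonnegative entries of \<open>\<Phi>\<close> permit replacing each inner product
    of block sums by the product of norms.\<close>
  have "\<bar>\<Sum>i\<in>{1..N}. \<Sum>j\<in>{1..N}. \<Phi> $ q i $ q j * (u i \<bullet> u j)\<bar> \<le> (\<Sum>a\<in>UNIV. \<Sum>b\<in>UNIV. \<Phi> $ a $ b * (norm (S a) * norm (S b)))"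
    unfolding full using \<Phi>(1)
    by (intro order_trans[OF sum_abs] sum_mono) (auto simp: abs_mult intro!: mult_left_mono Cauchy_Schwarz_ineq2)
  also have "\<dots> = real N * (\<Sum>a\<in>UNIV. \<Sum>b\<in>UNIV. \<Phi> $ a $ b * (sqrt (\<rho> $ a) * x a) * (sqrt (\<rho> $ b) * x b))"
    unfolding nS sum_distrib_left
  proof (intro sum.cong refl)
    fix a b
    have ac: "F * (r * A * (r * B)) = (r * r) * (F * A * B)" for F r A B :: real by simp
    have "sqrt (real N) * sqrt (real N) = real N" by simp
    then show "\<Phi> $ a $ b * (sqrt (real N) * (sqrt (\<rho> $ a) * x a) * (sqrt (real N) * (sqrt (\<rho> $ b) * x b))) =
      real N * (\<Phi> $ a $ b * (sqrt (\<rho> $ a) * x a) * (sqrt (\<rho> $ b) * x b))" unfolding ac by simp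
  qed
  finally have "\<beta>\<^sup>2 / real N * \<bar>\<Sum>i\<in>{1..N}. \<Sum>j\<in>{1..N}. \<Phi> $ q i $ q j * (u i \<bullet> u j)\<bar> \<le>
    \<beta>\<^sup>2 / real N * (real N * (\<Sum>a\<in>UNIV. \<Sum>b\<in>UNIV. \<Phi> $ a $ b * (sqrt (\<rho> $ a) * x a) * (sqrt (\<rho> $ b) * x b)))"
    by (rule mult_left_mono) simp
  also have "\<dots> \<le> c * (\<Sum>a\<in>UNIV. (x a)\<^sup>2)" using quad[of x] N by simp
  finally have off: "\<beta>\<^sup>2 / real N * \<bar>\<Sum>i\<in>{1..N}. \<Sum>j\<in>{1..N}. \<Phi> $ q i $ q j * (u i \<bullet> u j)\<bar> \<le> c * (\<Sum>a\<in>UNIV. (x a)\<^sup>2)" .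
  \<comment> \<open>The diagonal has only \<open>N\<close> bounded terms, so after division by
    \<open>real N\<close> it contributes a constant.\<close>
  have "\<bar>\<Sum>i\<in>{1..N}. \<Phi> $ q i $ q i * (u i \<bullet> u i)\<bar> \<le> (\<Sum>i\<in>{1..N}. F * U\<^sup>2)"
  proof (intro order_trans[OF sum_abs] sum_mono)
    fix i assume i: "i \<in> {1..N}"
    have "(norm (u i))\<^sup>2 \<le> U\<^sup>2" using u[OF i] by (intro power_mono) auto
    then show "\<bar>\<Phi> $ q i $ q i * (u i \<bullet> u i)\<bar> \<le> F * U\<^sup>2"
      using \<Phi>(3)[of "q i"] \<Phi>(1)[of "q i" "q i"] by (simp add: abs_mult dot_square_norm mult_mono)
  qed
  then have diag: "\<beta>\<^sup>2 / real N * \<bar>\<Sum>i\<in>{1..N}. \<Phi> $ q i $ q i * (u i \<bullet> u i)\<bar> \<le> \<beta>\<^sup>2 / real N * (real N * (F * U\<^sup>2))"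
    by (intro mult_left_mono) auto
  define A where "A = (\<Sum>i\<in>{1..N}. \<Sum>j\<in>{1..N}. \<Phi> $ q i $ q j * (u i \<bullet> u j))"
  define B where "B = (\<Sum>i\<in>{1..N}. \<Phi> $ q i $ q i * (u i \<bullet> u i))"
  have "(\<Sum>(i, j)\<in>upper_pairs N. \<beta>\<^sup>2 / real N * \<Phi> $ q i $ q j * (u i \<bullet> u j)) =
    \<beta>\<^sup>2 / real N * (\<Sum>(i, j)\<in>upper_pairs N. \<Phi> $ q i $ q j * (u i \<bullet> u j))"
    unfolding sum_distrib_left by (intro sum.cong) auto
  also have "\<dots> = \<beta>\<^sup>2 / real N * ((A + B) / 2)"
    unfolding A_def B_def by (subst sum_upper_pairs) (auto simp: \<Phi>(2) inner_commute)
  finally have "\<bar>\<Sum>(i, j)\<in>upper_pairs N. \<beta>\<^sup>2 / real N * \<Phi> $ q i $ q j * (u i \<bullet> u j)\<bar> = (\<beta>\<^sup>2 / real N) * (\<bar>A + B\<bar> / 2)"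
    by (simp add: abs_mult)
  also have "\<dots> \<le> (\<beta>\<^sup>2 / real N) * ((\<bar>A\<bar> + \<bar>B\<bar>) / 2)"
    by (intro mult_left_mono divide_right_mono abs_triangle_ineq) auto
  also have "\<dots> = ((\<beta>\<^sup>2 / real N) * \<bar>A\<bar> + (\<beta>\<^sup>2 / real N) * \<bar>B\<bar>) / 2" by (simp add: distrib_left add_divide_distrib)
  also have "\<dots> \<le> (c * (\<Sum>a\<in>UNIV. (x a)\<^sup>2) + \<beta>\<^sup>2 / real N * (real N * (F * U\<^sup>2))) / 2"
    using off diag unfolding A_def[symmetric] B_def[symmetric] by (intro divide_right_mono add_mono) simp_all
  also have "\<dots> = \<beta>\<^sup>2 / 2 * F * U\<^sup>2 + c / 2 * (\<Sum>a\<in>UNIV. (x a)\<^sup>2)" using N by (simp add: field_simps)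
  finally show ?thesis unfolding x_def .
qed

section \<open>Averaging the mixture over independent rows\<close>

context row_law
begin

lemma prob_iid: "prob_space (iid_rows \<nu> N)"
  unfolding iid_rows_def by (rule prob_space_PiM) (rule prob_space_axioms)

lemma measurable_row [measurable]: "i \<in> {1..N} \<Longrightarrow> (\<lambda>V. V i $ k) \<in> borel_measurable (iid_rows \<nu> N)"
  unfolding iid_rows_def by measurable

lemma AE_iid_norm_le: "AE V in iid_rows \<nu> N. \<forall>i\<in>{1..N}. norm (V i) \<le> R"
  unfolding iid_rows_def using bdd prob_space_axioms by (intro AE_ball_countable[THEN iffD2] ballI AE_PiM_component) auto

lemma measurable_exp_tensor:
  "(\<lambda>(V, V'). ennreal (exp (\<Sum>i\<in>{1..N}. tensor (V i) (V' i) \<bullet> w i))) \<in> borel_measurable (iid_rows \<nu> N \<Otimes>\<^sub>M iid_rows \<nu> N)"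
proof -
  have f: "(\<lambda>p. fst p i $ k) \<in> borel_measurable (iid_rows \<nu> N \<Otimes>\<^sub>M iid_rows \<nu> N)" if "i \<in> {1..N}" for i k
    by (rule measurable_compose[OF measurable_fst measurable_row[OF that]])
  have s: "(\<lambda>p. snd p i $ k) \<in> borel_measurable (iid_rows \<nu> N \<Otimes>\<^sub>M iid_rows \<nu> N)" if "i \<in> {1..N}" for i k
    by (rule measurable_compose[OF measurable_snd measurable_row[OF that]])
  show ?thesis
    unfolding tensor_inner split_beta'
    by (intro measurable_compose[OF _ measurable_ennreal] measurable_compose[OF _ borel_measurable_exp] borel_measurable_sum
      borel_measurable_times borel_measurable_const f s)
qed

text \<open>The exponential factors over rows; integrating the rows of \<open>V'\<close> with
  \<open>V\<close> frozen gives a product of functions of single rows of \<open>V\<close>, which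
  factors again.\<close>

lemma nn_integral_iid_exp_tensor:
  "(\<integral>\<^sup>+V. \<integral>\<^sup>+V'. ennreal (exp (\<Sum>i\<in>{1..N}. tensor (V i) (V' i) \<bullet> w i)) \<partial>iid_rows \<nu> N \<partial>iid_rows \<nu> N) = (\<Prod>i\<in>{1..N}. mgf (w i))"
proof -
  interpret P: product_sigma_finite "\<lambda>_::nat. \<nu>"
    by (simp add: product_sigma_finite_def sigma_finite_measure_axioms)
  have m: "(\<lambda>(x, x'). ennreal (exp (tensor x x' \<bullet> v))) \<in> borel_measurable (\<nu> \<Otimes>\<^sub>M \<nu>)" for v
    unfolding tensor_inner by measurable
  have "(\<integral>\<^sup>+V'. ennreal (exp (\<Sum>i\<in>{1..N}. tensor (V i) (V' i) \<bullet> w i)) \<partial>iid_rows \<nu> N) =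
    (\<Prod>i\<in>{1..N}. \<integral>\<^sup>+x'. ennreal (exp (tensor (V i) x' \<bullet> w i)) \<partial>\<nu>)" for V
  proof -
    have "(\<integral>\<^sup>+V'. ennreal (exp (\<Sum>i\<in>{1..N}. tensor (V i) (V' i) \<bullet> w i)) \<partial>iid_rows \<nu> N) =
      (\<integral>\<^sup>+V'. (\<Prod>i\<in>{1..N}. ennreal (exp (tensor (V i) (V' i) \<bullet> w i))) \<partial>iid_rows \<nu> N)"
      by (simp add: exp_sum prod_ennreal)
    also have "\<dots> = (\<Prod>i\<in>{1..N}. \<integral>\<^sup>+x'. ennreal (exp (tensor (V i) x' \<bullet> w i)) \<partial>\<nu>)"
      unfolding iid_rows_def
    proof (rule P.product_nn_integral_prod)
      fix i
      show "(\<lambda>x'. ennreal (exp (tensor (V i) x' \<bullet> w i))) \<in> borel_measurable \<nu>"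
        unfolding tensor_inner by measurable
    qed simp
    finally show ?thesis .
  qed
  moreover have "(\<integral>\<^sup>+V. (\<Prod>i\<in>{1..N}. \<integral>\<^sup>+x'. ennreal (exp (tensor (V i) x' \<bullet> w i)) \<partial>\<nu>) \<partial>iid_rows \<nu> N) = (\<Prod>i\<in>{1..N}. mgf (w i))"
    unfolding iid_rows_def mgf_def
  proof (rule P.product_nn_integral_prod)
    fix i
    show "(\<lambda>x. \<integral>\<^sup>+x'. ennreal (exp (tensor x x' \<bullet> w i)) \<partial>\<nu>) \<in> borel_measurable \<nu>"
      using borel_measurable_nn_integral_fst[OF m[of "w i"]] by simp
  qed simp
  ultimately show ?thesis by simp
qed

text \<open>Pointwise, the truncated exponential is at most a constant times a product over blocks
  and tensor coordinates of mixtures. Expanding that product yields exponentials linear in the row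
  tensors, whose averages factor over rows; the averaged terms then recombine into a power of one
  series.\<close>

lemma nn_integral_exp_trunc_overlap_le:
  fixes \<Phi> :: "real ^ 'n ^ 'n" and \<rho> :: "real ^ 'n" and q :: "nat \<Rightarrow> 'n"
  assumes N: "N \<ge> 1" and \<rho>: "\<And>a. \<rho> $ a > 0"
    and \<Phi>: "\<And>a b. 0 \<le> \<Phi> $ a $ b" "\<And>a b. \<Phi> $ a $ b = \<Phi> $ b $ a" "\<And>a. \<Phi> $ a $ a \<le> F"
    and quad: "\<And>x :: 'n \<Rightarrow> real. \<beta>\<^sup>2 * (\<Sum>a\<in>UNIV. \<Sum>b\<in>UNIV. \<Phi> $ a $ b * (sqrt (\<rho> $ a) * x a) * (sqrt (\<rho> $ b) * x b))
       \<le> c * (\<Sum>a\<in>UNIV. (x a)\<^sup>2)"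
    and c: "0 \<le> c" and \<kappa>: "\<kappa> > 1"
    and card: "\<And>a. real (card {i\<in>{1..N}. q i = a}) \<le> \<kappa> * (\<rho> $ a * real N)"
    and mgf_le: "\<And>a v. (norm v)\<^sup>2 \<le> 2 * real D * real CARD('k \<times> 'k) / (\<rho> $ a * real N) \<Longrightarrow> mgf v \<le> ennreal (exp (\<kappa> / 2 * (norm v)\<^sup>2))"
  shows "(\<integral>\<^sup>+V. \<integral>\<^sup>+V'. ennreal (exp_trunc D
      \<bar>\<Sum>(i, j)\<in>upper_pairs N. \<beta>\<^sup>2 / real N * \<Phi> $ q i $ q j * (tensor (V i) (V' i) \<bullet> tensor (V j) (V' j))\<bar>) \<partial>iid_rows \<nu> N \<partial>iid_rows \<nu> N)
    \<le> ennreal (exp (\<beta>\<^sup>2 / 2 * F * (R\<^sup>2)\<^sup>2) * (2 * (\<Sum>k\<le>D. mix_weight c k * exp (\<kappa>\<^sup>2 * real k))) ^ CARD('n \<times> 'k \<times> 'k))"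
proof -
  let ?M = "iid_rows \<nu> N"
  interpret M: prob_space ?M by (rule prob_iid)
  \<comment> \<open>A function \<open>\<phi>\<close> in \<open>\<Psi>\<close> picks a level and a
    sign for each block and coordinate, and so indexes one term of the expanded product;
    \<open>\<tau>\<close> is the tilt of a single pick.\<close>
  define T where "T = {..D} \<times> {1, -1 :: real}"
  define \<tau> where "\<tau> = (\<lambda>(k, s). s * sqrt (2 * real k))"
  define \<Psi> where "\<Psi> = (UNIV :: ('n \<times> 'k \<times> 'k) set) \<rightarrow>\<^sub>E T"
  define C where "C = exp (\<beta>\<^sup>2 / 2 * F * (R\<^sup>2)\<^sup>2)"
  define A where "A \<phi> = C * (\<Prod>ap\<in>UNIV. mix_weight c (fst (\<phi> ap)))" for \<phi> :: "'n \<times> 'k \<times> 'k \<Rightarrow> nat \<times> real"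
  define t where "t \<phi> a = (\<chi> p. \<tau> (\<phi> (a, p)))" for \<phi> :: "'n \<times> 'k \<times> 'k \<Rightarrow> nat \<times> real" and a
  \<comment> \<open>The tilt acting on one row of block \<open>a\<close>: the normalisation of the
    block mean is moved onto the test vector.\<close>
  define w where "w \<phi> a = t \<phi> a /\<^sub>R sqrt (\<rho> $ a * real N)" for \<phi> a
  have rN: "\<rho> $ a * real N > 0" for a using \<rho>[of a] N by simp
  have finT: "finite T" by (simp add: T_def)
  have fin\<Psi>: "finite \<Psi>" unfolding \<Psi>_def using finT by (intro finite_PiE) auto
  have A0: "A \<phi> \<ge> 0" for \<phi> unfolding A_def C_def by (intro mult_nonneg_nonneg prod_nonneg mix_weight_nonneg ballI c) simp
  have pointwise: "exp_trunc D \<bar>\<Sum>(i, j)\<in>upper_pairs N. \<beta>\<^sup>2 / real N * \<Phi> $ q i $ q j * (tensor (V i) (V' i) \<bullet> tensor (V j) (V' j))\<bar>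
    \<le> (\<Sum>\<phi>\<in>\<Psi>. A \<phi> * exp (\<Sum>i\<in>{1..N}. tensor (V i) (V' i) \<bullet> w \<phi> (q i)))"
    if V: "\<forall>i\<in>{1..N}. norm (V i) \<le> R" "\<forall>i\<in>{1..N}. norm (V' i) \<le> R" for V V' :: "nat \<Rightarrow> real ^ 'k"
  proof -
    define u where "u i = tensor (V i) (V' i)" for i
    define Z where "Z = block_mean \<rho> q N u"
    have u: "norm (u i) \<le> R\<^sup>2" if "i \<in> {1..N}" for i
      unfolding u_def norm_tensor power2_eq_square using V that by (intro mult_mono) (auto intro: order_trans[OF norm_ge_zero])
    have "\<bar>\<Sum>(i, j)\<in>upper_pairs N. \<beta>\<^sup>2 / real N * \<Phi> $ q i $ q j * (u i \<bullet> u j)\<bar>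
      \<le> \<beta>\<^sup>2 / 2 * F * (R\<^sup>2)\<^sup>2 + c / 2 * (\<Sum>a\<in>UNIV. (norm (Z a))\<^sup>2)"
      unfolding Z_def by (rule block_quadratic_form_le[OF N \<rho> \<Phi> quad u]) auto
    also have "c / 2 * (\<Sum>a\<in>UNIV. (norm (Z a))\<^sup>2) = (\<Sum>(a, p)\<in>UNIV. c / 2 * (Z a $ p)\<^sup>2)"
    proof -
      have "(\<Sum>a\<in>UNIV. (norm (Z a))\<^sup>2) = (\<Sum>a\<in>UNIV. \<Sum>p\<in>UNIV. (Z a $ p)\<^sup>2)"
        by (simp add: norm_vec_def L2_set_def sum_nonneg)
      also have "\<dots> = (\<Sum>(a, p)\<in>UNIV. (Z a $ p)\<^sup>2)" by (simp add: sum.cartesian_product)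
      finally show ?thesis by (simp add: sum_distrib_left split_beta')
    qed
    finally have "exp_trunc D \<bar>\<Sum>(i, j)\<in>upper_pairs N. \<beta>\<^sup>2 / real N * \<Phi> $ q i $ q j * (u i \<bullet> u j)\<bar>
      \<le> exp_trunc D (\<beta>\<^sup>2 / 2 * F * (R\<^sup>2)\<^sup>2 + (\<Sum>(a, p)\<in>UNIV. c / 2 * (Z a $ p)\<^sup>2))"
      by (intro exp_trunc_mono) auto
    also have "\<dots> \<le> exp_trunc D (\<beta>\<^sup>2 / 2 * F * (R\<^sup>2)\<^sup>2) * exp_trunc D (\<Sum>(a, p)\<in>UNIV. c / 2 * (Z a $ p)\<^sup>2)"
    proof (rule exp_trunc_add_le)
      have "F \<ge> 0" using \<Phi>(1,3) order_trans by blast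
      then show "0 \<le> \<beta>\<^sup>2 / 2 * F * (R\<^sup>2)\<^sup>2" by simp
      show "0 \<le> (\<Sum>(a, p)\<in>UNIV. c / 2 * (Z a $ p)\<^sup>2)" using c by (intro sum_nonneg) auto
    qed
    also have "\<dots> \<le> C * (\<Prod>(a, p)\<in>UNIV. exp_trunc D (c / 2 * (Z a $ p)\<^sup>2))"
    proof (rule mult_mono)
      have F0: "F \<ge> 0" using \<Phi>(1,3) order_trans by blast
      show "exp_trunc D (\<beta>\<^sup>2 / 2 * F * (R\<^sup>2)\<^sup>2) \<le> C" unfolding C_def using F0 by (intro exp_trunc_le_exp) simp
      show "exp_trunc D (\<Sum>(a, p)\<in>UNIV. c / 2 * (Z a $ p)\<^sup>2) \<le> (\<Prod>(a, p)\<in>UNIV. exp_trunc D (c / 2 * (Z a $ p)\<^sup>2))"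
        using exp_trunc_sum_le[of UNIV "\<lambda>(a, p). c / 2 * (Z a $ p)\<^sup>2" D] c by (simp add: split_beta')
      show "0 \<le> C" by (simp add: C_def)
      show "0 \<le> exp_trunc D (\<Sum>(a, p)\<in>UNIV. c / 2 * (Z a $ p)\<^sup>2)"
        using c by (intro exp_trunc_nonneg sum_nonneg) auto
    qed
    also have "\<dots> \<le> C * (\<Prod>ap\<in>UNIV. \<Sum>x\<in>T. mix_weight c (fst x) * exp (\<tau> x * Z (fst ap) $ snd ap))"
    proof (intro mult_left_mono)
      show "(\<Prod>(a, p)\<in>UNIV. exp_trunc D (c / 2 * (Z a $ p)\<^sup>2)) \<le> (\<Prod>ap\<in>UNIV. \<Sum>x\<in>T. mix_weight c (fst x) * exp (\<tau> x * Z (fst ap) $ snd ap))"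
        unfolding split_beta' using c
      proof (intro prod_mono conjI exp_trunc_nonneg)
        fix ap
        show "exp_trunc D (c / 2 * (Z (fst ap) $ snd ap)\<^sup>2) \<le> (\<Sum>x\<in>T. mix_weight c (fst x) * exp (\<tau> x * Z (fst ap) $ snd ap))"
          using exp_trunc_square_le_mixture[OF c] unfolding T_def \<tau>_def split_beta' .
      qed auto
    qed (simp add: C_def)
    also have "\<dots> = C * (\<Sum>\<phi>\<in>\<Psi>. \<Prod>ap\<in>UNIV. mix_weight c (fst (\<phi> ap)) * exp (\<tau> (\<phi> ap) * Z (fst ap) $ snd ap))"
      unfolding \<Psi>_def using finT by (subst prod_sum_PiE) auto
    also have "\<dots> = (\<Sum>\<phi>\<in>\<Psi>. A \<phi> * exp (\<Sum>ap\<in>UNIV. \<tau> (\<phi> ap) * Z (fst ap) $ snd ap))"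
      unfolding sum_distrib_left A_def by (intro sum.cong refl) (simp add: prod.distrib exp_sum mult.assoc)
    also have "\<dots> = (\<Sum>\<phi>\<in>\<Psi>. A \<phi> * exp (\<Sum>i\<in>{1..N}. u i \<bullet> w \<phi> (q i)))"
    proof (intro sum.cong refl)
      fix \<phi> :: "'n \<times> 'k \<times> 'k \<Rightarrow> nat \<times> real"
      have "(\<Sum>ap\<in>UNIV. \<tau> (\<phi> ap) * Z (fst ap) $ snd ap) = (\<Sum>a\<in>UNIV. \<Sum>p\<in>UNIV. \<tau> (\<phi> (a, p)) * Z a $ p)"
        by (simp add: sum.cartesian_product split_beta')
      also have "\<dots> = (\<Sum>a\<in>UNIV. Z a \<bullet> t \<phi> a)"
        by (simp add: inner_vec_def t_def mult.commute)
      also have "\<dots> = (\<Sum>a\<in>UNIV. \<Sum>i\<in>{i\<in>{1..N}. q i = a}. u i \<bullet> w \<phi> (q i))"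
        unfolding Z_def block_mean_def w_def by (intro sum.cong refl) (simp add: inner_sum_left sum_distrib_left)
      also have "\<dots> = (\<Sum>i\<in>{1..N}. u i \<bullet> w \<phi> (q i))"
        by (intro sum.group) auto
      finally show "A \<phi> * exp (\<Sum>ap\<in>UNIV. \<tau> (\<phi> ap) * Z (fst ap) $ snd ap) = A \<phi> * exp (\<Sum>i\<in>{1..N}. u i \<bullet> w \<phi> (q i))" by simp
    qed
    finally show ?thesis unfolding u_def .
  qed
  have mean_exp: "(\<Prod>i\<in>{1..N}. mgf (w \<phi> (q i))) \<le> ennreal (\<Prod>ap\<in>UNIV. exp (\<kappa>\<^sup>2 * real (fst (\<phi> ap))))" if \<phi>: "\<phi> \<in> \<Psi>" for \<phi>
  proof -
    have \<phi>T: "\<phi> ap \<in> T" for ap using \<phi> by (auto simp: \<Psi>_def)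
    have \<tau>2: "(\<tau> (\<phi> ap))\<^sup>2 = 2 * real (fst (\<phi> ap))" for ap
      using \<phi>T[of ap] by (auto simp: T_def \<tau>_def power_mult_distrib)
    have nt: "(norm (t \<phi> a))\<^sup>2 = (\<Sum>p\<in>UNIV. 2 * real (fst (\<phi> (a, p))))" for a
      by (simp add: norm_vec_def L2_set_def sum_nonneg t_def \<tau>2)
    have nw: "(norm (w \<phi> a))\<^sup>2 = (norm (t \<phi> a))\<^sup>2 / (\<rho> $ a * real N)" for a
      using rN[of a] unfolding w_def by (simp add: power_mult_distrib divide_inverse mult.commute power_inverse abs_of_pos)
    have "mgf (w \<phi> a) \<le> ennreal (exp (\<kappa> / 2 * (norm (w \<phi> a))\<^sup>2))" for a
    proof (rule mgf_le[of _ a])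
      \<comment> \<open>Levels are at most \<open>D\<close>, so every coordinate contributes at most
        \<open>2 * real D\<close>. The truncation thus keeps \<open>w\<close> in the range covered
        by \<open>mgf_le\<close>.\<close>
      have "(norm (t \<phi> a))\<^sup>2 \<le> (\<Sum>p\<in>(UNIV :: ('k \<times> 'k) set). 2 * real D)"
        unfolding nt using \<phi>T by (intro sum_mono) (auto simp: T_def mem_Times_iff)
      then show "(norm (w \<phi> a))\<^sup>2 \<le> 2 * real D * real CARD('k \<times> 'k) / (\<rho> $ a * real N)"
        unfolding nw using rN[of a] by (intro divide_right_mono) (auto simp: mult_ac)
    qed
    then have "(\<Prod>i\<in>{1..N}. mgf (w \<phi> (q i))) \<le> (\<Prod>i\<in>{1..N}. ennreal (exp (\<kappa> / 2 * (norm (w \<phi> (q i)))\<^sup>2)))"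
      by (intro prod_mono_ennreal)
    also have "\<dots> = ennreal (exp (\<Sum>i\<in>{1..N}. \<kappa> / 2 * (norm (w \<phi> (q i)))\<^sup>2))"
      by (simp add: exp_sum prod_ennreal)
    also have "(\<Sum>i\<in>{1..N}. \<kappa> / 2 * (norm (w \<phi> (q i)))\<^sup>2) = (\<Sum>a\<in>UNIV. \<Sum>i\<in>{i\<in>{1..N}. q i = a}. \<kappa> / 2 * (norm (w \<phi> (q i)))\<^sup>2)"
      by (intro sum.group[symmetric]) auto
    also have "\<dots> = (\<Sum>a\<in>UNIV. real (card {i\<in>{1..N}. q i = a}) * (\<kappa> / 2 * (norm (w \<phi> a))\<^sup>2))"
      by (intro sum.cong refl) simp
    \<comment> \<open>The second factor \<kappa>, from the block size; after \<open>real N\<close>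
      cancels, each coordinate costs \<open>\<kappa>\<^sup>2\<close> times its level.\<close>
    also have "\<dots> \<le> (\<Sum>a\<in>UNIV. \<kappa> * (\<rho> $ a * real N) * (\<kappa> / 2 * (norm (w \<phi> a))\<^sup>2))"
      using card \<kappa> by (intro sum_mono mult_right_mono) auto
    also have "\<dots> = (\<Sum>a\<in>UNIV. \<Sum>p\<in>UNIV. \<kappa>\<^sup>2 * real (fst (\<phi> (a, p))))"
    proof (intro sum.cong refl)
      fix a
      have "\<kappa> * (\<rho> $ a * real N) * (\<kappa> / 2 * (norm (w \<phi> a))\<^sup>2) = \<kappa>\<^sup>2 / 2 * (norm (t \<phi> a))\<^sup>2"
      proof -
        have "\<kappa> * r * (\<kappa> / 2 * (b / r)) = \<kappa>\<^sup>2 / 2 * b" if "r > 0" for r b :: real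
          using that by (simp add: power2_eq_square)
        from this[OF rN[of a]] show ?thesis unfolding nw .
      qed
      then show "\<kappa> * (\<rho> $ a * real N) * (\<kappa> / 2 * (norm (w \<phi> a))\<^sup>2) = (\<Sum>p\<in>UNIV. \<kappa>\<^sup>2 * real (fst (\<phi> (a, p))))"
        unfolding nt by (simp add: sum_distrib_left[symmetric])
    qed
    also have "\<dots> = (\<Sum>ap\<in>UNIV. \<kappa>\<^sup>2 * real (fst (\<phi> ap)))"
      by (simp add: sum.cartesian_product)
    finally show ?thesis by (simp add: exp_sum ennreal_leI)
  qed
  have "(\<integral>\<^sup>+V. \<integral>\<^sup>+V'. ennreal (exp_trunc D
      \<bar>\<Sum>(i, j)\<in>upper_pairs N. \<beta>\<^sup>2 / real N * \<Phi> $ q i $ q j * (tensor (V i) (V' i) \<bullet> tensor (V j) (V' j))\<bar>) \<partial>?M \<partial>?M)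
    \<le> (\<integral>\<^sup>+V. \<integral>\<^sup>+V'. (\<Sum>\<phi>\<in>\<Psi>. ennreal (A \<phi>) * ennreal (exp (\<Sum>i\<in>{1..N}. tensor (V i) (V' i) \<bullet> w \<phi> (q i)))) \<partial>?M \<partial>?M)"
  proof (rule nn_integral_mono_AE, use AE_iid_norm_le in eventually_elim)
    fix V :: "nat \<Rightarrow> real ^ 'k" assume V: "\<forall>i\<in>{1..N}. norm (V i) \<le> R"
    show "(\<integral>\<^sup>+V'. ennreal (exp_trunc D
      \<bar>\<Sum>(i, j)\<in>upper_pairs N. \<beta>\<^sup>2 / real N * \<Phi> $ q i $ q j * (tensor (V i) (V' i) \<bullet> tensor (V j) (V' j))\<bar>) \<partial>?M)
      \<le> (\<integral>\<^sup>+V'. (\<Sum>\<phi>\<in>\<Psi>. ennreal (A \<phi>) * ennreal (exp (\<Sum>i\<in>{1..N}. tensor (V i) (V' i) \<bullet> w \<phi> (q i)))) \<partial>?M)"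
    proof (rule nn_integral_mono_AE, use AE_iid_norm_le in eventually_elim)
      fix V' :: "nat \<Rightarrow> real ^ 'k" assume "\<forall>i\<in>{1..N}. norm (V' i) \<le> R"
      then have "ennreal (exp_trunc D \<bar>\<Sum>(i, j)\<in>upper_pairs N. \<beta>\<^sup>2 / real N * \<Phi> $ q i $ q j * (tensor (V i) (V' i) \<bullet> tensor (V j) (V' j))\<bar>)
        \<le> ennreal (\<Sum>\<phi>\<in>\<Psi>. A \<phi> * exp (\<Sum>i\<in>{1..N}. tensor (V i) (V' i) \<bullet> w \<phi> (q i)))"
        by (intro ennreal_leI pointwise V)
      also have "\<dots> = (\<Sum>\<phi>\<in>\<Psi>. ennreal (A \<phi>) * ennreal (exp (\<Sum>i\<in>{1..N}. tensor (V i) (V' i) \<bullet> w \<phi> (q i))))"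
        using A0 by (subst sum_ennreal[symmetric]) (auto simp: ennreal_mult)
      finally show "ennreal (exp_trunc D \<bar>\<Sum>(i, j)\<in>upper_pairs N. \<beta>\<^sup>2 / real N * \<Phi> $ q i $ q j * (tensor (V i) (V' i) \<bullet> tensor (V j) (V' j))\<bar>)
        \<le> (\<Sum>\<phi>\<in>\<Psi>. ennreal (A \<phi>) * ennreal (exp (\<Sum>i\<in>{1..N}. tensor (V i) (V' i) \<bullet> w \<phi> (q i))))" .
    qed
  qed
  also have "\<dots> = (\<Sum>\<phi>\<in>\<Psi>. ennreal (A \<phi>) * (\<Prod>i\<in>{1..N}. mgf (w \<phi> (q i))))"
  proof -
    let ?e = "\<lambda>\<phi> V V'. ennreal (exp (\<Sum>i\<in>{1..N}. tensor (V i) (V' i) \<bullet> w \<phi> (q i)))"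
    have mp: "(\<lambda>(V, V'). ?e \<phi> V V') \<in> borel_measurable (?M \<Otimes>\<^sub>M ?M)" for \<phi>
      by (rule measurable_exp_tensor)
    have m1: "?e \<phi> V \<in> borel_measurable ?M" if "V \<in> space ?M" for \<phi> V
      using measurable_compose[OF measurable_Pair1'[OF that] mp[of \<phi>]] by simp
    have m2: "(\<lambda>V. \<integral>\<^sup>+V'. ?e \<phi> V V' \<partial>?M) \<in> borel_measurable ?M" for \<phi>
      using M.borel_measurable_nn_integral_fst[OF mp[of \<phi>]] by simp
    have "(\<integral>\<^sup>+V. \<integral>\<^sup>+V'. (\<Sum>\<phi>\<in>\<Psi>. ennreal (A \<phi>) * ?e \<phi> V V') \<partial>?M \<partial>?M) =
      (\<integral>\<^sup>+V. (\<Sum>\<phi>\<in>\<Psi>. ennreal (A \<phi>) * (\<integral>\<^sup>+V'. ?e \<phi> V V' \<partial>?M)) \<partial>?M)"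
    proof (rule nn_integral_cong)
      fix V assume V: "V \<in> space ?M"
      show "(\<integral>\<^sup>+V'. (\<Sum>\<phi>\<in>\<Psi>. ennreal (A \<phi>) * ?e \<phi> V V') \<partial>?M) = (\<Sum>\<phi>\<in>\<Psi>. ennreal (A \<phi>) * (\<integral>\<^sup>+V'. ?e \<phi> V V' \<partial>?M))"
        using m1[OF V] by (subst nn_integral_sum) (auto simp: nn_integral_cmult)
    qed
    also have "\<dots> = (\<Sum>\<phi>\<in>\<Psi>. ennreal (A \<phi>) * (\<integral>\<^sup>+V. \<integral>\<^sup>+V'. ?e \<phi> V V' \<partial>?M \<partial>?M))"
      using m2 by (subst nn_integral_sum) (auto simp: nn_integral_cmult)
    finally show ?thesis by (simp only: nn_integral_iid_exp_tensor)
  qed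
  also have "\<dots> \<le> (\<Sum>\<phi>\<in>\<Psi>. ennreal (A \<phi>) * ennreal (\<Prod>ap\<in>UNIV. exp (\<kappa>\<^sup>2 * real (fst (\<phi> ap)))))"
    by (intro sum_mono mult_left_mono mean_exp) auto
  also have "\<dots> = ennreal (\<Sum>\<phi>\<in>\<Psi>. A \<phi> * (\<Prod>ap\<in>UNIV. exp (\<kappa>\<^sup>2 * real (fst (\<phi> ap)))))"
    using A0 by (subst sum_ennreal[symmetric]) (auto simp: ennreal_mult prod_nonneg)
  also have "(\<Sum>\<phi>\<in>\<Psi>. A \<phi> * (\<Prod>ap\<in>UNIV. exp (\<kappa>\<^sup>2 * real (fst (\<phi> ap))))) =
    C * (\<Sum>\<phi>\<in>\<Psi>. \<Prod>ap\<in>UNIV. mix_weight c (fst (\<phi> ap)) * exp (\<kappa>\<^sup>2 * real (fst (\<phi> ap))))"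
    unfolding A_def sum_distrib_left by (intro sum.cong refl) (simp add: prod.distrib mult.assoc)
  \<comment> \<open>The averaged terms are again products over coordinates, so the sum over all
    choices folds back into a product of identical sums.\<close>
  also have "(\<Sum>\<phi>\<in>\<Psi>. \<Prod>ap\<in>UNIV. mix_weight c (fst (\<phi> ap)) * exp (\<kappa>\<^sup>2 * real (fst (\<phi> ap)))) =
    (\<Prod>ap\<in>(UNIV :: ('n \<times> 'k \<times> 'k) set). \<Sum>x\<in>T. mix_weight c (fst x) * exp (\<kappa>\<^sup>2 * real (fst x)))"
    unfolding \<Psi>_def using finT by (subst prod_sum_PiE) auto
  also have "\<dots> = (\<Sum>x\<in>T. mix_weight c (fst x) * exp (\<kappa>\<^sup>2 * real (fst x))) ^ CARD('n \<times> 'k \<times> 'k)"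
    by simp
  also have "(\<Sum>x\<in>T. mix_weight c (fst x) * exp (\<kappa>\<^sup>2 * real (fst x))) = 2 * (\<Sum>k\<le>D. mix_weight c k * exp (\<kappa>\<^sup>2 * real k))"
  proof -
    have "(\<Sum>x\<in>T. mix_weight c (fst x) * exp (\<kappa>\<^sup>2 * real (fst x))) = (\<Sum>k\<le>D. \<Sum>s\<in>{1, -1::real}. mix_weight c k * exp (\<kappa>\<^sup>2 * real k))"
      unfolding T_def by (simp only: sum.cartesian_product split_beta')
    then show ?thesis by (simp add: sum_distrib_left)
  qed
  finally show ?thesis unfolding C_def .
qed

end

section \<open>From truncated exponentials to the full second moment\<close>

context spiked_model
begin

lemma nn_integral_overlap_pair:
  assumes "(\<lambda>y. g y) \<in> borel_measurable (borel :: real measure)"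
  shows "(\<integral>\<^sup>+X. \<integral>\<^sup>+X'. ennreal (g (overlap X X')) \<partial>S \<partial>S) = (\<integral>\<^sup>+(X, X'). ennreal (g (overlap X X')) \<partial>(S \<Otimes>\<^sub>M S))"
proof -
  interpret S: prob_space S by (rule prob_S)
  have "(\<lambda>(X, X'). ennreal (g (overlap X X'))) \<in> borel_measurable (S \<Otimes>\<^sub>M S)"
    using measurable_compose[OF measurable_compose[OF measurable_overlap assms] measurable_ennreal] by (simp add: split_beta')
  from S.nn_integral_fst[OF this] show ?thesis by (simp add: split_beta')
qed

text \<open>After passing to |W| the exponential series has nonnegative terms, so it is integrated
  termwise; each partial sum is bounded by a truncation, uniformly in \<open>D\<close>.\<close>

lemma nn_integral_avg_lr_square_le:
  assumes "\<And>D. (\<integral>\<^sup>+X. \<integral>\<^sup>+X'. ennreal (exp_trunc D \<bar>overlap X X'\<bar>) \<partial>S \<partial>S) \<le> K"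
  shows "(\<integral>\<^sup>+Y. (avg_lr Y)\<^sup>2 \<partial>Q) \<le> K"
proof -
  have mo: "(\<lambda>p. overlap (fst p) (snd p)) \<in> borel_measurable (S \<Otimes>\<^sub>M S)"
    using measurable_overlap by (simp add: split_beta')
  have m: "(\<lambda>y. exp_trunc D \<bar>y\<bar>) \<in> borel_measurable borel" for D
    unfolding exp_trunc_def by measurable
  define W where "W p = \<bar>overlap (fst p) (snd p)\<bar>" for p
  have [measurable]: "W \<in> borel_measurable (S \<Otimes>\<^sub>M S)" unfolding W_def using mo by measurable
  have bd: "(\<integral>\<^sup>+p. ennreal (exp_trunc D (W p)) \<partial>(S \<Otimes>\<^sub>M S)) \<le> K" for D
    using assms[of D] unfolding nn_integral_overlap_pair[OF m] W_def by (simp add: split_beta')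
  have "(\<integral>\<^sup>+Y. (avg_lr Y)\<^sup>2 \<partial>Q) = (\<integral>\<^sup>+p. ennreal (exp (overlap (fst p) (snd p))) \<partial>(S \<Otimes>\<^sub>M S))"
    unfolding nn_integral_avg_lr_square using nn_integral_overlap_pair[of exp] by (simp add: split_beta')
  also have "\<dots> \<le> (\<integral>\<^sup>+p. ennreal (exp (W p)) \<partial>(S \<Otimes>\<^sub>M S))"
    unfolding W_def by (intro nn_integral_mono ennreal_leI) simp
  also have "\<dots> = (\<integral>\<^sup>+p. suminf (\<lambda>d. ennreal (W p ^ d / fact d)) \<partial>(S \<Otimes>\<^sub>M S))"
    by (intro nn_integral_cong suminf_ennreal_eq[symmetric] exp_sums) (simp add: W_def)
  also have "\<dots> = suminf (\<lambda>d. \<integral>\<^sup>+p. ennreal (W p ^ d / fact d) \<partial>(S \<Otimes>\<^sub>M S))"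
    by (rule nn_integral_suminf) measurable
  also have "\<dots> \<le> K"
  proof (rule suminf_le_const)
    fix n
    have "(\<Sum>d<n. \<integral>\<^sup>+p. ennreal (W p ^ d / fact d) \<partial>(S \<Otimes>\<^sub>M S)) = (\<integral>\<^sup>+p. (\<Sum>d<n. ennreal (W p ^ d / fact d)) \<partial>(S \<Otimes>\<^sub>M S))"
      by (subst nn_integral_sum) auto
    also have "\<dots> \<le> (\<integral>\<^sup>+p. ennreal (exp_trunc n (W p)) \<partial>(S \<Otimes>\<^sub>M S))"
    proof (rule nn_integral_mono)
      fix p
      have "(\<Sum>d<n. W p ^ d / fact d) \<le> exp_trunc n (W p)"
        unfolding exp_trunc_def by (intro sum_mono2) (auto simp: W_def)
      then show "(\<Sum>d<n. ennreal (W p ^ d / fact d)) \<le> ennreal (exp_trunc n (W p))"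
        by (subst sum_ennreal) (auto simp: W_def intro: ennreal_leI)
    qed
    also have "\<dots> \<le> K" by (rule bd)
    finally show "(\<Sum>d<n. \<integral>\<^sup>+p. ennreal (W p ^ d / fact d) \<partial>(S \<Otimes>\<^sub>M S)) \<le> K" .
  qed simp
  finally show ?thesis .
qed

end

lemma var_nonneg: "var M f \<ge> 0"
  unfolding var_def by (rule integral_nonneg_AE) simp

text \<open>Separation is a strict inequality, so the contradiction persists even when both
  variances vanish.\<close>

lemma not_strong_separation:
  assumes "\<forall>\<^sub>F N in sequentially. (\<integral>y. f N y \<partial>P N) - (\<integral>y. f N y \<partial>Q N) \<le> B * sqrt (var (Q N) (f N))"
    and "B \<ge> 0"
  shows "\<not> strong_separation P Q f"
proof
  assume "strong_separation P Q f"
  \<comment> \<open>The constant \<open>B + 1\<close> is positive also for \<open>B = 0\<close>, as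
    the definition of separation demands.\<close>
  then have "\<forall>\<^sub>F N in sequentially. (\<integral>y. f N y \<partial>P N) - (\<integral>y. f N y \<partial>Q N) > (B + 1) * (sqrt (var (Q N) (f N)) + sqrt (var (P N) (f N)))"
    unfolding strong_separation_def using assms(2) by (elim conjE allE[of _ "B + 1"] impE) auto
  with assms(1) have "\<forall>\<^sub>F N :: nat in sequentially. False"
  proof eventually_elim
    case (elim N)
    have "B * sqrt (var (Q N) (f N)) \<le> (B + 1) * (sqrt (var (Q N) (f N)) + sqrt (var (P N) (f N)))"
      using assms(2) by (intro mult_mono) (auto simp: var_nonneg)
    then show ?case using elim by linarith
  qed
  then show False by simp
qed

section \<open>Uniform bounds for the block-structured spike\<close>

locale block_model = row_law \<nu> R for \<nu> :: "(real ^ 'k) measure" and R +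
  fixes \<Delta> :: "nat \<Rightarrow> nat \<Rightarrow> nat \<Rightarrow> ereal" and \<Delta>b :: "ereal ^ 'n ^ 'n" and \<rho> :: "real ^ 'n"
    and \<beta> :: real and q :: "nat \<Rightarrow> nat \<Rightarrow> 'n"
  assumes params: "block_params \<Delta>b \<rho>"
    and profile: "\<And>N i j. i \<in> {1..N} \<Longrightarrow> j \<in> {1..N} \<Longrightarrow> \<Delta> N i j = \<Delta>b $ q N i $ q N j"
    and block_sizes: "\<And>a. (\<lambda>N. real (card {i\<in>{1..N}. q N i = a}) / real N) \<longlonglongrightarrow> \<rho> $ a"
    and beta: "\<beta> > 0" "ereal \<beta> < beta_star \<Delta>b \<rho>"
begin

abbreviation "S N \<equiv> spike_law \<beta> \<nu> N"

definition spike :: "nat \<Rightarrow> (nat \<Rightarrow> real ^ 'k) \<Rightarrow> nat \<times> nat \<Rightarrow> real" where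
  "spike N V = (\<lambda>(i, j)\<in>{1..N} \<times> {1..N}. \<beta> / sqrt (real N) * (\<Sum>k\<in>UNIV. V i $ k * V j $ k))"

lemma spike_eq: "i \<in> {1..N} \<Longrightarrow> j \<in> {1..N} \<Longrightarrow> spike N V (i, j) = \<beta> / sqrt (real N) * (V i \<bullet> V j)"
  by (simp add: spike_def inner_vec_def)

lemma spiked: "spiked_model \<Delta> N (S N)"
proof
  show "\<forall>i\<in>{1..N}. \<forall>j\<in>{1..N}. 0 < \<Delta> N i j"
    using params profile by (simp add: block_params_def)
  show "S N \<in> space (prob_algebra (matrix_space N))"
    by (intro spike_law_in_prob_algebra prob_space_axioms sets_\<nu>)
qed

lemma measurable_spike: "spike N \<in> measurable (iid_rows \<nu> N) (matrix_space N)"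
  unfolding matrix_space_def spike_def
  by (rule measurable_restrict)
     (auto intro!: borel_measurable_times borel_measurable_divide borel_measurable_sum measurable_row)

lemma S_eq: "S N = distr (iid_rows \<nu> N) (matrix_space N) (spike N)"
  unfolding spike_law_def spike_def ..

text \<open>The product of the two spike entries is an inner product of row tensors. Unobserved
  pairs have reciprocal variance 0, so the sum may run over all upper pairs.\<close>

lemma overlap_spike:
  assumes "N \<ge> 1"
  shows "spiked_model.overlap \<Delta> N (spike N V) (spike N V') =
    (\<Sum>(i, j)\<in>upper_pairs N. \<beta>\<^sup>2 / real N * recip_profile \<Delta>b $ q N i $ q N j * (tensor (V i) (V' i) \<bullet> tensor (V j) (V' j)))"
proof -
  interpret spiked_model \<Delta> N "S N" by (rule spiked)
  have "overlap (spike N V) (spike N V') =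
    (\<Sum>(i, j)\<in>J. \<beta>\<^sup>2 / real N * recip_profile \<Delta>b $ q N i $ q N j * (tensor (V i) (V' i) \<bullet> tensor (V j) (V' j)))"
    unfolding overlap_def
  proof (intro sum.cong refl)
    fix p assume p: "p \<in> J"
    obtain i j where ij: "p = (i, j)" by (cases p)
    have r: "i \<in> {1..N}" "j \<in> {1..N}" using p by (auto simp: ij observed_def)
    have D: "\<Delta> N i j = \<Delta>b $ q N i $ q N j" using r by (rule profile)
    have "0 < \<Delta> N i j" "\<Delta> N i j \<noteq> \<infinity>" using pos r p by (auto simp: ij observed_def)
    then obtain d where d: "\<Delta> N i j = ereal d" "d > 0" by (cases "\<Delta> N i j") auto
    have "nvar p = d" using p d by (simp add: nvar_def ij)
    moreover have "recip_profile \<Delta>b $ q N i $ q N j = 1 / d"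
      using d unfolding recip_profile_def D by (simp add: one_ereal_def)
    moreover have "(\<beta> / sqrt (real N)) * (\<beta> / sqrt (real N)) = \<beta>\<^sup>2 / real N"
      by (simp add: power2_eq_square)
    ultimately show "spike N V p * spike N V' p / nvar p = (case p of (i, j) \<Rightarrow>
      \<beta>\<^sup>2 / real N * recip_profile \<Delta>b $ q N i $ q N j * (tensor (V i) (V' i) \<bullet> tensor (V j) (V' j)))"
      using d(2) by (simp add: ij spike_eq[OF r] tensor_inner_tensor power2_eq_square mult_ac)
  qed
  also have "\<dots> = (\<Sum>(i, j)\<in>upper_pairs N. \<beta>\<^sup>2 / real N * recip_profile \<Delta>b $ q N i $ q N j * (tensor (V i) (V' i) \<bullet> tensor (V j) (V' j)))"
  proof (rule sum.mono_neutral_left)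
    show "J \<subseteq> upper_pairs N" by (auto simp: observed_def upper_pairs_def)
    show "\<forall>p\<in>upper_pairs N - J. (case p of (i, j) \<Rightarrow>
      \<beta>\<^sup>2 / real N * recip_profile \<Delta>b $ q N i $ q N j * (tensor (V i) (V' i) \<bullet> tensor (V j) (V' j))) = 0"
    proof
      fix p assume p: "p \<in> upper_pairs N - J"
      obtain i j where ij: "p = (i, j)" by (cases p)
      have "\<Delta>b $ q N i $ q N j = \<infinity>"
        using p profile[of i N j] by (auto simp: ij observed_def upper_pairs_def)
      then have "recip_profile \<Delta>b $ q N i $ q N j = 0" by (simp add: recip_profile_def)
      then show "(case p of (i, j) \<Rightarrow>
        \<beta>\<^sup>2 / real N * recip_profile \<Delta>b $ q N i $ q N j * (tensor (V i) (V' i) \<bullet> tensor (V j) (V' j))) = 0"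
        by (simp add: ij)
    qed
  qed simp
  finally show ?thesis .
qed

lemma nn_integral_overlap_spike:
  assumes "N \<ge> 1" and g: "g \<in> borel_measurable (borel :: real measure)"
  shows "(\<integral>\<^sup>+X. \<integral>\<^sup>+X'. ennreal (g (spiked_model.overlap \<Delta> N X X')) \<partial>S N \<partial>S N) =
    (\<integral>\<^sup>+V. \<integral>\<^sup>+V'. ennreal (g (\<Sum>(i, j)\<in>upper_pairs N. \<beta>\<^sup>2 / real N * recip_profile \<Delta>b $ q N i $ q N j *
      (tensor (V i) (V' i) \<bullet> tensor (V j) (V' j)))) \<partial>iid_rows \<nu> N \<partial>iid_rows \<nu> N)"
proof -
  interpret spiked_model \<Delta> N "S N" by (rule spiked)
  interpret SS: prob_space "S N" by (rule prob_S)
  let ?M = "iid_rows \<nu> N"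
  have mp: "(\<lambda>(X, X'). ennreal (g (overlap X X'))) \<in> borel_measurable (S N \<Otimes>\<^sub>M S N)"
    using measurable_compose[OF measurable_compose[OF measurable_overlap g] measurable_ennreal] by (simp add: split_beta')
  have m1: "(\<lambda>X'. ennreal (g (overlap X X'))) \<in> borel_measurable (matrix_space N)" if "X \<in> space (matrix_space N)" for X
  proof -
    have "X \<in> space (S N)" using that sets_eq_imp_space_eq[OF sets_S] by simp
    from measurable_compose[OF measurable_Pair1'[OF this] mp] show ?thesis
      by (simp add: measurable_cong_sets[OF sets_S refl])
  qed
  have m2: "(\<lambda>X. \<integral>\<^sup>+X'. ennreal (g (overlap X X')) \<partial>S N) \<in> borel_measurable (matrix_space N)"
    using SS.borel_measurable_nn_integral_fst[OF mp] by (simp add: measurable_cong_sets[OF sets_S refl])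
  have d: "(\<integral>\<^sup>+X. f X \<partial>S N) = (\<integral>\<^sup>+V. f (spike N V) \<partial>?M)" if "f \<in> borel_measurable (matrix_space N)" for f
    unfolding S_eq using that by (intro nn_integral_distr[OF measurable_spike]) (simp add: measurable_cong_sets[OF sets_distr refl])
  have "(\<integral>\<^sup>+X. \<integral>\<^sup>+X'. ennreal (g (overlap X X')) \<partial>S N \<partial>S N) =
    (\<integral>\<^sup>+V. (\<integral>\<^sup>+X'. ennreal (g (overlap (spike N V) X')) \<partial>S N) \<partial>?M)"
    by (rule d[OF m2])
  also have "\<dots> = (\<integral>\<^sup>+V. (\<integral>\<^sup>+V'. ennreal (g (overlap (spike N V) (spike N V'))) \<partial>?M) \<partial>?M)"
  proof (rule nn_integral_cong)
    fix V assume "V \<in> space ?M"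
    then have "spike N V \<in> space (matrix_space N)" using measurable_spike by (rule measurable_space[rotated])
    then show "(\<integral>\<^sup>+X'. ennreal (g (overlap (spike N V) X')) \<partial>S N) = (\<integral>\<^sup>+V'. ennreal (g (overlap (spike N V) (spike N V'))) \<partial>?M)"
      by (intro d m1)
  qed
  finally show ?thesis unfolding overlap_spike[OF assms(1)] .
qed

text \<open>The bound depends on \<open>N\<close>; it supplies the integrability needed for the
  Hermite expansion at fixed \<open>N\<close>.\<close>

lemma AE_spike_bounded: "\<exists>B. AE X in S N. \<forall>p\<in>observed \<Delta> N. \<bar>X p\<bar> \<le> B"
proof
  interpret spiked_model \<Delta> N "S N" by (rule spiked)
  let ?B = "\<beta> / sqrt (real N) * (R * R)"
  have ms: "(\<lambda>X. X p) \<in> borel_measurable (matrix_space N)" if "p \<in> J" for p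
    using measurable_S[OF that] by (simp add: measurable_cong_sets[OF sets_S refl])
  have "{X \<in> space (matrix_space N). \<forall>p\<in>J. \<bar>X p\<bar> \<le> ?B} \<in> sets (matrix_space N)"
    using ms by (intro sets.sets_Collect_finite_All finJ) simp
  then show "AE X in S N. \<forall>p\<in>J. \<bar>X p\<bar> \<le> ?B"
    unfolding S_eq
  proof (subst AE_distr_iff[OF measurable_spike])
    show "AE V in iid_rows \<nu> N. \<forall>p\<in>J. \<bar>spike N V p\<bar> \<le> ?B"
      using AE_iid_norm_le
    proof eventually_elim
      case (elim V)
      show ?case
      proof
        fix p assume p: "p \<in> J"
        obtain i j where ij: "p = (i, j)" by (cases p)
        have r: "i \<in> {1..N}" "j \<in> {1..N}" using p by (auto simp: ij observed_def)
        have "\<bar>V i \<bullet> V j\<bar> \<le> norm (V i) * norm (V j)" by (rule Cauchy_Schwarz_ineq2)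
        also have "\<dots> \<le> R * R" using elim r by (intro mult_mono) (auto intro: order_trans[OF norm_ge_zero])
        finally have "\<beta> / sqrt (real N) * \<bar>V i \<bullet> V j\<bar> \<le> ?B" using beta by (intro mult_left_mono) auto
        then show "\<bar>spike N V p\<bar> \<le> ?B" using beta by (simp add: ij spike_eq[OF r] abs_mult)
      qed
    qed
  qed auto
qed

text \<open>\<open>K\<close> depends neither on \<open>N\<close> nor on \<open>D\<close>; the moment
  generating function is constrained only on a ball whose size grows with \<open>D / N\<close>. The
  polynomial bound uses one \<open>D\<close> per \<open>N\<close>, the second moment uses all
  \<open>D\<close> at once.\<close>

lemma overlap_moments_bounded:
  obtains \<kappa> K where "\<kappa> > 1" "K \<ge> 0"
    "\<forall>\<^sub>F N in sequentially. N \<ge> 1 \<and> (\<forall>D.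
      (\<forall>a v. (norm v)\<^sup>2 \<le> 2 * real D * real CARD('k \<times> 'k) / (\<rho> $ a * real N) \<longrightarrow> mgf v \<le> ennreal (exp (\<kappa> / 2 * (norm v)\<^sup>2))) \<longrightarrow>
      (\<integral>\<^sup>+X. \<integral>\<^sup>+X'. ennreal (exp_trunc D \<bar>spiked_model.overlap \<Delta> N X X'\<bar>) \<partial>S N \<partial>S N) \<le> ennreal K)"
proof -
  let ?\<Phi> = "recip_profile \<Delta>b"
  obtain c where c: "0 < c" "c < 1" and quad: "\<And>x :: 'n \<Rightarrow> real. \<beta>\<^sup>2 * (\<Sum>a\<in>UNIV. \<Sum>b\<in>UNIV. ?\<Phi> $ a $ b * (sqrt (\<rho> $ a) * x a) * (sqrt (\<rho> $ b) * x b))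
       \<le> c * (\<Sum>a\<in>UNIV. (x a)\<^sup>2)"
    by (rule quadratic_form_below_threshold[OF params beta]) (rule that)
  \<comment> \<open>This makes \<open>c * exp (\<kappa>\<^sup>2 - 1)\<close> equal to the square
    root of \<open>c\<close>, which is below 1, so the mixture series converges.\<close>
  define \<kappa> where "\<kappa> = sqrt (1 - ln c / 2)"
  have lc: "ln c < 0" using c by simp
  have \<kappa>: "\<kappa> > 1" unfolding \<kappa>_def using lc by simp
  have \<kappa>2: "\<kappa>\<^sup>2 = 1 - ln c / 2" unfolding \<kappa>_def using lc by simp
  have "c * exp (\<kappa>\<^sup>2 - 1) = exp (ln c + (\<kappa>\<^sup>2 - 1))" using c by (simp only: exp_add exp_ln)
  also have "\<dots> < 1" unfolding \<kappa>2 using lc by simp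
  finally have summ: "summable (\<lambda>k. mix_weight c k * exp (\<kappa>\<^sup>2 * real k))"
    by (rule summable_mix_weight[OF c(1)])
  define M where "M = suminf (\<lambda>k. mix_weight c k * exp (\<kappa>\<^sup>2 * real k))"
  have partial: "(\<Sum>k\<le>D. mix_weight c k * exp (\<kappa>\<^sup>2 * real k)) \<le> M" for D
    unfolding M_def using c by (intro sum_le_suminf summ) (auto simp: mix_weight_nonneg)
  \<comment> \<open>A common upper bound for the nonnegative diagonal entries.\<close>
  define F where "F = (\<Sum>a\<in>UNIV. ?\<Phi> $ a $ a)"
  define K where "K = exp (\<beta>\<^sup>2 / 2 * F * (R\<^sup>2)\<^sup>2) * (2 * M) ^ CARD('n \<times> 'k \<times> 'k)"
  have \<Phi>0: "0 \<le> ?\<Phi> $ a $ b" for a b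
  proof -
    have "0 < \<Delta>b $ a $ b" using params by (simp add: block_params_def)
    then show ?thesis by (cases "\<Delta>b $ a $ b") (auto simp: recip_profile_def one_ereal_def)
  qed
  have \<Phi>s: "?\<Phi> $ a $ b = ?\<Phi> $ b $ a" for a b
    using params by (simp add: recip_profile_def block_params_def)
  have \<Phi>F: "?\<Phi> $ a $ a \<le> F" for a
    unfolding F_def using \<Phi>0 by (intro member_le_sum) auto
  have \<rho>: "\<rho> $ a > 0" for a using params by (simp add: block_params_def)
  have "M \<ge> 0" using partial[of 0] mix_weight_nonneg[of c 0] c by simp
  then have K0: "K \<ge> 0" by (simp add: K_def)
  \<comment> \<open>The slack \<kappa> > 1 turns convergence of the block proportions into an
    eventual inequality.\<close>
  have "\<forall>\<^sub>F N in sequentially. real (card {i\<in>{1..N}. q N i = a}) / real N < \<kappa> * \<rho> $ a" for a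
    using block_sizes[of a] \<rho>[of a] \<kappa> by (intro order_tendstoD(2)) auto
  then have "\<forall>\<^sub>F N in sequentially. \<forall>a. real (card {i\<in>{1..N}. q N i = a}) / real N < \<kappa> * \<rho> $ a"
    by (rule eventually_all_finite)
  then have "\<forall>\<^sub>F N in sequentially. N \<ge> 1 \<and> (\<forall>D.
      (\<forall>a v. (norm v)\<^sup>2 \<le> 2 * real D * real CARD('k \<times> 'k) / (\<rho> $ a * real N) \<longrightarrow> mgf v \<le> ennreal (exp (\<kappa> / 2 * (norm v)\<^sup>2))) \<longrightarrow>
      (\<integral>\<^sup>+X. \<integral>\<^sup>+X'. ennreal (exp_trunc D \<bar>spiked_model.overlap \<Delta> N X X'\<bar>) \<partial>S N \<partial>S N) \<le> ennreal K)"
    using eventually_ge_at_top[of 1]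
  proof eventually_elim
    case (elim N)
    have N: "N \<ge> 1" by fact
    have card: "real (card {i\<in>{1..N}. q N i = a}) \<le> \<kappa> * (\<rho> $ a * real N)" for a
      using elim(1)[rule_format, of a] N by (simp add: field_simps)
    show ?case
    proof (intro conjI N allI impI)
      fix D
      assume "\<forall>a v. (norm v)\<^sup>2 \<le> 2 * real D * real CARD('k \<times> 'k) / (\<rho> $ a * real N) \<longrightarrow> mgf v \<le> ennreal (exp (\<kappa> / 2 * (norm v)\<^sup>2))"
      then have mgf_le: "\<And>a v. (norm v)\<^sup>2 \<le> 2 * real D * real CARD('k \<times> 'k) / (\<rho> $ a * real N) \<Longrightarrow> mgf v \<le> ennreal (exp (\<kappa> / 2 * (norm v)\<^sup>2))"
        by blast
      have "(\<lambda>y. exp_trunc D \<bar>y\<bar>) \<in> borel_measurable borel" unfolding exp_trunc_def by measurable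
      then have "(\<integral>\<^sup>+X. \<integral>\<^sup>+X'. ennreal (exp_trunc D \<bar>spiked_model.overlap \<Delta> N X X'\<bar>) \<partial>S N \<partial>S N) =
        (\<integral>\<^sup>+V. \<integral>\<^sup>+V'. ennreal (exp_trunc D \<bar>\<Sum>(i, j)\<in>upper_pairs N. \<beta>\<^sup>2 / real N * ?\<Phi> $ q N i $ q N j *
          (tensor (V i) (V' i) \<bullet> tensor (V j) (V' j))\<bar>) \<partial>iid_rows \<nu> N \<partial>iid_rows \<nu> N)"
        by (rule nn_integral_overlap_spike[OF N])
      also have "\<dots> \<le> ennreal (exp (\<beta>\<^sup>2 / 2 * F * (R\<^sup>2)\<^sup>2) * (2 * (\<Sum>k\<le>D. mix_weight c k * exp (\<kappa>\<^sup>2 * real k))) ^ CARD('n \<times> 'k \<times> 'k))"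
        by (rule nn_integral_exp_trunc_overlap_le[OF N \<rho> \<Phi>0 \<Phi>s \<Phi>F quad less_imp_le[OF c(1)] \<kappa> card mgf_le])
      also have "\<dots> \<le> ennreal K"
        unfolding K_def using partial c
        by (intro ennreal_leI mult_left_mono power_mono) (auto intro!: sum_nonneg mult_nonneg_nonneg mix_weight_nonneg)
      finally show "(\<integral>\<^sup>+X. \<integral>\<^sup>+X'. ennreal (exp_trunc D \<bar>spiked_model.overlap \<Delta> N X X'\<bar>) \<partial>S N \<partial>S N) \<le> ennreal K" .
    qed
  qed
  then show thesis by (rule that[OF \<kappa> K0])
qed

lemma planted_eq: "planted_law \<Delta> (spike_law \<beta> \<nu>) N = spiked_model.P \<Delta> N (S N)"
  using spiked_model.P_def[OF spiked] by (simp add: planted_law_def)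

text \<open>The degree hypothesis enters as D \<le> \<epsilon> N for large \<open>N\<close>, which
  places all tilts in the neighbourhood where the local bound on \<open>mgf\<close> holds.\<close>

lemma no_low_degree_separation:
  fixes p :: "nat \<Rightarrow> mpoly"
  assumes vars: "\<forall>N\<ge>1. mpoly_vars (p N) \<subseteq> observed \<Delta> N"
    and deg: "(\<lambda>N. real (mpoly_degree (p N))) \<in> o(\<lambda>N. real N / ln (real N))"
  shows "\<not> strong_separation (planted_law \<Delta> (spike_law \<beta> \<nu>)) (null_law \<Delta>) (\<lambda>N. mpoly_eval (p N))"
proof -
  obtain \<kappa> K where \<kappa>: "\<kappa> > 1" and K: "K \<ge> 0" and ev:
    "\<forall>\<^sub>F N in sequentially. N \<ge> 1 \<and> (\<forall>D.
      (\<forall>a v. (norm v)\<^sup>2 \<le> 2 * real D * real CARD('k \<times> 'k) / (\<rho> $ a * real N) \<longrightarrow> mgf v \<le> ennreal (exp (\<kappa> / 2 * (norm v)\<^sup>2))) \<longrightarrow>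
      (\<integral>\<^sup>+X. \<integral>\<^sup>+X'. ennreal (exp_trunc D \<bar>spiked_model.overlap \<Delta> N X X'\<bar>) \<partial>S N \<partial>S N) \<le> ennreal K)"
    by (rule overlap_moments_bounded)
  obtain \<eta> where \<eta>: "\<eta> > 0" "\<And>v :: real ^ ('k \<times> 'k). norm v \<le> \<eta> \<Longrightarrow> mgf v \<le> ennreal (exp (\<kappa> / 2 * (norm v)\<^sup>2))"
    using mgf_le_local[OF \<kappa>] by blast
  define r where "r = Min (range (\<lambda>a. \<rho> $ a))"
  have r: "r > 0" "r \<le> \<rho> $ a" for a
    using params unfolding r_def block_params_def by (auto simp: Min_gr_iff)
  define C where "C = real CARD('k \<times> 'k)"
  have C: "C > 0" by (simp add: C_def)
  \<comment> \<open>Solved from 2 (\<epsilon> N) C / (r N) = \<eta>^2, where \<open>r\<close> is the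
    smallest block weight.\<close>
  define \<epsilon> where "\<epsilon> = \<eta>\<^sup>2 * r / (2 * C)"
  have \<epsilon>: "\<epsilon> > 0" using \<eta> r C by (simp add: \<epsilon>_def)
  have "\<forall>\<^sub>F N in sequentially. norm (real (mpoly_degree (p N))) \<le> \<epsilon> * norm (real N / ln (real N))"
    by (rule landau_o.smallD[OF deg \<epsilon>])
  then have "\<forall>\<^sub>F N in sequentially. (\<integral>y. mpoly_eval (p N) y \<partial>planted_law \<Delta> (spike_law \<beta> \<nu>) N) - (\<integral>y. mpoly_eval (p N) y \<partial>null_law \<Delta> N)
    \<le> sqrt K * sqrt (var (null_law \<Delta> N) (mpoly_eval (p N)))"
    using ev eventually_ge_at_top[of 3]
  proof eventually_elim
    case (elim N)
    interpret spiked_model \<Delta> N "S N" by (rule spiked)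
    have N: "N \<ge> 1" using elim by simp
    define D where "D = mpoly_degree (p N)"
    \<comment> \<open>\<open>N \<ge> 3\<close> exceeds e, so the logarithm is at least 1 and may be
      dropped from the degree bound.\<close>
    have "exp 1 \<le> real N" using elim(3) exp_le by linarith
    then have ln: "ln (real N) \<ge> 1" using N by (subst ln_ge_iff) auto
    have "real D \<le> \<epsilon> * (real N / ln (real N))" using elim(1) ln by (simp add: D_def)
    also have "\<dots> \<le> \<epsilon> * real N"
      using \<epsilon> ln mult_left_mono[OF ln, of "real N"] by (intro mult_left_mono) (auto simp: divide_le_eq)
    finally have D: "real D \<le> \<epsilon> * real N" .
    have "mgf v \<le> ennreal (exp (\<kappa> / 2 * (norm v)\<^sup>2))"
      if v: "(norm v)\<^sup>2 \<le> 2 * real D * real CARD('k \<times> 'k) / (\<rho> $ a * real N)" for a and v :: "real ^ ('k \<times> 'k)"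
    proof (rule \<eta>(2))
      have "(norm v)\<^sup>2 \<le> 2 * real D * C / (\<rho> $ a * real N)" using v unfolding C_def .
      also have "\<dots> \<le> 2 * (\<epsilon> * real N) * C / (r * real N)"
        using D C r(1) r(2)[of a] N \<epsilon> by (intro frac_le mult_mono) auto
      also have "\<dots> = \<eta>\<^sup>2" using N C r by (simp add: \<epsilon>_def)
      finally show "norm v \<le> \<eta>" using \<eta>(1) by (rule power2_le_imp_le[OF _ less_imp_le])
    qed
    note mgf_le = this
    have le: "(\<integral>\<^sup>+X. \<integral>\<^sup>+X'. ennreal (exp_trunc D \<bar>overlap X X'\<bar>) \<partial>S N \<partial>S N) \<le> ennreal K"
      by (rule conjunct2[OF elim(2), rule_format, of D]) (rule mgf_le)
    obtain B where B: "AE X in S N. \<forall>p\<in>J. \<bar>X p\<bar> \<le> B" using AE_spike_bounded by blast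
    show ?case unfolding planted_eq
      using mpoly_mean_difference_le[OF B K le, of "p N"] vars N by (simp add: D_def)
  qed
  then show ?thesis by (rule not_strong_separation) (use K in simp)
qed

text \<open>Under (d) the bound on \<open>mgf\<close> holds for every \<open>v\<close>, so the
  truncated moments are bounded for all \<open>D\<close> at the same \<open>N\<close>.\<close>

lemma second_moment_bounded:
  assumes sg: "moment_subgaussian_vec (\<nu> \<Otimes>\<^sub>M \<nu>) 1 (\<lambda>(x, x'). tensor x x')"
  obtains K where "K \<ge> 0"
    "\<forall>\<^sub>F N in sequentially. N \<ge> 1 \<and> (\<integral>\<^sup>+Y. (spiked_model.avg_lr \<Delta> N (S N) Y)\<^sup>2 \<partial>null_law \<Delta> N) \<le> ennreal K"
proof -
  obtain \<kappa> K where \<kappa>: "\<kappa> > 1" and K: "K \<ge> 0" and ev: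
    "\<forall>\<^sub>F N in sequentially. N \<ge> 1 \<and> (\<forall>D.
      (\<forall>a v. (norm v)\<^sup>2 \<le> 2 * real D * real CARD('k \<times> 'k) / (\<rho> $ a * real N) \<longrightarrow> mgf v \<le> ennreal (exp (\<kappa> / 2 * (norm v)\<^sup>2))) \<longrightarrow>
      (\<integral>\<^sup>+X. \<integral>\<^sup>+X'. ennreal (exp_trunc D \<bar>spiked_model.overlap \<Delta> N X X'\<bar>) \<partial>S N \<partial>S N) \<le> ennreal K)"
    by (rule overlap_moments_bounded)
  have mgf_le: "mgf v \<le> ennreal (exp (\<kappa> / 2 * (norm v)\<^sup>2))" for v
  proof -
    have "(norm v)\<^sup>2 / 2 \<le> \<kappa> / 2 * (norm v)\<^sup>2" using \<kappa> mult_right_mono[of 1 \<kappa> "(norm v)\<^sup>2"] by simp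
    then show ?thesis using mgf_le_global[OF sg, of v] by (elim order_trans) (simp add: ennreal_leI)
  qed
  have "\<forall>\<^sub>F N in sequentially. N \<ge> 1 \<and> (\<integral>\<^sup>+Y. (spiked_model.avg_lr \<Delta> N (S N) Y)\<^sup>2 \<partial>null_law \<Delta> N) \<le> ennreal K"
    using ev
  proof eventually_elim
    case (elim N)
    then show ?case
      by (intro conjI spiked_model.nn_integral_avg_lr_square_le[OF spiked]) (use mgf_le in auto)
  qed
  then show thesis by (rule that[OF K])
qed

section \<open>Statistical lower bound\<close>

context
  assumes sg: "moment_subgaussian_vec (\<nu> \<Otimes>\<^sub>M \<nu>) 1 (\<lambda>(x, x'). tensor x x')"
begin

lemma no_separation:
  "\<not> strong_separation (planted_law \<Delta> (spike_law \<beta> \<nu>)) (null_law \<Delta>) f"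
proof
  \<comment> \<open>The assumption is made first because it provides the square integrability
    required by \<open>mean_difference_le\<close>.\<close>
  assume sep: "strong_separation (planted_law \<Delta> (spike_law \<beta> \<nu>)) (null_law \<Delta>) f"
  obtain K where K: "K \<ge> 0" and ev:
    "\<forall>\<^sub>F N in sequentially. N \<ge> 1 \<and> (\<integral>\<^sup>+Y. (spiked_model.avg_lr \<Delta> N (S N) Y)\<^sup>2 \<partial>null_law \<Delta> N) \<le> ennreal K"
    by (rule second_moment_bounded[OF sg])
  have le: "\<forall>\<^sub>F N in sequentially. (\<integral>y. f N y \<partial>planted_law \<Delta> (spike_law \<beta> \<nu>) N) - (\<integral>y. f N y \<partial>null_law \<Delta> N)
    \<le> sqrt K * sqrt (var (null_law \<Delta> N) (f N))"
    using ev
  proof eventually_elim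
    case (elim N)
    then have "square_integrable (planted_law \<Delta> (spike_law \<beta> \<nu>) N) (f N)" "square_integrable (null_law \<Delta> N) (f N)"
      using sep by (auto simp: strong_separation_def)
    then show ?case unfolding planted_eq
      using spiked_model.mean_difference_le[OF spiked _ _ K] elim by blast
  qed
  show False using sep not_strong_separation[OF le] K by simp
qed

text \<open>A successful test would make its acceptance region null under \<open>Q\<close> and
  almost sure under \<open>P\<close> in the limit, against contiguity. Quantitatively 1 \<le> (2 +
  K) times the total error, which cannot tend to 0.\<close>

lemma no_detection:
  "\<not> strong_detection (planted_law \<Delta> (spike_law \<beta> \<nu>)) (null_law \<Delta>) t"
proof
  assume det: "strong_detection (planted_law \<Delta> (spike_law \<beta> \<nu>)) (null_law \<Delta>) t"
  define err where "err N = measure (planted_law \<Delta> (spike_law \<beta> \<nu>) N) {y \<in> space (planted_law \<Delta> (spike_law \<beta> \<nu>) N). t N y = 0}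
    + measure (null_law \<Delta> N) {y \<in> space (null_law \<Delta> N). t N y = 1}" for N
  have err: "err \<longlonglongrightarrow> 0" using det unfolding strong_detection_def err_def by blast
  obtain K where K: "K \<ge> 0" and ev:
    "\<forall>\<^sub>F N in sequentially. N \<ge> 1 \<and> (\<integral>\<^sup>+Y. (spiked_model.avg_lr \<Delta> N (S N) Y)\<^sup>2 \<partial>null_law \<Delta> N) \<le> ennreal K"
    by (rule second_moment_bounded[OF sg])
  have "\<forall>\<^sub>F N in sequentially. 1 \<le> 2 * err N + K * err N"
    using ev
  proof eventually_elim
    case (elim N)
    interpret spiked_model \<Delta> N "S N" by (rule spiked)
    interpret P: prob_space P by (rule prob_P)
    have tm: "t N \<in> measurable P (count_space {0, 1})" "t N \<in> measurable Q (count_space {0, 1})"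
      using det elim unfolding strong_detection_def planted_eq by auto
    have sp: "space P = space Q" using sets_eq_imp_space_eq[OF sets_P] sets_eq_imp_space_eq[OF sets_Q] by simp
    define A where "A = {y \<in> space Q. t N y = 1}"
    have "t N -` {1} \<inter> space Q \<in> sets Q" using tm(2) by (rule measurable_sets) simp
    then have A: "A \<in> sets Q" unfolding A_def by (simp add: vimage_def Int_def conj_commute)
    then have AP: "A \<in> P.events" by (simp add: sets_P)
    have e: "{y \<in> space P. t N y = 0} = space P - A"
      using measurable_space[OF tm(1)] by (auto simp: A_def sp)
    have err_eq: "err N = (1 - P.prob A) + measure Q A"
      unfolding err_def planted_eq e A_def[symmetric] by (simp only: P.prob_compl[OF AP])
    have 1: "(P.prob A)\<^sup>2 \<le> K * measure Q A" using elim by (intro measure_P_square_le[OF A K]) simp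
    \<comment> \<open>Linearising the square at 1 allows the final combination of the two
      inequalities to be linear in the error.\<close>
    have 2: "2 * P.prob A - 1 \<le> (P.prob A)\<^sup>2"
      using zero_le_power2[of "1 - P.prob A"] by (simp add: power2_eq_square algebra_simps)
    have 3: "K * measure Q A \<le> K * err N"
      unfolding err_eq using K by (intro mult_left_mono) (auto simp: P.prob_le_1)
    have "1 - P.prob A \<le> err N" unfolding err_eq by simp
    moreover have "2 * P.prob A - 1 \<le> K * err N" by (rule order_trans[OF 2 order_trans[OF 1 3]])
    ultimately show ?case by linarith
  qed
  moreover have "(\<lambda>N. 2 * err N + K * err N) \<longlonglongrightarrow> 2 * 0 + K * 0"
    by (intro tendsto_intros err)
  ultimately have "1 \<le> 2 * 0 + K * (0 :: real)"
    by (intro tendsto_lowerbound[of "\<lambda>N. 2 * err N + K * err N" _ sequentially]) auto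
  then show False by simp
qed

lemma chi_squared_bounded:
  "\<exists>C :: real. \<forall>\<^sub>F N in sequentially. chi_squared (planted_law \<Delta> (spike_law \<beta> \<nu>) N) (null_law \<Delta> N) \<le> ennreal C"
proof -
  obtain K where K: "K \<ge> 0" and ev:
    "\<forall>\<^sub>F N in sequentially. N \<ge> 1 \<and> (\<integral>\<^sup>+Y. (spiked_model.avg_lr \<Delta> N (S N) Y)\<^sup>2 \<partial>null_law \<Delta> N) \<le> ennreal K"
    by (rule second_moment_bounded[OF sg])
  have "\<forall>\<^sub>F N in sequentially. chi_squared (planted_law \<Delta> (spike_law \<beta> \<nu>) N) (null_law \<Delta> N) \<le> ennreal (K + 1)"
    using ev
  proof eventually_elim
    case (elim N)
    have "chi_squared (planted_law \<Delta> (spike_law \<beta> \<nu>) N) (null_law \<Delta> N) \<le> (\<integral>\<^sup>+Y. (spiked_model.avg_lr \<Delta> N (S N) Y)\<^sup>2 \<partial>null_law \<Delta> N) + 1"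
      unfolding planted_eq by (rule spiked_model.chi_squared_le[OF spiked])
    also have "\<dots> \<le> ennreal K + 1" using elim by (intro add_right_mono) simp
    finally show ?case using K by simp
  qed
  then show ?thesis by blast
qed

end

end

theorem theorem1p10:
  fixes \<Delta> :: "nat \<Rightarrow> nat \<Rightarrow> nat \<Rightarrow> ereal"
    and \<Delta>b :: "ereal ^ 'n ^ 'n"
    and \<rho> :: "real ^ 'n"
    and \<nu> :: "(real ^ 'k) measure"
    and \<beta> :: real
  assumes block: "block_structured \<Delta> \<Delta>b \<rho>"
    and prob: "prob_space \<nu>" and borel: "sets \<nu> = sets borel"
    and beta: "\<beta> > 0"
  shows
    "((\<integral>x. x \<partial>\<nu>) = 0 \<and> spectral_norm (cov_matrix \<nu>) \<le> 1 \<and> bounded (measure_support \<nu>) \<and>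
      ereal \<beta> < beta_star \<Delta>b \<rho> \<longrightarrow>
        \<not> (\<exists>p :: nat \<Rightarrow> mpoly.
              (\<forall>N\<ge>1. mpoly_vars (p N) \<subseteq> observed \<Delta> N) \<and>
              (\<lambda>N. real (mpoly_degree (p N))) \<in> o(\<lambda>N. real N / ln (real N)) \<and>
              strong_separation (planted_law \<Delta> (spike_law \<beta> \<nu>)) (null_law \<Delta>) (\<lambda>N. mpoly_eval (p N))))
     \<and>
     ((\<integral>x. x \<partial>\<nu>) = 0 \<and> spectral_norm (cov_matrix \<nu>) \<le> 1 \<and> bounded (measure_support \<nu>) \<and>
      moment_subgaussian_vec (\<nu> \<Otimes>\<^sub>M \<nu>) 1 (\<lambda>(x, x'). tensor x x') \<and>
      ereal \<beta> < beta_star \<Delta>b \<rho> \<longrightarrow>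
        \<not> (\<exists>f. strong_separation (planted_law \<Delta> (spike_law \<beta> \<nu>)) (null_law \<Delta>) f) \<and>
        \<not> (\<exists>t. strong_detection (planted_law \<Delta> (spike_law \<beta> \<nu>)) (null_law \<Delta>) t) \<and>
        (\<exists>C :: real. \<forall>\<^sub>F N in sequentially.
            chi_squared (planted_law \<Delta> (spike_law \<beta> \<nu>) N) (null_law \<Delta> N) \<le> ennreal C))"
proof -
  obtain q where params: "block_params \<Delta>b \<rho>"
    and q: "\<And>N i j. N \<ge> 1 \<Longrightarrow> i \<in> {1..N} \<Longrightarrow> j \<in> {1..N} \<Longrightarrow> \<Delta> N i j = \<Delta>b $ q N i $ q N j"
    and sizes: "\<And>a. (\<lambda>N. real (card {i\<in>{1..N}. q N i = a}) / real N) \<longlonglongrightarrow> \<rho> $ a"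
    using block unfolding block_structured_def by blast
  have model: "\<exists>R. block_model \<nu> R \<Delta> \<Delta>b \<rho> \<beta> q"
    if "(\<integral>x. x \<partial>\<nu>) = 0" "spectral_norm (cov_matrix \<nu>) \<le> 1" "bounded (measure_support \<nu>)" "ereal \<beta> < beta_star \<Delta>b \<rho>"
  proof -
    obtain R where R: "\<And>x. x \<in> measure_support \<nu> \<Longrightarrow> norm x \<le> R"
      using \<open>bounded (measure_support \<nu>)\<close> by (auto simp: bounded_iff)
    \<comment> \<open>Bounded support becomes an almost sure bound because the support carries the
      full mass.\<close>
    have "AE x in \<nu>. norm x \<le> R"
      using AE_measure_support[OF borel] by eventually_elim (rule R)
    then have "row_law \<nu> R"
      unfolding row_law_def row_law_axioms_def using prob borel that by blast
    \<comment> \<open>For \<open>N = 0\<close> the index ranges are empty, so \<open>q\<close> gives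
      the profile for every \<open>N\<close>.\<close>
    moreover have "block_model_axioms \<Delta> \<Delta>b \<rho> \<beta> q"
      unfolding block_model_axioms_def using params sizes beta that
      by (auto intro!: q)
    ultimately show ?thesis unfolding block_model_def by blast
  qed
  show ?thesis
  proof (intro conjI impI)
    assume "(\<integral>x. x \<partial>\<nu>) = 0 \<and> spectral_norm (cov_matrix \<nu>) \<le> 1 \<and> bounded (measure_support \<nu>) \<and> ereal \<beta> < beta_star \<Delta>b \<rho>"
    then obtain R where "block_model \<nu> R \<Delta> \<Delta>b \<rho> \<beta> q" using model by blast
    then interpret block_model \<nu> R \<Delta> \<Delta>b \<rho> \<beta> q .
    show "\<not> (\<exists>p :: nat \<Rightarrow> mpoly.
              (\<forall>N\<ge>1. mpoly_vars (p N) \<subseteq> observed \<Delta> N) \<and>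
              (\<lambda>N. real (mpoly_degree (p N))) \<in> o(\<lambda>N. real N / ln (real N)) \<and>
              strong_separation (planted_law \<Delta> (spike_law \<beta> \<nu>)) (null_law \<Delta>) (\<lambda>N. mpoly_eval (p N)))"
      using no_low_degree_separation by blast
  next
    assume *: "(\<integral>x. x \<partial>\<nu>) = 0 \<and> spectral_norm (cov_matrix \<nu>) \<le> 1 \<and> bounded (measure_support \<nu>) \<and>
      moment_subgaussian_vec (\<nu> \<Otimes>\<^sub>M \<nu>) 1 (\<lambda>(x, x'). tensor x x') \<and> ereal \<beta> < beta_star \<Delta>b \<rho>"
    then obtain R where "block_model \<nu> R \<Delta> \<Delta>b \<rho> \<beta> q" using model by blast
    then interpret block_model \<nu> R \<Delta> \<Delta>b \<rho> \<beta> q .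
    have sg: "moment_subgaussian_vec (\<nu> \<Otimes>\<^sub>M \<nu>) 1 (\<lambda>(x, x'). tensor x x')" using * by blast
    show "\<not> (\<exists>f. strong_separation (planted_law \<Delta> (spike_law \<beta> \<nu>)) (null_law \<Delta>) f)"
      using no_separation[OF sg] by blast
    show "\<not> (\<exists>t. strong_detection (planted_law \<Delta> (spike_law \<beta> \<nu>)) (null_law \<Delta>) t)"
      using no_detection[OF sg] by blast
    show "\<exists>C :: real. \<forall>\<^sub>F N in sequentially.
            chi_squared (planted_law \<Delta> (spike_law \<beta> \<nu>) N) (null_law \<Delta> N) \<le> ennreal C"
      by (rule chi_squared_bounded[OF sg])
  qed
qed

end
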